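(* Let $\Omega$ be any open set in $\mathbb R^n$, $n \geq 2$. There exists a constant $C=C(n)$, depending only on $n$, such that $$|\mathbf u(x)| \leq C \int_{\mathbb S^{n-1}} |\mathbf u(\zeta(x,\vartheta))|\, d\mathcal H^{n-1}(\vartheta) + C\int_\Omega \frac{|\mathcal E\mathbf u(y)|}{|x-y|^{n-1}}\, dy \qquad \text{for } x\in\Omega,$$ for every function $\mathbf u \in E^{1,1}(\Omega)\cap C_b(\overline\Omega)$. Here $\mathbf u(\zeta(x,\vartheta))$ is understood to be $0$ whenever the ray $\{x+t\vartheta : t>0\}$ does not meet $\partial\Omega$.
   Context: Functions $\mathbf u$ are $\mathbb R^n$-valued. $\mathcal E\mathbf u=\tfrac12(\nabla\mathbf u+(\nabla\mathbf u)^T)$ is the symmetric part of the distributional gradient $\nabla \mathbf u$. $E^{1,1}(\Omega)=\{\mathbf u\in L^1_{\rm loc}(\Omega): |\mathcal E\mathbf u|\in L^1(\Omega)\}$. $C_b(\overline\Omega)$ is the set of functions that are continuous in $\overline\Omega$ and have bounded support. $\mathbb S^{n-1}$ is the unit sphere in $\mathbb R^n$ and $\mathcal H^{n-1}$ is the $(n-1)$-dimensional Hausdorff measure. For $x\in\Omega$, let $(\partial\Omega)_x=\{y\in\partial\Omega: (1-t)x+ty\in\Omega \text{ for every } t\in(0,1)\}$. For $(x,\vartheta)\in\Omega\times\mathbb S^{n-1}$ such that $x+t\vartheta\in\partial\Omega$ for some $t>0$, define $\zeta(x,\vartheta)=x+t\vartheta$, where $t>0$ is such that $x+t\vartheta\in(\partial\Omega)_x$;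 that is, $\zeta(x,\vartheta)$ is the first point of $\partial\Omega$ on the ray issued from $x$ in direction $\vartheta$. For all other $(x,\vartheta)$ (the ray does not meet $\partial\Omega$) one sets, by convention, $g(\zeta(x,\vartheta))=0$ for any function $g$ on $\partial\Omega$ with compact support. *)

theory Defs
  imports "HOL-Analysis.Analysis"
begin

section \<open>Hausdorff measure\<close>

definition hausdorff_weight :: "nat \<Rightarrow> 'a::metric_space set \<Rightarrow> ennreal" where
  "hausdorff_weight k U =
     (if U = {} then 0 else ennreal (unit_ball_vol (real k) * (diameter U / 2) ^ k))"

text \<open>\<^const>\<open>diameter\<close> is real-valued and meaningful only on bounded sets, so
  boundedness of the covering sets is required explicitly.\<close>

definition hausdorff_covers :: "real \<Rightarrow> 'a::metric_space set \<Rightarrow> (nat \<Rightarrow> 'a set) set" where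
  "hausdorff_covers \<delta> A =
     {U. A \<subseteq> (\<Union>i. U i) \<and> (\<forall>i. bounded (U i) \<and> diameter (U i) \<le> \<delta>)}"

definition hausdorff_premeasure :: "nat \<Rightarrow> real \<Rightarrow> 'a::metric_space set \<Rightarrow> ennreal" where
  "hausdorff_premeasure k \<delta> A =
     (INF U \<in> hausdorff_covers \<delta> A. \<Sum>i. hausdorff_weight k (U i))"

definition hausdorff_outer :: "nat \<Rightarrow> 'a::metric_space set \<Rightarrow> ennreal" where
  "hausdorff_outer k A = (SUP \<delta>\<in>{0<..}. hausdorff_premeasure k \<delta> A)"

text \<open>\<^const>\<open>measure_of\<close> would yield the zero measure if the set function were not
  countably additive; lemma \<open>emeasure_hausdorff_measure\<close> below rules this out.\<close>

definition hausdorff_measure :: "nat \<Rightarrow> 'a::metric_space measure" where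
  "hausdorff_measure k = measure_of UNIV (sets borel) (hausdorff_outer k)"

lemma hausdorff_weight_empty [simp]: "hausdorff_weight k {} = 0"
  by (simp add: hausdorff_weight_def)

lemma hausdorff_premeasure_le:
  "U \<in> hausdorff_covers \<delta> A \<Longrightarrow> hausdorff_premeasure k \<delta> A \<le> (\<Sum>i. hausdorff_weight k (U i))"
  unfolding hausdorff_premeasure_def by (rule INF_lower)

lemma hausdorff_premeasure_mono:
  "A \<subseteq> B \<Longrightarrow> \<delta>' \<le> \<delta> \<Longrightarrow> hausdorff_premeasure k \<delta> A \<le> hausdorff_premeasure k \<delta>' B"
  unfolding hausdorff_premeasure_def hausdorff_covers_def
  by (rule INF_superset_mono) (auto intro: order_trans)

lemma hausdorff_premeasure_empty: "0 < \<delta> \<Longrightarrow> hausdorff_premeasure k \<delta> {} = 0"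
  using hausdorff_premeasure_le[of "\<lambda>_. {}" \<delta> "{}" k] by (simp add: hausdorff_covers_def)

lemma hausdorff_premeasure_subadditive:
  fixes A :: "nat \<Rightarrow> 'a::metric_space set"
  shows "hausdorff_premeasure k \<delta> (\<Union>n. A n) \<le> (\<Sum>n. hausdorff_premeasure k \<delta> (A n))"
proof (rule ennreal_le_epsilon)
  let ?O = "hausdorff_premeasure k \<delta>"
  fix e :: real assume e: "0 < e" and fin: "(\<Sum>n. ?O (A n)) < top"
  have "\<exists>U \<in> hausdorff_covers \<delta> (A n). (\<Sum>i. hausdorff_weight k (U i)) \<le> ?O (A n) + e * (1/2)^Suc n" for n
  proof -
    have "?O (A n) < top"
      using fin by (auto simp add: less_top dest!: ennreal_suminf_lessD)
    with e have "?O (A n) < ?O (A n) + ennreal (e * (1/2)^Suc n)"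
      by (auto simp: less_top)
    then show ?thesis
      unfolding hausdorff_premeasure_def INF_less_iff by (auto intro: less_imp_le)
  qed
  then obtain B where B: "\<And>n. B n \<in> hausdorff_covers \<delta> (A n)"
    and le: "\<And>n. (\<Sum>i. hausdorff_weight k (B n i)) \<le> ?O (A n) + e * (1/2)^Suc n"
    by metis
  define C where "C = case_prod B o prod_decode"
  have "C \<in> hausdorff_covers \<delta> (\<Union>n. A n)"
    unfolding hausdorff_covers_def
  proof (intro CollectI conjI allI subsetI)
    fix x assume "x \<in> (\<Union>n. A n)"
    then obtain n i where "x \<in> B n i" using B unfolding hausdorff_covers_def by blast
    then have "x \<in> C (prod_encode (n, i))" by (simp add: C_def)
    then show "x \<in> (\<Union>i. C i)" by blast
  next
    show "bounded (C i)" "diameter (C i) \<le> \<delta>" for i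
      using B by (auto simp: hausdorff_covers_def C_def split_def)
  qed
  then have "?O (\<Union>n. A n) \<le> (\<Sum>i. hausdorff_weight k (C i))"
    by (rule hausdorff_premeasure_le)
  also have "\<dots> = (\<Sum>i. (\<lambda>p. hausdorff_weight k (case_prod B p)) (prod_decode i))"
    by (simp add: C_def)
  also have "\<dots> = (\<Sum>n. \<Sum>i. hausdorff_weight k (B n i))"
    by (rule suminf_ennreal_2dimen) simp
  also have "\<dots> \<le> (\<Sum>n. ?O (A n) + e * (1/2) ^ Suc n)"
    by (intro suminf_le le) auto
  also have "\<dots> = (\<Sum>n. ?O (A n)) + (\<Sum>n. ennreal e * ennreal ((1/2) ^ Suc n))"
    using e by (subst suminf_add[symmetric])
      (auto simp del: ennreal_suminf_cmult simp add: ennreal_mult[symmetric])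
  also have "\<dots> = (\<Sum>n. ?O (A n)) + e"
    unfolding ennreal_suminf_cmult
    by (subst suminf_ennreal_eq[OF zero_le_power power_half_series]) auto
  finally show "?O (\<Union>n. A n) \<le> (\<Sum>n. ?O (A n)) + e" .
qed

lemma hausdorff_outer_ge: "0 < \<delta> \<Longrightarrow> hausdorff_premeasure k \<delta> A \<le> hausdorff_outer k A"
  unfolding hausdorff_outer_def by (rule SUP_upper) simp

lemma hausdorff_outer_mono: "A \<subseteq> B \<Longrightarrow> hausdorff_outer k A \<le> hausdorff_outer k B"
  unfolding hausdorff_outer_def by (rule SUP_mono) (auto intro: hausdorff_premeasure_mono)

lemma hausdorff_outer_empty [simp]: "hausdorff_outer k {} = 0"
  unfolding hausdorff_outer_def by (simp add: hausdorff_premeasure_empty)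

lemma hausdorff_outer_subadditive:
  "hausdorff_outer k (\<Union>n::nat. A n) \<le> (\<Sum>n. hausdorff_outer k (A n))"
  unfolding hausdorff_outer_def[of k "\<Union>n. A n"]
proof (rule SUP_least)
  fix \<delta> :: real assume "\<delta> \<in> {0<..}"
  then show "hausdorff_premeasure k \<delta> (\<Union>n. A n) \<le> (\<Sum>n. hausdorff_outer k (A n))"
    by (intro order_trans[OF hausdorff_premeasure_subadditive] suminf_le hausdorff_outer_ge) auto
qed

lemma outer_measure_space_hausdorff: "outer_measure_space UNIV (hausdorff_outer k)"
  by (simp add: outer_measure_space_def positive_def increasing_def countably_subadditive_def
      hausdorff_outer_mono hausdorff_outer_subadditive)

lemma hausdorff_outer_Un: "hausdorff_outer k (A \<union> B) \<le> hausdorff_outer k A + hausdorff_outer k B"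
proof -
  have "hausdorff_outer k (\<Union>n. (\<lambda>n::nat. if n = 0 then A else if n = 1 then B else {}) n) \<le>
     (\<Sum>n. hausdorff_outer k ((\<lambda>n::nat. if n = 0 then A else if n = 1 then B else {}) n))"
    by (rule hausdorff_outer_subadditive)
  also have "(\<Union>n. (\<lambda>n::nat. if n = 0 then A else if n = 1 then B else {}) n) = A \<union> B"
    by (auto split: if_splits)
  also have "(\<Sum>n. hausdorff_outer k ((\<lambda>n::nat. if n = 0 then A else if n = 1 then B else {}) n))
     = hausdorff_outer k A + hausdorff_outer k B"
    by (subst suminf_finite[of "{0,1}"]) auto
  finally show ?thesis .
qed

lemma hausdorff_outer_separated:
  fixes A B :: "'a::metric_space set"
  assumes d: "0 < d" and sep: "\<And>a b. a \<in> A \<Longrightarrow> b \<in> B \<Longrightarrow> d \<le> dist a b"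
  shows "hausdorff_outer k A + hausdorff_outer k B \<le> hausdorff_outer k (A \<union> B)"
proof -
  have small: "hausdorff_premeasure k \<delta> A + hausdorff_premeasure k \<delta> B \<le> hausdorff_premeasure k \<delta> (A \<union> B)"
    if \<delta>: "0 < \<delta>" "\<delta> < d" for \<delta>
    unfolding hausdorff_premeasure_def[of k \<delta> "A \<union> B"]
  proof (rule INF_greatest)
    fix U assume U: "U \<in> hausdorff_covers \<delta> (A \<union> B)"
    define V where "V i = (if U i \<inter> A \<noteq> {} then U i else {})" for i
    define W where "W i = (if U i \<inter> B \<noteq> {} then U i else {})" for i
    have disj: "U i \<inter> A = {} \<or> U i \<inter> B = {}" for i
    proof (rule ccontr)
      assume "\<not> ?thesis"
      then obtain a b where ab: "a \<in> A" "a \<in> U i" "b \<in> B" "b \<in> U i" by auto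
      from U have "bounded (U i)" "diameter (U i) \<le> \<delta>" by (auto simp: hausdorff_covers_def)
      with ab have "dist a b \<le> \<delta>"
        using diameter_bounded_bound[of "U i" a b] by simp
      with sep[OF ab(1,3)] \<delta> show False by simp
    qed
    have V: "V \<in> hausdorff_covers \<delta> A" and W: "W \<in> hausdorff_covers \<delta> B"
      using U \<delta> by (fastforce simp: hausdorff_covers_def V_def W_def)+
    have "hausdorff_premeasure k \<delta> A + hausdorff_premeasure k \<delta> B
        \<le> (\<Sum>i. hausdorff_weight k (V i)) + (\<Sum>i. hausdorff_weight k (W i))"
      by (intro add_mono hausdorff_premeasure_le V W)
    also have "\<dots> = (\<Sum>i. hausdorff_weight k (V i) + hausdorff_weight k (W i))"
      by (rule suminf_add) auto
    also have "\<dots> \<le> (\<Sum>i. hausdorff_weight k (U i))"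
    proof (rule suminf_le)
      show "hausdorff_weight k (V i) + hausdorff_weight k (W i) \<le> hausdorff_weight k (U i)" for i
        using disj[of i] by (auto simp: V_def W_def)
    qed auto
    finally show "hausdorff_premeasure k \<delta> A + hausdorff_premeasure k \<delta> B
      \<le> (\<Sum>i. hausdorff_weight k (U i))" .
  qed
  have "hausdorff_outer k A + hausdorff_outer k B
      = (SUP \<delta>\<in>{0<..}. hausdorff_premeasure k \<delta> A + hausdorff_premeasure k \<delta> B)"
    unfolding hausdorff_outer_def
  proof (rule SUP_add_directed_ennreal[symmetric])
    fix i j :: real assume "i \<in> {0<..}" "j \<in> {0<..}"
    then show "\<exists>l\<in>{0<..}. hausdorff_premeasure k i A + hausdorff_premeasure k j B
        \<le> hausdorff_premeasure k l A + hausdorff_premeasure k l B"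
      by (intro bexI[of _ "min i j"] add_mono hausdorff_premeasure_mono) auto
  qed
  also have "\<dots> \<le> hausdorff_outer k (A \<union> B)"
  proof (rule SUP_least)
    fix \<delta> :: real assume \<delta>: "\<delta> \<in> {0<..}"
    let ?l = "min \<delta> (d/2)"
    have l: "0 < ?l" "?l < d" using \<delta> d by auto
    have "hausdorff_premeasure k \<delta> A + hausdorff_premeasure k \<delta> B
       \<le> hausdorff_premeasure k ?l A + hausdorff_premeasure k ?l B"
      by (intro add_mono hausdorff_premeasure_mono) auto
    also have "\<dots> \<le> hausdorff_premeasure k ?l (A \<union> B)" by (rule small[OF l])
    also have "\<dots> \<le> hausdorff_outer k (A \<union> B)" by (rule hausdorff_outer_ge[OF l(1)])
    finally show "hausdorff_premeasure k \<delta> A + hausdorff_premeasure k \<delta> B \<le> hausdorff_outer k (A \<union> B)" .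
  qed
  finally show ?thesis .
qed

lemma closed_in_lambda_system_hausdorff:
  fixes F :: "'a::metric_space set"
  assumes F: "closed F"
  shows "F \<in> lambda_system UNIV UNIV (hausdorff_outer k)"
proof -
  let ?H = "hausdorff_outer k"
  have "?H (A \<inter> F) + ?H (A - F) \<le> ?H A" if fin: "?H A < top" and ne: "F \<noteq> {}" for A
  proof -
    define r where "r n = 1 / (real n + 1)" for n
    define D where "D n = {a\<in>A. r n \<le> infdist a F}" for n
    define R where "R n = D (Suc n) - D n" for n
    have r_pos: "0 < r n" for n by (simp add: r_def)
    have r_less: "r (Suc n) < r n" for n by (simp add: r_def field_simps)
    have r_mono: "m \<le> n \<Longrightarrow> r n \<le> r m" for m n by (simp add: r_def field_simps)
    have D_sub: "D n \<subseteq> A" for n by (auto simp: D_def)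
    have D_mono: "m \<le> n \<Longrightarrow> D m \<subseteq> D n" for m n using r_mono[of m n] by (auto simp: D_def)
    have sepR: "?H (D n) + ?H (R (Suc n)) \<le> ?H (D (Suc (Suc n)))" for n
    proof -
      have "?H (D n) + ?H (R (Suc n)) \<le> ?H (D n \<union> R (Suc n))"
      proof (rule hausdorff_outer_separated[of "r n - r (Suc n)"])
        fix a b assume "a \<in> D n" "b \<in> R (Suc n)"
        then have "r n \<le> infdist a F" "infdist b F < r (Suc n)" by (auto simp: D_def R_def)
        moreover have "infdist a F \<le> infdist b F + dist a b" by (rule infdist_triangle)
        ultimately show "r n - r (Suc n) \<le> dist a b" by simp
      qed (use r_less[of n] in simp)
      also have "\<dots> \<le> ?H (D (Suc (Suc n)))"
        using D_mono[of n "Suc (Suc n)"] by (intro hausdorff_outer_mono) (auto simp: R_def)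
      finally show ?thesis .
    qed
    have sepF: "?H (A \<inter> F) + ?H (D n) \<le> ?H A" for n
    proof -
      have "?H (A \<inter> F) + ?H (D n) \<le> ?H ((A \<inter> F) \<union> D n)"
      proof (rule hausdorff_outer_separated[of "r n"])
        fix a b assume "a \<in> A \<inter> F" "b \<in> D n"
        then show "r n \<le> dist a b"
          using infdist_le[of a F b] by (auto simp: D_def dist_commute)
      qed (rule r_pos)
      also have "\<dots> \<le> ?H A" using D_sub by (intro hausdorff_outer_mono) auto
      finally show ?thesis .
    qed
    have alt: "(\<Sum>i<N. ?H (R (2 * i + 1 + j))) \<le> ?H (D (2 * N + j))" for N j
    proof (induction N)
      case (Suc N)
      have "(\<Sum>i<Suc N. ?H (R (2 * i + 1 + j))) \<le> ?H (D (2 * N + j)) + ?H (R (Suc (2 * N + j)))"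
        using Suc by (simp add: add_right_mono)
      also have "\<dots> \<le> ?H (D (Suc (Suc (2 * N + j))))" by (rule sepR)
      finally show ?case by simp
    qed simp
    define S where "S = (\<Sum>i. ?H (R (i + 1)))"
    have "S \<le> ?H A + ?H A"
      unfolding S_def
    proof (rule suminf_le_const)
      fix N
      have "(\<Sum>i<2*N. ?H (R (i + 1))) = (\<Sum>i<N. ?H (R (2 * i + 1 + 0))) + (\<Sum>i<N. ?H (R (2 * i + 1 + 1)))"
        by (induction N) (simp_all add: ac_simps)
      also have "\<dots> \<le> ?H (D (2 * N + 0)) + ?H (D (2 * N + 1))"
        by (intro add_mono alt)
      also have "\<dots> \<le> ?H A + ?H A"
        by (intro add_mono hausdorff_outer_mono D_sub)
      finally have "(\<Sum>i<2*N. ?H (R (i + 1))) \<le> ?H A + ?H A" .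
      moreover have "(\<Sum>i<N. ?H (R (i + 1))) \<le> (\<Sum>i<2*N. ?H (R (i + 1)))"
        by (rule sum_mono2) auto
      ultimately show "(\<Sum>i<N. ?H (R (i + 1))) \<le> ?H A + ?H A" by (rule order_trans[rotated])
    qed simp
    with fin have S_fin: "S \<noteq> \<infinity>" by (auto simp: top_unique)
    have step: "?H (A - F) \<le> ?H (D (N + 1)) + (\<Sum>i. ?H (R (i + N + 1)))" for N
    proof -
      have "A - F \<subseteq> D (N + 1) \<union> (\<Union>i. R (i + N + 1))"
      proof
        fix a assume a: "a \<in> A - F"
        with F ne have "0 < infdist a F"
          by (simp add: infdist_pos_not_in_closed)
        then obtain m where "r m < infdist a F"
          unfolding r_def by (metis nat_approx_posE of_nat_Suc add.commute)
        with a have ex: "\<exists>m. a \<in> D m" by (auto simp: D_def intro: less_imp_le)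
        define m where "m = (LEAST m. a \<in> D m)"
        have am: "a \<in> D m" unfolding m_def using ex by (rule LeastI_ex)
        show "a \<in> D (N + 1) \<union> (\<Union>i. R (i + N + 1))"
        proof (cases "m \<le> N + 1")
          case True
          then show ?thesis using D_mono[OF True] am by auto
        next
          case False
          define i where "i = m - N - 2"
          have i: "m = Suc (i + N + 1)" using False by (simp add: i_def)
          then have "a \<notin> D (i + N + 1)"
            using not_less_Least[of "i + N + 1" "\<lambda>m. a \<in> D m"] by (simp add: m_def)
          with am i have "a \<in> R (i + N + 1)" by (simp add: R_def)
          then show ?thesis by blast
        qed
      qed
      then have "?H (A - F) \<le> ?H (D (N + 1) \<union> (\<Union>i. R (i + N + 1)))" by (rule hausdorff_outer_mono)
      also have "\<dots> \<le> ?H (D (N + 1)) + ?H (\<Union>i. R (i + N + 1))" by (rule hausdorff_outer_Un)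
      also have "\<dots> \<le> ?H (D (N + 1)) + (\<Sum>i. ?H (R (i + N + 1)))"
        by (intro add_left_mono hausdorff_outer_subadditive)
      finally show ?thesis .
    qed
    have "S + (?H (A \<inter> F) + ?H (A - F)) \<le> S + ?H A"
      unfolding S_def
    proof (rule ennreal_suminf_bound_add)
      fix N
      have "(\<Sum>i<N. ?H (R (i + 1))) + (?H (A \<inter> F) + ?H (A - F))
        \<le> (\<Sum>i<N. ?H (R (i + 1))) + (?H (A \<inter> F) + (?H (D (N + 1)) + (\<Sum>i. ?H (R (i + N + 1)))))"
        by (intro add_left_mono step)
      also have "\<dots> = ((\<Sum>i. ?H (R (i + N + 1))) + (\<Sum>i<N. ?H (R (i + 1)))) + (?H (A \<inter> F) + ?H (D (N + 1)))"
        by (simp add: ac_simps)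
      also have "(\<Sum>i. ?H (R (i + N + 1))) + (\<Sum>i<N. ?H (R (i + 1))) = (\<Sum>i. ?H (R (i + 1)))"
        by (rule suminf_offset[symmetric]) simp
      also have "(\<Sum>i. ?H (R (i + 1))) + (?H (A \<inter> F) + ?H (D (N + 1))) \<le> (\<Sum>i. ?H (R (i + 1))) + ?H A"
        by (intro add_left_mono sepF)
      finally show "(\<Sum>i<N. ?H (R (i + 1))) + (?H (A \<inter> F) + ?H (A - F)) \<le> (\<Sum>i. ?H (R (i + 1))) + ?H A" .
    qed
    with S_fin show ?thesis by (simp only: ennreal_add_left_cancel_le) simp
  qed
  then have "?H (A \<inter> F) + ?H (A - F) \<le> ?H A" for A
    by (cases "F = {}"; cases "?H A = top") (auto simp: less_top)
  moreover have "?H A \<le> ?H (A \<inter> F) + ?H (A - F)" for A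
    using hausdorff_outer_Un[of k "A \<inter> F" "A - F"] by (simp add: Int_Diff_Un)
  ultimately have "?H (A \<inter> F) + ?H (A - F) = ?H A" for A
    by (rule antisym)
  then show ?thesis
    by (simp add: lambda_system_def Int_commute Diff_eq)
qed

lemma sets_hausdorff_measure [simp, measurable_cong]: "sets (hausdorff_measure k) = sets borel"
  unfolding hausdorff_measure_def by (metis sets.sets_measure_of_eq space_borel)

lemma space_hausdorff_measure [simp]: "space (hausdorff_measure k) = UNIV"
  unfolding hausdorff_measure_def by (simp add: space_measure_of_conv)

lemma emeasure_hausdorff_measure:
  assumes A: "A \<in> sets borel"
  shows "emeasure (hausdorff_measure k) A = hausdorff_outer k A"
proof -
  let ?L = "lambda_system UNIV UNIV (hausdorff_outer k) :: 'a set set"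
  interpret P: sigma_algebra "UNIV :: 'a set" "UNIV :: 'a set set"
    using sigma_algebra_Pow[of "UNIV :: 'a set"] by simp
  have ms: "measure_space UNIV ?L (hausdorff_outer k)"
    by (rule P.caratheodory_lemma[OF outer_measure_space_hausdorff])
  then have "sigma_sets UNIV (Collect closed) \<subseteq> ?L"
    by (intro sigma_algebra.sigma_sets_subset)
      (auto simp: measure_space_def closed_in_lambda_system_hausdorff)
  then have sub: "sets borel \<subseteq> ?L"
    by (simp add: borel_eq_closed)
  have "countably_additive (sets borel) (hausdorff_outer k :: 'a set \<Rightarrow> ennreal)"
    using ms sub unfolding measure_space_def countably_additive_def
    by (meson order_trans subsetD)
  moreover have "sigma_algebra UNIV (sets borel :: 'a set set)"
    using sets.sigma_algebra_axioms[of "borel :: 'a measure"] by simp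
  ultimately show ?thesis
    unfolding hausdorff_measure_def
    using A by (intro emeasure_measure_of_sigma) (auto simp: positive_def)
qed


section \<open>Distributional symmetric gradient\<close>

definition partial_deriv :: "'n::finite \<Rightarrow> (real^'n \<Rightarrow> real) \<Rightarrow> real^'n \<Rightarrow> real" where
  "partial_deriv j f x = frechet_derivative f (at x) (axis j 1)"

text \<open>Differentiability of all iterated partial derivatives forces their continuity, so this is
  \<open>C\<^sup>\<infinity>\<close>.\<close>

definition smooth :: "(real^'n::finite \<Rightarrow> real) \<Rightarrow> bool" where
  "smooth f \<longleftrightarrow> (\<forall>js :: 'n list. foldr partial_deriv js f differentiable_on UNIV)"

definition test_function :: "(real^'n::finite) set \<Rightarrow> (real^'n \<Rightarrow> real) \<Rightarrow> bool" where
  "test_function \<Omega> \<phi> \<longleftrightarrow>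
     smooth \<phi> \<and> compact (closure {x. \<phi> x \<noteq> 0}) \<and> closure {x. \<phi> x \<noteq> 0} \<subseteq> \<Omega>"

definition locally_integrable_on ::
  "(real^'n::finite \<Rightarrow> 'b::euclidean_space) \<Rightarrow> (real^'n) set \<Rightarrow> bool"
  (infixr "locally'_integrable'_on" 46) where
  "f locally_integrable_on \<Omega> \<longleftrightarrow> (\<forall>K. compact K \<and> K \<subseteq> \<Omega> \<longrightarrow> f absolutely_integrable_on K)"

text \<open>Entry \<open>(i, j)\<close> of the distributional gradient is the distribution \<open>\<partial>\<^sub>j u\<^sub>i\<close>, acting on test
  functions.\<close>

definition distr_grad ::
  "(real^'n::finite) set \<Rightarrow> (real^'n \<Rightarrow> real^'n) \<Rightarrow> 'n \<Rightarrow> 'n \<Rightarrow> (real^'n \<Rightarrow> real) \<Rightarrow> real" where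
  "distr_grad \<Omega> u i j \<phi> = - (LINT y:\<Omega>|lebesgue. u y $ i * partial_deriv j \<phi> y)"

definition distr_sym_grad ::
  "(real^'n::finite) set \<Rightarrow> (real^'n \<Rightarrow> real^'n) \<Rightarrow> 'n \<Rightarrow> 'n \<Rightarrow> (real^'n \<Rightarrow> real) \<Rightarrow> real" where
  "distr_sym_grad \<Omega> u i j \<phi> = (distr_grad \<Omega> u i j \<phi> + distr_grad \<Omega> u j i \<phi>) / 2"

text \<open>\<open>has_sym_grad \<Omega> u E\<close>: the distribution \<^const>\<open>distr_sym_grad\<close> of \<open>u\<close> is (represented by)
  the locally integrable matrix field \<open>E\<close>, which is then unique up to null sets.\<close>

definition has_sym_grad ::
  "(real^'n::finite) set \<Rightarrow> (real^'n \<Rightarrow> real^'n) \<Rightarrow> (real^'n \<Rightarrow> real^'n^'n) \<Rightarrow> bool" where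
  "has_sym_grad \<Omega> u E \<longleftrightarrow> E locally_integrable_on \<Omega> \<and>
     (\<forall>\<phi>. test_function \<Omega> \<phi> \<longrightarrow>
        (\<forall>i j. distr_sym_grad \<Omega> u i j \<phi> = (LINT y:\<Omega>|lebesgue. E y $ i $ j * \<phi> y)))"

definition E11 :: "(real^'n::finite) set \<Rightarrow> (real^'n \<Rightarrow> real^'n) set" where
  "E11 \<Omega> = {u. u locally_integrable_on \<Omega> \<and>
     (\<exists>E. has_sym_grad \<Omega> u E \<and> (\<lambda>y. norm (E y)) absolutely_integrable_on \<Omega>)}"

definition Cb :: "'a::metric_space set \<Rightarrow> ('a \<Rightarrow> 'b::real_normed_vector) set" where
  "Cb S = {u. continuous_on S u \<and> bounded {x\<in>S. u x \<noteq> 0}}"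


section \<open>First boundary point on a ray\<close>

definition visible_frontier :: "'a::real_normed_vector set \<Rightarrow> 'a \<Rightarrow> 'a set" where
  "visible_frontier \<Omega> x =
     {y \<in> frontier \<Omega>. \<forall>t\<in>{0<..<1}. (1 - t) *\<^sub>R x + t *\<^sub>R y \<in> \<Omega>}"

text \<open>If \<open>\<Omega>\<close> is open, \<open>x \<in> \<Omega>\<close> and the ray meets the frontier, then the \<open>t\<close> below exists and is
  unique; the remaining case is treated in \<open>at_zeta\<close>.\<close>

definition zeta :: "'a::real_normed_vector set \<Rightarrow> 'a \<Rightarrow> 'a \<Rightarrow> 'a" where
  "zeta \<Omega> x \<theta> = x + (THE t. 0 < t \<and> x + t *\<^sub>R \<theta> \<in> visible_frontier \<Omega> x) *\<^sub>R \<theta>"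

text \<open>\<open>at_zeta g \<Omega> x \<theta>\<close> is \<open>g (\<zeta>(x,\<theta>))\<close>, with the convention that it vanishes if the ray from \<open>x\<close> in
  direction \<open>\<theta>\<close> does not meet the frontier.\<close>

definition at_zeta ::
  "('a::real_normed_vector \<Rightarrow> 'b::zero) \<Rightarrow> 'a set \<Rightarrow> 'a \<Rightarrow> 'a \<Rightarrow> 'b" where
  "at_zeta g \<Omega> x \<theta> =
     (if \<exists>t>0. x + t *\<^sub>R \<theta> \<in> frontier \<Omega> then g (zeta \<Omega> x \<theta>) else 0)"

end

theory Submission
  imports Defs
begin

text \<open>
  For smooth \<open>u\<close>, the derivative of \<open>\<tau> \<mapsto> z \<bullet> u (x + \<tau> z)\<close> is \<open>z \<bullet> (E (x + \<tau> z) z)\<close>. Integrating from \<open>x\<close>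
  to the first boundary point in direction \<open>\<theta>\<close> bounds \<open>\<theta> \<bullet> u x\<close> by \<open>\<bar>u (\<zeta>(x,\<theta>))\<bar>\<close> plus the integral of \<open>\<bar>E\<bar>\<close>
  along the ray. Averaging over the directions \<open>\<theta> = z / \<bar>z\<bar>\<close>, with \<open>z\<close> in a small ball centred at half the
  unit vector of \<open>u x\<close>, turns the left-hand side into a multiple of \<open>\<bar>u x\<bar>\<close> and, by Fubini and scaling,
  the ray integrals into the Riesz potential of \<open>\<bar>E\<bar>\<close>. Parametrizing directions by a solid ball avoids
  polar coordinates; only the domination of the cone measure by the Hausdorff measure is needed.

  If \<open>u\<close> is merely continuous, the ray inequality is first tested against smooth \<open>\<psi>(z) \<ge> 0\<close>, where it
  follows from the definition of the distributional symmetric gradient, and then extended to almost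
  every \<open>z\<close>.
\<close>

section \<open>Smooth cutoff functions\<close>

text \<open>The ray in the direction of \<open>u x\<close> alone would bound
  \<open>norm (u x)\<close>, but a field \<open>E\<close> determined only up to null sets says
  nothing about a single ray. A whole cone of directions is therefore used. Each ray controls only
  the component of \<open>u\<close> parallel to it, so the cone has to stay close to
  \<open>u x\<close>, where this component is a fixed fraction of the norm.

  Nothing is assumed about the boundary of \<Omega>, so the weak arguments are confined to segments
  inside \<Omega> with parameters in \<open>{s..t}\<close>, \<open>0 < s\<close>. The boundary point
  and \<open>x\<close> itself are reached afterwards by continuity of \<open>u\<close> on the
  closure. Keeping \<open>s\<close> positive avoids the apex, where \<open>z\<close> \<mapsto>
  \<open>x + \<tau> z\<close> collapses.

  The exceptional null set depends on \<open>(s, t)\<close>, and the unit sphere is itself a null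
  set. Continuity in \<open>(s, t)\<close> reduces the first problem to rational pairs; for the
  second, the set of good directions is shown to be invariant under positive scaling, so that almost
  every \<open>z\<close> in a ball yields the good unit vector \<open>sgn z\<close>.\<close>

definition flat_exp :: "nat \<Rightarrow> real \<Rightarrow> real" where
  "flat_exp k t = (if t > 0 then exp (- inverse t) * inverse t ^ k else 0)"

text \<open>The index \<open>k\<close> makes the span of the family closed under differentiation,
  which is what \<open>smooth_alg\<close> relies on. At the origin the right difference quotient is
  \<open>w^(k+1) / exp w\<close> with \<open>w = 1/t\<close>, and the left one is zero.\<close>

lemma flat_exp_has_deriv: "(flat_exp k has_real_derivative flat_exp (k + 2) t - real k * flat_exp (k + 1) t) (at t)"
proof -
  consider "t > 0" | "t < 0" | "t = 0" by linarith
  then show ?thesis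
  proof cases
    case 1
    have "((\<lambda>t. exp (- inverse t) * inverse t ^ k) has_real_derivative flat_exp (k + 2) t - real k * flat_exp (k + 1) t) (at t)"
    proof -
      have "real k * inverse t ^ (k - 1) * (inverse t * inverse t) = real k * inverse t ^ (k + 1)"
        by (cases k) auto
      then show ?thesis
        using 1 by (auto intro!: derivative_eq_intros simp: flat_exp_def algebra_simps)
    qed
    then show ?thesis
      by (rule has_field_derivative_transform_within_open[where S="{0<..}"]) (use 1 in \<open>auto simp: flat_exp_def\<close>)
  next
    case 2
    have "((\<lambda>t. 0) has_real_derivative flat_exp (k + 2) t - real k * flat_exp (k + 1) t) (at t)"
      using 2 by (auto simp: flat_exp_def)
    then show ?thesis
      by (rule has_field_derivative_transform_within_open[where S="{..<0}"]) (use 2 in \<open>auto simp: flat_exp_def\<close>)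
  next
    case 3
    have "((\<lambda>x::real. x ^ (k+1) / exp x) \<longlongrightarrow> 0) at_top" by (rule tendsto_power_div_exp_0)
    then have "((\<lambda>t::real. inverse t ^ (k+1) / exp (inverse t)) \<longlongrightarrow> 0) (at_right 0)"
      by (rule filterlim_compose) (rule filterlim_inverse_at_top_right)
    then have "((\<lambda>t::real. (flat_exp k t - flat_exp k 0) / (t - 0)) \<longlongrightarrow> 0) (at_right 0)"
      by (rule Lim_transform_eventually)
        (auto simp: eventually_at_right_field flat_exp_def exp_minus field_simps intro!: exI[of _ 1])
    moreover have "((\<lambda>t::real. (flat_exp k t - flat_exp k 0) / (t - 0)) \<longlongrightarrow> 0) (at_left 0)"
      by (rule Lim_transform_eventually[of "\<lambda>_. 0"])
        (auto simp: eventually_at_left_field flat_exp_def intro!: exI[of _ "-1"])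
    ultimately show ?thesis
      using 3 by (auto simp: has_field_derivative_iff filterlim_at_split flat_exp_def)
  qed
qed

lemma flat_exp_bounds: "0 \<le> flat_exp 0 t" "flat_exp 0 t \<le> 1" "flat_exp 0 t > 0 \<longleftrightarrow> t > 0"
  by (auto simp: flat_exp_def)

text \<open>This class is closed under partial derivatives, so smoothness follows without computing higher
  derivatives.\<close>

inductive smooth_alg :: "(real^'n::finite \<Rightarrow> real) \<Rightarrow> bool" where
  const: "smooth_alg (\<lambda>y. c)"
| coord: "smooth_alg (\<lambda>y. y $ i)"
| add: "smooth_alg f \<Longrightarrow> smooth_alg g \<Longrightarrow> smooth_alg (\<lambda>y. f y + g y)"
| mult: "smooth_alg f \<Longrightarrow> smooth_alg g \<Longrightarrow> smooth_alg (\<lambda>y. f y * g y)"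
| flat_exp: "smooth_alg f \<Longrightarrow> smooth_alg (\<lambda>y. flat_exp k (f y))"

lemma smooth_alg_diff: "smooth_alg f \<Longrightarrow> smooth_alg g \<Longrightarrow> smooth_alg (\<lambda>y. f y - g y)"
  using smooth_alg.add[of f "\<lambda>y. (-1) * g y"] smooth_alg.mult[OF smooth_alg.const[of "-1"], of g] by simp

lemma smooth_alg_prod: "(\<And>i. i \<in> I \<Longrightarrow> smooth_alg (f i)) \<Longrightarrow> smooth_alg (\<lambda>y. \<Prod>i\<in>I. f i y)"
  by (induction I rule: infinite_finite_induct) (auto intro: smooth_alg.intros)

lemma smooth_alg_power: "smooth_alg f \<Longrightarrow> smooth_alg (\<lambda>y. f y ^ k)"
  by (induction k) (auto intro: smooth_alg.intros)

lemma smooth_alg_affine: "smooth_alg f \<Longrightarrow> smooth_alg (\<lambda>y. f (c *\<^sub>R (y - x)))"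
proof (induction rule: smooth_alg.induct)
  case (coord i)
  show ?case
    by (simp add: smooth_alg.intros smooth_alg_diff)
qed (auto intro: smooth_alg.intros)

text \<open>The induction builds the gradient coefficients from those of the subterms, so they
  appear as an existential family \<open>d\<close> inside the class. Uniqueness of derivatives
  identifies them with \<open>partial_deriv\<close> afterwards.\<close>

lemma smooth_alg_has_derivative:
  fixes f :: "real^'n::finite \<Rightarrow> real"
  assumes "smooth_alg f"
  shows "\<exists>d. (\<forall>j. smooth_alg (d j)) \<and> (\<forall>y. (f has_derivative (\<lambda>v. \<Sum>j\<in>UNIV. d j y * v $ j)) (at y))"
  using assms
proof induction
  case (const c)
  show ?case by (rule exI[of _ "\<lambda>_ _. 0"]) (auto intro: smooth_alg.const)
next
  case (coord i)
  show ?case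
    by (rule exI[of _ "\<lambda>j _. if j = i then 1 else 0"])
      (auto intro: smooth_alg.const simp: if_distrib[of "\<lambda>c. c * _"] cong: if_cong intro!: bounded_linear_imp_has_derivative bounded_linear_vec_nth)
next
  case (add f g)
  then obtain d e where
    "\<forall>j. smooth_alg (d j)" "\<forall>y. (f has_derivative (\<lambda>v. \<Sum>j\<in>UNIV. d j y * v $ j)) (at y)"
    "\<forall>j. smooth_alg (e j)" "\<forall>y. (g has_derivative (\<lambda>v. \<Sum>j\<in>UNIV. e j y * v $ j)) (at y)" by auto
  then show ?case
    by (intro exI[of _ "\<lambda>j y. d j y + e j y"])
      (auto intro!: smooth_alg.add derivative_eq_intros simp: sum.distrib algebra_simps)
next
  case (mult f g)
  then obtain d e where
    "\<forall>j. smooth_alg (d j)" "\<forall>y. (f has_derivative (\<lambda>v. \<Sum>j\<in>UNIV. d j y * v $ j)) (at y)"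
    "\<forall>j. smooth_alg (e j)" "\<forall>y. (g has_derivative (\<lambda>v. \<Sum>j\<in>UNIV. e j y * v $ j)) (at y)" by auto
  with mult.hyps show ?case
    by (intro exI[of _ "\<lambda>j y. f y * e j y + d j y * g y"])
      (auto intro!: smooth_alg.add smooth_alg.mult derivative_eq_intros simp: sum.distrib algebra_simps sum_distrib_left)
next
  case (flat_exp f k)
  then obtain d where
    d: "\<forall>j. smooth_alg (d j)" "\<And>y. (f has_derivative (\<lambda>v. \<Sum>j\<in>UNIV. d j y * v $ j)) (at y)" by auto
  have "((\<lambda>y. flat_exp k (f y)) has_derivative
      (\<lambda>v. \<Sum>j\<in>UNIV. (flat_exp (k + 2) (f y) - real k * flat_exp (k + 1) (f y)) * d j y * v $ j)) (at y)" for y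
    using has_derivative_compose[OF d(2) flat_exp_has_deriv[unfolded has_field_derivative_def, of k "f y"]]
    by (simp add: sum_distrib_left mult.assoc)
  with d(1) flat_exp.hyps show ?case
    by (intro exI[of _ "\<lambda>j y. (flat_exp (k + 2) (f y) - real k * flat_exp (k + 1) (f y)) * d j y"])
      (auto intro!: smooth_alg.mult smooth_alg_diff smooth_alg.const smooth_alg.flat_exp)
qed

lemma partial_deriv_eq:
  fixes f :: "real^'n::finite \<Rightarrow> real"
  assumes "(f has_derivative D) (at y)"
  shows "partial_deriv j f y = D (axis j 1)"
  unfolding partial_deriv_def using frechet_derivative_at[OF assms] by simp

lemma
  fixes f :: "real^'n::finite \<Rightarrow> real"
  assumes "smooth_alg f"
  shows smooth_alg_partial_deriv: "smooth_alg (partial_deriv j f)"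
    and smooth_alg_derivative: "(f has_derivative (\<lambda>v. \<Sum>j\<in>UNIV. partial_deriv j f y * v $ j)) (at y)"
proof -
  obtain d where d: "\<And>j. smooth_alg (d j)" "\<And>y. (f has_derivative (\<lambda>v. \<Sum>j\<in>UNIV. d j y * v $ j)) (at y)"
    using smooth_alg_has_derivative[OF assms] by auto
  have eq: "partial_deriv j f = d j" for j
    by (rule ext) (simp add: partial_deriv_eq[OF d(2)] axis_def if_distrib cong: if_cong)
  show "smooth_alg (partial_deriv j f)" "(f has_derivative (\<lambda>v. \<Sum>j\<in>UNIV. partial_deriv j f y * v $ j)) (at y)"
    using d by (simp_all add: eq)
qed

lemma smooth_alg_continuous: "smooth_alg f \<Longrightarrow> continuous_on S f"
  by (meson smooth_alg_derivative has_derivative_continuous continuous_at_imp_continuous_on)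

lemma smooth_alg_smooth: "smooth_alg f \<Longrightarrow> smooth f"
  unfolding smooth_def
proof
  fix js assume "smooth_alg f"
  then have "smooth_alg (foldr partial_deriv js f)"
    by (induction js) (auto intro: smooth_alg_partial_deriv)
  then show "foldr partial_deriv js f differentiable_on UNIV"
    by (meson smooth_alg_derivative differentiableI differentiable_at_imp_differentiable_on)
qed

section \<open>Transport along rays\<close>

definition dilate :: "(real^'n::finite \<Rightarrow> real) \<Rightarrow> real^'n \<Rightarrow> real \<Rightarrow> real^'n \<Rightarrow> real" where
  "dilate \<psi> x \<tau> y = \<psi> (inverse \<tau> *\<^sub>R (y - x))"

text \<open>Density at \<open>y\<close> of the image of \<open>z $ i * \<psi> z dz\<close> under
  \<open>z\<close> \<mapsto> \<open>x + \<tau> z\<close>: the Jacobian contributes \<open>n\<close>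
  factors \<open>1/\<tau>\<close>, and \<open>z $ i = (y - x) $ i / \<tau>\<close> one more.\<close>

definition radial_field :: "(real^'n::finite \<Rightarrow> real) \<Rightarrow> real^'n \<Rightarrow> real \<Rightarrow> 'n \<Rightarrow> real^'n \<Rightarrow> real" where
  "radial_field \<psi> x \<tau> i y = (y - x) $ i * inverse \<tau> ^ (CARD('n) + 1) * dilate \<psi> x \<tau> y"

text \<open>The same image density for \<open>z $ i * z $ j * \<psi> z dz\<close>; the additional
  factor is the velocity \<open>z\<close> of the flow.\<close>

definition radial_tensor :: "(real^'n::finite \<Rightarrow> real) \<Rightarrow> real^'n \<Rightarrow> real \<Rightarrow> 'n \<Rightarrow> 'n \<Rightarrow> real^'n \<Rightarrow> real" where
  "radial_tensor \<psi> x \<tau> i j y =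
     (y - x) $ i * (y - x) $ j * inverse \<tau> ^ (CARD('n) + 2) * dilate \<psi> x \<tau> y"

lemma smooth_alg_dilate: "smooth_alg \<psi> \<Longrightarrow> smooth_alg (dilate \<psi> x \<tau>)"
  unfolding dilate_def[abs_def] by (rule smooth_alg_affine)

lemma smooth_alg_shifted_coord: "smooth_alg (\<lambda>y. (y - x) $ i)"
  unfolding vector_minus_component by (rule smooth_alg_diff[OF smooth_alg.coord smooth_alg.const])

lemma smooth_alg_radial_tensor: "smooth_alg \<psi> \<Longrightarrow> smooth_alg (radial_tensor \<psi> x \<tau> i j)"
  unfolding radial_tensor_def[abs_def]
  by (rule smooth_alg.mult[OF smooth_alg.mult[OF smooth_alg.mult[OF smooth_alg_shifted_coord smooth_alg_shifted_coord] smooth_alg.const] smooth_alg_dilate])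

lemma smooth_alg_radial_field: "smooth_alg \<psi> \<Longrightarrow> smooth_alg (radial_field \<psi> x \<tau> i)"
  unfolding radial_field_def[abs_def]
  by (rule smooth_alg.mult[OF smooth_alg.mult[OF smooth_alg_shifted_coord smooth_alg.const] smooth_alg_dilate])

lemma dilate_has_derivative:
  assumes "smooth_alg \<psi>"
  shows "(dilate \<psi> x \<tau> has_derivative
    (\<lambda>v. \<Sum>k\<in>UNIV. dilate (partial_deriv k \<psi>) x \<tau> y * (inverse \<tau> * v $ k))) (at y)"
proof -
  have "((\<lambda>y. inverse \<tau> *\<^sub>R (y - x)) has_derivative (\<lambda>v. inverse \<tau> *\<^sub>R v)) (at y)"
    by (auto intro!: derivative_eq_intros)
  from has_derivative_compose[OF this smooth_alg_derivative[OF assms]]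
  show ?thesis by (simp add: dilate_def[abs_def])
qed

lemma partial_deriv_radial_tensor:
  fixes \<psi> :: "real^'n::finite \<Rightarrow> real"
  assumes "smooth_alg \<psi>"
  shows "partial_deriv j (radial_tensor \<psi> x \<tau> i j) y =
    inverse \<tau> ^ (CARD('n) + 2) *
      (((y - x) $ i + (if i = j then (y - x) $ j else 0)) * dilate \<psi> x \<tau> y +
       (y - x) $ i * (y - x) $ j * inverse \<tau> * dilate (partial_deriv j \<psi>) x \<tau> y)"
proof -
  let ?c = "inverse \<tau> ^ (CARD('n) + 2)"
  let ?D = "\<lambda>v. \<Sum>k\<in>UNIV. dilate (partial_deriv k \<psi>) x \<tau> y * (inverse \<tau> * v $ k)"
  have c: "((\<lambda>y. (y - x) $ k) has_derivative (\<lambda>v. v $ k)) (at y)" for k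
    by (auto intro!: derivative_eq_intros bounded_linear_imp_has_derivative bounded_linear_vec_nth)
  have "(radial_tensor \<psi> x \<tau> i j has_derivative
     (\<lambda>v. ((y - x) $ i * v $ j + v $ i * (y - x) $ j) * ?c * dilate \<psi> x \<tau> y +
       (y - x) $ i * (y - x) $ j * ?c * ?D v)) (at y)"
    unfolding radial_tensor_def[abs_def]
    by (rule derivative_eq_intros c dilate_has_derivative[OF assms] refl)+
       (simp add: algebra_simps)
  from partial_deriv_eq[OF this, of j]
  have "partial_deriv j (radial_tensor \<psi> x \<tau> i j) y =
     ((y - x) $ i * axis j 1 $ j + axis j 1 $ i * (y - x) $ j) * ?c * dilate \<psi> x \<tau> y +
       (y - x) $ i * (y - x) $ j * ?c * ?D (axis j 1)" .
  also have "?D (axis j 1) = inverse \<tau> * dilate (partial_deriv j \<psi>) x \<tau> y"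
    by (simp add: axis_def if_distrib cong: if_cong)
  finally show ?thesis by (cases "i = j") (simp_all add: axis_def power_add algebra_simps del: scaleR_right_diff_distrib)
qed

text \<open>This is the continuity equation for the vector measure \<open>z \<psi>(z) dz\<close> pushed forward by the flow
  \<open>z \<mapsto> x + \<tau> z\<close>, whose velocity at \<open>y\<close> is \<open>(y - x) / \<tau>\<close>. The flux is a symmetric tensor, so pairing it
  with \<open>u\<close> involves the symmetric gradient only.\<close>
lemma radial_field_has_deriv:
  fixes \<psi> :: "real^'n::finite \<Rightarrow> real"
  assumes "smooth_alg \<psi>" "0 < \<tau>"
  shows "((\<lambda>\<tau>. radial_field \<psi> x \<tau> i y) has_real_derivative
    - (\<Sum>j\<in>UNIV. partial_deriv j (radial_tensor \<psi> x \<tau> i j) y)) (at \<tau>)"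
proof -
  let ?c = "inverse \<tau> ^ (CARD('n) + 2)"
  let ?D = "\<Sum>k\<in>UNIV. dilate (partial_deriv k \<psi>) x \<tau> y * (y - x) $ k"
  have "((\<lambda>\<tau>. inverse \<tau> *\<^sub>R (y - x)) has_derivative (\<lambda>h. (- h * inverse \<tau>^2) *\<^sub>R (y - x))) (at \<tau>)"
    using assms by (auto intro!: derivative_eq_intros simp: power2_eq_square)
  from has_derivative_compose[OF this smooth_alg_derivative[OF assms(1)]]
  have "((\<lambda>\<tau>. dilate \<psi> x \<tau> y) has_derivative
      (\<lambda>h. \<Sum>k\<in>UNIV. partial_deriv k \<psi> (inverse \<tau> *\<^sub>R (y - x)) * ((- h * inverse \<tau>^2) *\<^sub>R (y - x)) $ k)) (at \<tau>)"
    by (simp add: dilate_def[abs_def] del: scaleR_right_diff_distrib vector_minus_component vector_scaleR_component)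
  also have "(\<lambda>h. \<Sum>k\<in>UNIV. partial_deriv k \<psi> (inverse \<tau> *\<^sub>R (y - x)) * ((- h * inverse \<tau>^2) *\<^sub>R (y - x)) $ k) =
      (*) (- (inverse \<tau>^2 * ?D))"
    by (simp add: dilate_def sum_distrib_left sum_distrib_right sum_negf[symmetric] fun_eq_iff algebra_simps
        del: scaleR_right_diff_distrib)
  finally have "((\<lambda>\<tau>. dilate \<psi> x \<tau> y) has_real_derivative - (inverse \<tau>^2 * ?D)) (at \<tau>)"
    by (simp only: has_field_derivative_def)
  moreover have "((\<lambda>\<tau>. inverse \<tau> ^ (CARD('n) + 1)) has_real_derivative
      - (real (CARD('n) + 1) * ?c)) (at \<tau>)"
    using DERIV_power[OF DERIV_inverse[of \<tau> UNIV], of "CARD('n) + 1"] assms(2)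
    by (simp add: power2_eq_square algebra_simps)
  ultimately have "((\<lambda>\<tau>. (y - x) $ i * (inverse \<tau> ^ (CARD('n) + 1) * dilate \<psi> x \<tau> y)) has_real_derivative
     (y - x) $ i * (- (real (CARD('n) + 1) * ?c) * dilate \<psi> x \<tau> y +
      - (inverse \<tau>^2 * ?D) * inverse \<tau> ^ (CARD('n) + 1))) (at \<tau>)"
    by (intro DERIV_cmult DERIV_mult)
  then have "((\<lambda>\<tau>. radial_field \<psi> x \<tau> i y) has_real_derivative
     (y - x) $ i * (- (real (CARD('n) + 1) * ?c) * dilate \<psi> x \<tau> y +
      - (inverse \<tau>^2 * ?D) * inverse \<tau> ^ (CARD('n) + 1))) (at \<tau>)"
    by (simp only: radial_field_def[abs_def] mult.assoc)
  \<comment> \<open>Of the factor \<open>n + 1\<close>, \<open>n\<close> comes from differentiating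
    \<open>(y - x) $ j\<close> for every \<open>j\<close>, and 1 from the diagonal term, where
    \<open>(y - x) $ i\<close> is differentiated as well. It matches the exponent of
    \<open>inverse \<tau>\<close> in \<open>radial_field\<close>.\<close>
  moreover have "(\<Sum>j\<in>UNIV. partial_deriv j (radial_tensor \<psi> x \<tau> i j) y) =
     ?c * ((real CARD('n) + 1) * (y - x) $ i * dilate \<psi> x \<tau> y + (y - x) $ i * inverse \<tau> * ?D)"
    unfolding partial_deriv_radial_tensor[OF assms(1)]
    by (simp add: sum_distrib_left[symmetric] sum.distrib sum_distrib_right[symmetric] mult.assoc)
       (simp add: algebra_simps sum_distrib_left)
  ultimately show ?thesis
    by (elim DERIV_cong) (simp add: algebra_simps power2_eq_square del: vector_minus_component)
qed

lemma dilate_continuous: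
  fixes \<psi> :: "real^'n::finite \<Rightarrow> real"
  assumes "smooth_alg \<psi>" "0 < s"
  shows "continuous_on ({s..t} \<times> S) (\<lambda>(\<tau>, y). dilate \<psi> x \<tau> y)"
  unfolding dilate_def split_def
  by (rule continuous_on_compose2[OF smooth_alg_continuous[OF assms(1), of UNIV]])
     (use assms(2) in \<open>auto intro!: continuous_intros\<close>)

lemma radial_tensor_deriv_continuous:
  fixes \<psi> :: "real^'n::finite \<Rightarrow> real"
  assumes "smooth_alg \<psi>" "0 < s"
  shows "continuous_on ({s..t} \<times> S) (\<lambda>(\<tau>, y). partial_deriv j (radial_tensor \<psi> x \<tau> i j) y)"
  unfolding partial_deriv_radial_tensor[OF assms(1)]
  using dilate_continuous[OF assms, of t S x]
    dilate_continuous[OF smooth_alg_partial_deriv[OF assms(1), of j] assms(2), of t S x] assms(2)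
  unfolding split_def
  by (cases "i = j") (auto intro!: continuous_intros)

text \<open>Cauchy-Schwarz against the rank one matrix with entries \<open>V $ i * V $ j\<close>.
  The norm of \<open>real^'n^'n\<close> is the Frobenius norm, which for this matrix is
  \<open>(norm V)\<^sup>2\<close>.\<close>

lemma inner_quadratic_le:
  fixes M :: "real^'n::finite^'n" and V :: "real^'n"
  shows "\<bar>\<Sum>i\<in>UNIV. \<Sum>j\<in>UNIV. M $ i $ j * (V $ i * V $ j)\<bar> \<le> norm M * (norm V)\<^sup>2"
proof -
  define T where "T = (\<chi> i. V $ i *\<^sub>R V)"
  have M: "(\<Sum>i\<in>UNIV. \<Sum>j\<in>UNIV. M $ i $ j * (V $ i * V $ j)) = inner M T"
    by (simp add: inner_vec_def T_def)
  have "norm T = (norm V)\<^sup>2"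
  proof (rule power2_eq_imp_eq)
    have "(norm T)\<^sup>2 = (\<Sum>i\<in>UNIV. inner (T $ i) (T $ i))"
      by (simp only: power2_norm_eq_inner inner_vec_def)
    also have "\<dots> = (\<Sum>i\<in>UNIV. V $ i * V $ i) * inner V V"
      by (simp only: T_def vec_lambda_beta inner_scaleR_left inner_scaleR_right sum_distrib_right mult.assoc)
    also have "\<dots> = inner V V * inner V V"
      by (simp only: inner_vec_def inner_real_def)
    finally show "(norm T)\<^sup>2 = ((norm V)\<^sup>2)\<^sup>2"
      by (metis power2_norm_eq_inner power2_eq_square)
  qed auto
  then show ?thesis
    using Cauchy_Schwarz_ineq2[of M T] M by simp
qed

lemma dilate_eq_0:
  assumes "\<And>z. z \<notin> K \<Longrightarrow> \<psi> z = 0" "0 < \<tau>" "y \<notin> (\<lambda>z. x + \<tau> *\<^sub>R z) ` K"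
  shows "dilate \<psi> x \<tau> y = 0"
proof -
  have "y = x + \<tau> *\<^sub>R (inverse \<tau> *\<^sub>R (y - x))" using assms(2) by simp
  then have "inverse \<tau> *\<^sub>R (y - x) \<notin> K" using assms(3) image_eqI by metis
  then show ?thesis using assms(1) by (simp add: dilate_def)
qed

lemma partial_deriv_eq_0:
  fixes \<psi> :: "real^'n::finite \<Rightarrow> real"
  assumes "\<And>z. z \<notin> K \<Longrightarrow> \<psi> z = 0" "closed K" "z \<notin> K"
  shows "partial_deriv j \<psi> z = 0"
proof -
  have "((\<lambda>_. 0::real) has_derivative (\<lambda>_. 0)) (at z)" by simp
  then have "(\<psi> has_derivative (\<lambda>_. 0)) (at z)"
    by (rule has_derivative_transform_within_open[where s="- K"]) (use assms in auto)
  then show ?thesis by (rule partial_deriv_eq)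
qed

lemma radial_tensor_deriv_eq_0:
  fixes \<psi> :: "real^'n::finite \<Rightarrow> real"
  assumes "smooth_alg \<psi>" "\<And>z. z \<notin> K \<Longrightarrow> \<psi> z = 0" "closed K" "0 < \<tau>" "y \<notin> (\<lambda>z. x + \<tau> *\<^sub>R z) ` K"
  shows "partial_deriv j (radial_tensor \<psi> x \<tau> i j) y = 0"
proof -
  have 1: "dilate \<psi> x \<tau> y = 0"
    by (rule dilate_eq_0[OF assms(2,4,5)])
  have 2: "dilate (partial_deriv j \<psi>) x \<tau> y = 0"
    by (rule dilate_eq_0[OF _ assms(4,5)]) (rule partial_deriv_eq_0[OF assms(2,3)])
  show ?thesis
    by (simp only: partial_deriv_radial_tensor[OF assms(1)] 1 2 mult_zero_right add_0)
qed

lemma test_function_radial_tensor: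
  fixes \<psi> :: "real^'n::finite \<Rightarrow> real"
  assumes "smooth_alg \<psi>" "\<And>z. z \<notin> K \<Longrightarrow> \<psi> z = 0" "compact K" "0 < \<tau>"
    and "(\<lambda>z. x + \<tau> *\<^sub>R z) ` K \<subseteq> \<Omega>"
  shows "test_function \<Omega> (radial_tensor \<psi> x \<tau> i j)"
proof -
  let ?K = "(\<lambda>z. x + \<tau> *\<^sub>R z) ` K"
  have "compact ?K"
    by (intro compact_continuous_image assms) (auto intro!: continuous_intros)
  moreover have "{y. radial_tensor \<psi> x \<tau> i j y \<noteq> 0} \<subseteq> ?K"
  proof
    fix y assume "y \<in> {y. radial_tensor \<psi> x \<tau> i j y \<noteq> 0}"
    then have "dilate \<psi> x \<tau> y \<noteq> 0" by (simp add: radial_tensor_def)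
    then show "y \<in> ?K"
      by (rule contrapos_np) (rule dilate_eq_0[OF assms(2,4)])
  qed
  ultimately have sub: "{y. radial_tensor \<psi> x \<tau> i j y \<noteq> 0} \<subseteq> ?K" and K: "compact ?K"
    by blast+
  then have "closure {y. radial_tensor \<psi> x \<tau> i j y \<noteq> 0} \<subseteq> \<Omega>"
    using closure_minimal[OF sub compact_imp_closed[OF K]] assms(5) by (rule_tac subset_trans)
  moreover have "compact (closure {y. radial_tensor \<psi> x \<tau> i j y \<noteq> 0})"
    unfolding compact_closure by (rule bounded_subset[OF compact_imp_bounded[OF K] sub])
  ultimately show ?thesis
    unfolding test_function_def using smooth_alg_smooth[OF smooth_alg_radial_tensor[OF assms(1)]] by blast
qed

text \<open>Differentiation under the integral asks for continuity on a box, hence the globally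
  continuous \<open>U\<close> in place of \<open>u\<close> and no reference to \<Omega>. All
  \<tau>-dependence sits in smooth functions, so \<open>U\<close> is never differentiated.\<close>

lemma transport_FTC:
  fixes \<psi> :: "real^'n::finite \<Rightarrow> real" and U :: "real^'n \<Rightarrow> real^'n" and a b x :: "real^'n"
  assumes \<psi>: "smooth_alg \<psi>" and st: "0 < s" "s \<le> t" and U: "continuous_on UNIV U"
  defines "g \<equiv> \<lambda>\<tau>. integral (cbox a b) (\<lambda>y. \<Sum>i\<in>UNIV. U y $ i * radial_field \<psi> x \<tau> i y)"
  defines "g' \<equiv> \<lambda>\<tau>. integral (cbox a b) (\<lambda>y. \<Sum>i\<in>UNIV. U y $ i *
       - (\<Sum>j\<in>UNIV. partial_deriv j (radial_tensor \<psi> x \<tau> i j) y))"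
  shows "continuous_on {s..t} g'" "(g' has_integral g t - g s) {s..t}"
proof -
  have cont: "continuous_on ({s..t} \<times> cbox a b) (\<lambda>(\<tau>, y). \<Sum>i\<in>UNIV. U y $ i *
       - (\<Sum>j\<in>UNIV. partial_deriv j (radial_tensor \<psi> x \<tau> i j) y))"
  proof -
    have "continuous_on ({s..t} \<times> cbox a b) (\<lambda>p. U (snd p))"
      by (rule continuous_on_compose2[OF U]) (auto intro!: continuous_intros)
    then show ?thesis
      using radial_tensor_deriv_continuous[OF \<psi> st(1), of t "cbox a b"]
      unfolding split_def
      by (intro continuous_on_sum continuous_on_mult continuous_on_minus continuous_on_component) blast+
  qed
  show "continuous_on {s..t} g'"
    unfolding g'_def by (rule integral_continuous_on_param[OF cont])
  have "(g has_real_derivative g' \<tau>) (at \<tau> within {s..t})" if "\<tau> \<in> {s..t}" for \<tau>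
    unfolding g_def g'_def
  proof (rule leibniz_rule_field_derivative[OF _ _ cont that])
    fix \<tau>' y assume "\<tau>' \<in> {s..t}"
    then have "0 < \<tau>'" using st by auto
    from radial_field_has_deriv[OF \<psi> this]
    have "((\<lambda>\<tau>. radial_field \<psi> x \<tau> i y) has_real_derivative
        - (\<Sum>j\<in>UNIV. partial_deriv j (radial_tensor \<psi> x \<tau>' i j) y)) (at \<tau>' within {s..t})" for i
      by (rule has_field_derivative_at_within)
    then show "((\<lambda>\<tau>. \<Sum>i\<in>UNIV. U y $ i * radial_field \<psi> x \<tau> i y) has_real_derivative
       (\<Sum>i\<in>UNIV. U y $ i * - (\<Sum>j\<in>UNIV. partial_deriv j (radial_tensor \<psi> x \<tau>' i j) y)))
       (at \<tau>' within {s..t})"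
      by (intro DERIV_sum DERIV_cmult)
  next
    fix \<tau>'
    show "(\<lambda>y. \<Sum>i\<in>UNIV. U y $ i * radial_field \<psi> x \<tau>' i y) integrable_on cbox a b"
      by (intro integrable_continuous continuous_on_sum continuous_on_mult continuous_on_component
          continuous_on_subset[OF U] smooth_alg_continuous[OF smooth_alg_radial_field[OF \<psi>]]) simp
  qed simp
  then show "(g' has_integral g t - g s) {s..t}"
    by (intro fundamental_theorem_of_calculus st) (simp add: has_real_derivative_iff_has_vector_derivative)
qed

text \<open>Connects the distributional pairing, a Lebesgue integral over \<Omega>, with the box
  integrals of \<open>transport_FTC\<close>. Both see only \<open>Q\<close>, where \<open>u\<close>
  and its extension agree.\<close>

lemma set_integral_eq_integral_cbox:
  fixes f h :: "real^'n::finite \<Rightarrow> real"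
  assumes "continuous_on UNIV h" "\<And>y. y \<in> \<Omega> \<Longrightarrow> f y = h y" "\<And>y. y \<notin> Q \<Longrightarrow> h y = 0"
    and "Q \<subseteq> \<Omega>" "Q \<subseteq> cbox a b"
  shows "(LINT y:\<Omega>|lebesgue. f y) = integral (cbox a b) h"
proof -
  have eq: "(\<lambda>y. indicat_real \<Omega> y *\<^sub>R f y) = (\<lambda>y. indicat_real (cbox a b) y *\<^sub>R h y)"
  proof
    fix y
    consider "y \<in> Q" | "y \<notin> Q" by blast
    then show "indicator \<Omega> y *\<^sub>R f y = indicator (cbox a b) y *\<^sub>R h y"
    proof cases
      case 1
      then have "y \<in> \<Omega>" "y \<in> cbox a b" using assms(4,5) by blast+
      then show ?thesis using assms(2) by simp
    next
      case 2
      then show ?thesis using assms(2)[of y] assms(3)[of y] by (simp add: indicator_def)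
    qed
  qed
  have "h absolutely_integrable_on cbox a b"
    by (intro absolutely_integrable_continuous continuous_on_subset[OF assms(1)]) auto
  with eq show "(LINT y:\<Omega>|lebesgue. f y) = integral (cbox a b) h"
    using set_lebesgue_integral_eq_integral(2)[of "cbox a b" h]
    by (simp_all add: set_integrable_def set_lebesgue_integral_def)
qed

section \<open>Pairing with the symmetric gradient and the weak ray inequality\<close>

lemma nn_integral_lborel_affine:
  fixes f :: "'a::euclidean_space \<Rightarrow> ennreal"
  assumes [measurable]: "f \<in> borel_measurable borel" and "0 < c"
  shows "(\<integral>\<^sup>+y. f y \<partial>lborel) = ennreal (c ^ DIM('a)) * (\<integral>\<^sup>+z. f (x + c *\<^sub>R z) \<partial>lborel)"
  using assms(2)
  by (subst lborel_affine[of c x]) (simp_all add: nn_integral_density nn_integral_distr nn_integral_cmult)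

lemma integral_lborel_affine:
  fixes f :: "'a::euclidean_space \<Rightarrow> real"
  assumes [measurable]: "f \<in> borel_measurable borel" and "0 < c"
  shows "(LINT y|lborel. f y) = c ^ DIM('a) * (LINT z|lborel. f (x + c *\<^sub>R z))"
  using assms(2)
  by (subst lborel_affine[of c x]) (simp_all add: integral_density integral_distr)

text \<open>Undoes the dilation: after \<open>y = x + \<tau> z\<close> all powers of \<tau> cancel
  and the tensor becomes \<open>\<psi> z\<close> times the entries \<open>z $ i * z $ j\<close>, so
  \<open>inner_quadratic_le\<close> produces \<open>(norm z)\<^sup>2\<close>. The function
  \<open>m\<close> is a Borel version of \<open>norm (E y)\<close>, set to zero off \<Omega>, for
  which substitution and Fubini are available.\<close>

lemma sym_grad_pairing_le:
  fixes \<psi> :: "real^'n::finite \<Rightarrow> real" and E :: "real^'n \<Rightarrow> real^'n^'n"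
  assumes \<psi>: "smooth_alg \<psi>" "\<And>z. 0 \<le> \<psi> z" "\<And>z. z \<notin> K \<Longrightarrow> \<psi> z = 0" and K: "compact K" and \<tau>: "0 < \<tau>"
    and sub: "(\<lambda>z. x + \<tau> *\<^sub>R z) ` K \<subseteq> \<Omega>"
    and E: "E locally_integrable_on \<Omega>"
    and m [measurable]: "m \<in> borel_measurable borel"
    and ae: "AE y in lebesgue. ennreal (norm (E y)) * indicator \<Omega> y = m y"
  shows "ennreal \<bar>\<Sum>i\<in>UNIV. \<Sum>j\<in>UNIV. LINT y:\<Omega>|lebesgue. E y $ i $ j * radial_tensor \<psi> x \<tau> i j y\<bar>
    \<le> (\<integral>\<^sup>+z. ennreal (\<psi> z) * (ennreal ((norm z)\<^sup>2) * m (x + \<tau> *\<^sub>R z)) \<partial>lborel)"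
proof -
  let ?K = "(\<lambda>z. x + \<tau> *\<^sub>R z) ` K"
  let ?T = "\<lambda>y i j. radial_tensor \<psi> x \<tau> i j y"
  let ?d = "\<lambda>y. inverse \<tau> ^ (CARD('n) + 2) * dilate \<psi> x \<tau> y"
  have [measurable]: "\<psi> \<in> borel_measurable borel" "dilate \<psi> x \<tau> \<in> borel_measurable borel"
    by (auto intro!: borel_measurable_continuous_onI smooth_alg_continuous smooth_alg_dilate \<psi>(1))
  have cK: "compact ?K"
    by (intro compact_continuous_image K) (auto intro!: continuous_intros)
  have EK: "E absolutely_integrable_on ?K"
    using E cK sub unfolding locally_integrable_on_def by blast
  have T0: "?T y i j = 0" if "y \<notin> ?K" for y i j
    using dilate_eq_0[OF \<psi>(3) \<tau> that] by (simp add: radial_tensor_def)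
  have int: "integrable lebesgue (\<lambda>y. indicat_real \<Omega> y * (E y $ i $ j * ?T y i j))" for i j
  proof -
    have 1: "(\<lambda>M. M $ i $ j) \<circ> E absolutely_integrable_on ?K"
      by (rule absolutely_integrable_linear[OF EK])
        (rule bounded_linear_compose[OF bounded_linear_vec_nth bounded_linear_vec_nth])
    have cont: "continuous_on S (\<lambda>y. ?T y i j)" for S
      by (rule smooth_alg_continuous[OF smooth_alg_radial_tensor[OF \<psi>(1)]])
    have 2: "bounded ((\<lambda>y. ?T y i j) ` ?K)"
      by (rule compact_imp_bounded[OF compact_continuous_image[OF cont cK]])
    have 3: "?K \<in> sets lebesgue"
      using cK by (simp add: compact_imp_closed lmeasurable_compact fmeasurableD)
    from this have 4: "(\<lambda>y. ?T y i j) \<in> borel_measurable (lebesgue_on ?K)"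
      by (rule continuous_imp_measurable_on_sets_lebesgue[OF cont])
    have "(\<lambda>y. ?T y i j * ((\<lambda>M. M $ i $ j) \<circ> E) y) absolutely_integrable_on ?K"
      by (rule absolutely_integrable_bounded_measurable_product[OF bilinear_times 4 3 2 1])
    moreover have "(\<lambda>y. indicat_real ?K y *\<^sub>R (?T y i j * ((\<lambda>M. M $ i $ j) \<circ> E) y)) =
      (\<lambda>y. indicat_real \<Omega> y * (E y $ i $ j * ?T y i j))"
    proof
      fix y
      show "indicat_real ?K y *\<^sub>R (?T y i j * ((\<lambda>M. M $ i $ j) \<circ> E) y) =
        indicat_real \<Omega> y * (E y $ i $ j * ?T y i j)"
        using sub T0[of y i j] by (cases "y \<in> ?K") (auto simp: indicator_def)
    qed
    ultimately show ?thesis by (simp add: set_integrable_def)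
  qed
  define F where "F y = (\<Sum>i\<in>UNIV. \<Sum>j\<in>UNIV. indicat_real \<Omega> y * (E y $ i $ j * ?T y i j))" for y
  have "integrable lebesgue F"
    unfolding F_def by (intro Bochner_Integration.integrable_sum int)
  moreover have "(\<Sum>i\<in>UNIV. \<Sum>j\<in>UNIV. LINT y:\<Omega>|lebesgue. E y $ i $ j * ?T y i j) = integral\<^sup>L lebesgue F"
  proof -
    have "integral\<^sup>L lebesgue F =
        (\<Sum>i\<in>UNIV. LINT y|lebesgue. (\<Sum>j\<in>UNIV. indicat_real \<Omega> y * (E y $ i $ j * ?T y i j)))"
      unfolding F_def
      by (rule Bochner_Integration.integral_sum) (rule Bochner_Integration.integrable_sum, rule int)
    also have "\<dots> = (\<Sum>i\<in>UNIV. \<Sum>j\<in>UNIV. LINT y|lebesgue. indicat_real \<Omega> y * (E y $ i $ j * ?T y i j))"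
      by (rule sum.cong[OF refl]) (rule Bochner_Integration.integral_sum, rule int)
    finally show ?thesis by (simp only: set_lebesgue_integral_def real_scaleR_def)
  qed
  ultimately have "ennreal \<bar>\<Sum>i\<in>UNIV. \<Sum>j\<in>UNIV. LINT y:\<Omega>|lebesgue. E y $ i $ j * ?T y i j\<bar> \<le>
      (\<integral>\<^sup>+y. ennreal (norm (F y)) \<partial>lebesgue)"
    using integral_norm_bound_ennreal[of lebesgue F] by simp
  also have "\<dots> \<le> (\<integral>\<^sup>+y. ennreal (norm (E y)) * indicator \<Omega> y * ennreal ((norm (y - x))\<^sup>2 * ?d y) \<partial>lebesgue)"
  proof (rule nn_integral_mono)
    fix y
    have d: "0 \<le> ?d y" using \<psi>(2) \<tau> by (simp add: dilate_def)
    have "(\<Sum>i\<in>UNIV. \<Sum>j\<in>UNIV. E y $ i $ j * ?T y i j) =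
        (\<Sum>i\<in>UNIV. \<Sum>j\<in>UNIV. E y $ i $ j * ((y - x) $ i * (y - x) $ j)) * ?d y"
      by (simp only: radial_tensor_def sum_distrib_right mult.assoc)
    then have "\<bar>\<Sum>i\<in>UNIV. \<Sum>j\<in>UNIV. E y $ i $ j * ?T y i j\<bar> \<le> norm (E y) * (norm (y - x))\<^sup>2 * ?d y"
      using mult_right_mono[OF inner_quadratic_le[of "E y" "y - x"] d] d
      by (simp only: abs_mult[of _ "?d y"] abs_of_nonneg[of "?d y"])
    then show "ennreal (norm (F y)) \<le> ennreal (norm (E y)) * indicator \<Omega> y * ennreal ((norm (y - x))\<^sup>2 * ?d y)"
      unfolding F_def
      by (cases "y \<in> \<Omega>") (simp_all add: ennreal_mult'[symmetric] ennreal_leI mult.assoc)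
  qed
  also have "\<dots> = (\<integral>\<^sup>+y. m y * ennreal ((norm (y - x))\<^sup>2 * ?d y) \<partial>lebesgue)"
    by (rule nn_integral_cong_AE) (use ae in eventually_elim, simp)
  also have "\<dots> = (\<integral>\<^sup>+y. m y * ennreal ((norm (y - x))\<^sup>2 * ?d y) \<partial>lborel)"
    by (rule nn_integral_completion)
  also have "\<dots> = ennreal (\<tau> ^ CARD('n)) *
     (\<integral>\<^sup>+z. m (x + \<tau> *\<^sub>R z) * ennreal ((norm (\<tau> *\<^sub>R z))\<^sup>2 * ?d (x + \<tau> *\<^sub>R z)) \<partial>lborel)"
    by (subst nn_integral_lborel_affine[OF _ \<tau>, of _ x]) simp_all
  also have "\<dots> = (\<integral>\<^sup>+z. ennreal (\<tau> ^ CARD('n)) * (m (x + \<tau> *\<^sub>R z) * ennreal ((norm (\<tau> *\<^sub>R z))\<^sup>2 * ?d (x + \<tau> *\<^sub>R z))) \<partial>lborel)"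
    by (rule nn_integral_cmult[symmetric]) measurable
  also have "\<dots> = (\<integral>\<^sup>+z. ennreal (\<psi> z) * (ennreal ((norm z)\<^sup>2) * m (x + \<tau> *\<^sub>R z)) \<partial>lborel)"
  proof (rule nn_integral_cong)
    fix z
    have "\<tau> ^ CARD('n) * ((norm (\<tau> *\<^sub>R z))\<^sup>2 * ?d (x + \<tau> *\<^sub>R z)) = \<psi> z * (norm z)\<^sup>2"
      using \<tau> by (simp add: dilate_def power_add power2_eq_square power_inverse field_simps)
    then have *: "ennreal (\<tau> ^ CARD('n)) * ennreal ((norm (\<tau> *\<^sub>R z))\<^sup>2 * ?d (x + \<tau> *\<^sub>R z)) =
       ennreal (\<psi> z) * ennreal ((norm z)\<^sup>2)"
      using \<tau> \<psi>(2) by (simp add: ennreal_mult'[symmetric] dilate_def)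
    show "ennreal (\<tau> ^ CARD('n)) * (m (x + \<tau> *\<^sub>R z) * ennreal ((norm (\<tau> *\<^sub>R z))\<^sup>2 * ?d (x + \<tau> *\<^sub>R z))) =
        ennreal (\<psi> z) * (ennreal ((norm z)\<^sup>2) * m (x + \<tau> *\<^sub>R z))"
      unfolding mult.left_commute[of _ "m _"] * by (simp only: mult.assoc mult.commute mult.left_commute)
  qed
  finally show ?thesis .
qed


text \<open>Written in the variable \<open>y\<close>, the \<psi>-average of
  \<open>inner z (u (x + \<tau> *\<^sub>R z))\<close> is the pairing of \<open>u\<close> with
  \<open>radial_field\<close>. Its \<tau>-derivative is then the distributional gradient of
  \<open>u\<close> tested against \<open>radial_tensor\<close>, and integration over
  \<open>{s..t}\<close> gives the difference of the endpoint averages.\<close>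

lemma weak_ray_bound:
  fixes \<psi> :: "real^'n::finite \<Rightarrow> real" and E :: "real^'n \<Rightarrow> real^'n^'n" and u :: "real^'n \<Rightarrow> real^'n"
  assumes \<psi>: "smooth_alg \<psi>" "\<And>z. 0 \<le> \<psi> z" "\<And>z. z \<notin> K \<Longrightarrow> \<psi> z = 0" and K: "compact K"
    and st: "0 < s" "s \<le> t"
    and seg: "\<And>\<tau> z. \<tau> \<in> {s..t} \<Longrightarrow> z \<in> K \<Longrightarrow> x + \<tau> *\<^sub>R z \<in> \<Omega>"
    and u: "continuous_on \<Omega> u" and E: "has_sym_grad \<Omega> u E"
    and m [measurable]: "m \<in> borel_measurable borel"
    and ae: "AE y in lebesgue. ennreal (norm (E y)) * indicator \<Omega> y = m y"
  shows "integrable lborel (\<lambda>z. \<psi> z * inner z (u (x + s *\<^sub>R z) - u (x + t *\<^sub>R z)))" (is ?int)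
    and "ennreal (LINT z|lborel. \<psi> z * inner z (u (x + s *\<^sub>R z) - u (x + t *\<^sub>R z)))
      \<le> (\<integral>\<^sup>+z. ennreal (\<psi> z) * (ennreal ((norm z)\<^sup>2) * (\<integral>\<^sup>+\<tau>\<in>{s..t}. m (x + \<tau> *\<^sub>R z) \<partial>lborel)) \<partial>lborel)"
      (is ?le)
proof -
  define Q where "Q = (\<lambda>(\<tau>, z). x + \<tau> *\<^sub>R z) ` ({s..t} \<times> K)"
  have "compact Q"
    unfolding Q_def split_def
    by (intro compact_continuous_image compact_Times K) (auto intro!: continuous_intros)
  have Q: "Q \<subseteq> \<Omega>" using seg by (auto simp: Q_def)
  have subQ: "(\<lambda>z. x + \<tau> *\<^sub>R z) ` K \<subseteq> Q" if "\<tau> \<in> {s..t}" for \<tau>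
    using that by (auto simp: Q_def)
  \<comment> \<open>Only values on the compact set \<open>Q\<close> swept out by the segments
    matter, so a Tietze extension of \<open>u\<close> from \<open>Q\<close> supplies the global
    function that \<open>transport_FTC\<close> needs.\<close>
  obtain U where U: "continuous_on UNIV U" "\<And>y. y \<in> Q \<Longrightarrow> U y = u y"
    using Tietze_unbounded[OF continuous_on_subset[OF u Q], of UNIV] compact_imp_closed[OF \<open>compact Q\<close>]
    by auto
  obtain a b where ab: "Q \<subseteq> cbox a b"
    using compact_imp_bounded[OF \<open>compact Q\<close>] bounded_subset_cbox_symmetric by metis
  define g where "g \<tau> = integral (cbox a b) (\<lambda>y. \<Sum>i\<in>UNIV. U y $ i * radial_field \<psi> x \<tau> i y)" for \<tau>
  define g' where "g' \<tau> = integral (cbox a b) (\<lambda>y. \<Sum>i\<in>UNIV. U y $ i *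
       - (\<Sum>j\<in>UNIV. partial_deriv j (radial_tensor \<psi> x \<tau> i j) y))" for \<tau>
  have g'_cont: "continuous_on {s..t} g'" and g'_int: "(g' has_integral g t - g s) {s..t}"
    unfolding g_def g'_def using transport_FTC[OF \<psi>(1) st U(1)] by auto
  have contU: "continuous_on UNIV (\<lambda>y. U y $ i)" for i
    by (intro continuous_on_component U)
  have [measurable]: "U \<in> borel_measurable borel" "\<psi> \<in> borel_measurable borel"
    using U(1) \<psi>(1) by (auto intro!: borel_measurable_continuous_onI smooth_alg_continuous)
  have \<psi>U: "\<psi> z * inner z (U (x + \<tau> *\<^sub>R z)) = \<psi> z * inner z (u (x + \<tau> *\<^sub>R z))" if "\<tau> \<in> {s..t}" for \<tau> z
    using \<psi>(3)[of z] U(2)[of "x + \<tau> *\<^sub>R z"] subQ[OF that] by (cases "z \<in> K") auto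
  have int\<psi>: "integrable lborel (\<lambda>z. \<psi> z * inner z (u (x + \<tau> *\<^sub>R z)))" if "\<tau> \<in> {s..t}" for \<tau>
  proof -
    have "continuous_on K (\<lambda>z. \<psi> z * inner z (U (x + \<tau> *\<^sub>R z)))"
      by (intro continuous_on_mult smooth_alg_continuous[OF \<psi>(1)] continuous_on_inner continuous_on_id
          continuous_on_compose2[OF U(1)] continuous_intros) simp
    then have "integrable lborel (\<lambda>z. indicat_real K z *\<^sub>R (\<psi> z * inner z (U (x + \<tau> *\<^sub>R z))))"
      by (rule borel_integrable_compact[OF K])
    moreover have "(\<lambda>z. indicat_real K z *\<^sub>R (\<psi> z * inner z (U (x + \<tau> *\<^sub>R z)))) =
       (\<lambda>z. \<psi> z * inner z (u (x + \<tau> *\<^sub>R z)))"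
      using \<psi>(3) unfolding \<psi>U[OF that] by (auto simp: fun_eq_iff indicator_def)
    ultimately show ?thesis by (simp only:)
  qed
  have g_eq: "g \<tau> = (LINT z|lborel. \<psi> z * inner z (u (x + \<tau> *\<^sub>R z)))" if \<tau>: "\<tau> \<in> {s..t}" for \<tau>
  proof -
    have \<tau>0: "0 < \<tau>" using \<tau> st by auto
    define h where "h y = (\<Sum>i\<in>UNIV. U y $ i * radial_field \<psi> x \<tau> i y)" for y
    have h: "continuous_on UNIV h"
      unfolding h_def
      by (intro continuous_on_sum continuous_on_mult contU smooth_alg_continuous[OF smooth_alg_radial_field[OF \<psi>(1)]])
    have h0: "h y = 0" if "y \<notin> Q" for y
      unfolding h_def radial_field_def
      using dilate_eq_0[OF \<psi>(3) \<tau>0 contra_subsetD[OF subQ[OF \<tau>] that]] by simp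
    have "g \<tau> = (LINT y:UNIV|lebesgue. h y)"
      unfolding g_def h_def[symmetric]
      by (rule set_integral_eq_integral_cbox[OF h _ h0 subset_UNIV ab, symmetric]) simp_all
    also have "\<dots> = (LINT y|lborel. h y)"
      using h by (simp add: set_lebesgue_integral_def integral_completion borel_measurable_continuous_onI)
    also have "\<dots> = \<tau> ^ CARD('n) * (LINT z|lborel. h (x + \<tau> *\<^sub>R z))"
      using integral_lborel_affine[OF borel_measurable_continuous_onI[OF h] \<tau>0, of x] by simp
    also have "\<dots> = (LINT z|lborel. \<tau> ^ CARD('n) * h (x + \<tau> *\<^sub>R z))"
      by simp
    also have "(\<lambda>z. \<tau> ^ CARD('n) * h (x + \<tau> *\<^sub>R z)) = (\<lambda>z. \<psi> z * inner z (u (x + \<tau> *\<^sub>R z)))"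
    proof
      fix z
      have "h (x + \<tau> *\<^sub>R z) = (\<Sum>i\<in>UNIV. U (x + \<tau> *\<^sub>R z) $ i * z $ i) * \<tau> * inverse \<tau> ^ (CARD('n) + 1) * \<psi> z"
        using \<tau>0 by (simp add: h_def radial_field_def dilate_def sum_distrib_right sum_distrib_left ac_simps)
      also have "(\<Sum>i\<in>UNIV. U (x + \<tau> *\<^sub>R z) $ i * z $ i) = inner z (U (x + \<tau> *\<^sub>R z))"
        by (simp add: inner_vec_def mult.commute)
      finally have "\<tau> ^ CARD('n) * h (x + \<tau> *\<^sub>R z) = \<psi> z * inner z (U (x + \<tau> *\<^sub>R z))"
        using \<tau>0 by (simp add: power_inverse mult.assoc[symmetric])
      then show "\<tau> ^ CARD('n) * h (x + \<tau> *\<^sub>R z) = \<psi> z * inner z (u (x + \<tau> *\<^sub>R z))"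
        by (simp only: \<psi>U[OF \<tau>])
    qed
    finally show ?thesis .
  qed
  have g'_le: "ennreal \<bar>g' \<tau>\<bar> \<le> (\<integral>\<^sup>+z. ennreal (\<psi> z) * (ennreal ((norm z)\<^sup>2) * m (x + \<tau> *\<^sub>R z)) \<partial>lborel)"
    if \<tau>: "\<tau> \<in> {s..t}" for \<tau>
  proof -
    have \<tau>0: "0 < \<tau>" using \<tau> st by auto
    let ?D = "\<lambda>i j. partial_deriv j (radial_tensor \<psi> x \<tau> i j)"
    have cont: "continuous_on UNIV (\<lambda>y. U y $ i * ?D i j y)" for i j
      by (intro continuous_on_mult contU smooth_alg_continuous[OF smooth_alg_partial_deriv[OF smooth_alg_radial_tensor[OF \<psi>(1)]]])
    have D: "?D i j y = 0" if "y \<notin> Q" for y i j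
      by (rule radial_tensor_deriv_eq_0[OF \<psi>(1,3) compact_imp_closed[OF K] \<tau>0
            contra_subsetD[OF subQ[OF \<tau>] that]])
    then have D0: "U y $ i * ?D i j y = 0" if "y \<notin> Q" for y i j
      using that by simp
    have uU: "u y $ i * ?D i j y = U y $ i * ?D i j y" for y i j
      using D[of y j i] U(2)[of y] by (cases "y \<in> Q") simp_all
    have dg: "distr_grad \<Omega> u i j (radial_tensor \<psi> x \<tau> i j) = - integral (cbox a b) (\<lambda>y. U y $ i * ?D i j y)" for i j
      unfolding distr_grad_def
      using set_integral_eq_integral_cbox[OF cont uU D0 Q ab] by simp
    have int: "(\<lambda>y. U y $ i * ?D i j y) integrable_on cbox a b" for i j
      by (rule integrable_continuous[OF continuous_on_subset[OF cont]]) simp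
    have "g' \<tau> = integral (cbox a b) (\<lambda>y. \<Sum>i\<in>UNIV. \<Sum>j\<in>UNIV. - (U y $ i * ?D i j y))"
      unfolding g'_def by (simp add: sum_distrib_left sum_negf)
    also have "\<dots> = (\<Sum>i\<in>UNIV. \<Sum>j\<in>UNIV. distr_grad \<Omega> u i j (radial_tensor \<psi> x \<tau> i j))"
      by (simp add: integral_sum integrable_sum integrable_neg int dg)
    \<comment> \<open>Here the full gradient is traded for its symmetric part: the test functions
      are symmetric in \<open>i\<close> and \<open>j\<close>, so exchanging the summation indices
      leaves the double sum unchanged.\<close>
    also have "\<dots> = (\<Sum>i\<in>UNIV. \<Sum>j\<in>UNIV. distr_sym_grad \<Omega> u i j (radial_tensor \<psi> x \<tau> i j))"
    proof -
      let ?G = "\<lambda>i j. distr_grad \<Omega> u i j (radial_tensor \<psi> x \<tau> i j)"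
      have "radial_tensor \<psi> x \<tau> i j = radial_tensor \<psi> x \<tau> j i" for i j
        by (simp add: radial_tensor_def fun_eq_iff)
      then have eq: "distr_sym_grad \<Omega> u i j (radial_tensor \<psi> x \<tau> i j) = (?G i j + ?G j i) / 2" for i j
        unfolding distr_sym_grad_def by (simp only:)
      have "(\<Sum>i\<in>UNIV. \<Sum>j\<in>UNIV. distr_sym_grad \<Omega> u i j (radial_tensor \<psi> x \<tau> i j)) =
          (\<Sum>i\<in>UNIV. \<Sum>j\<in>UNIV. ?G i j) / 2 + (\<Sum>i\<in>UNIV. \<Sum>j\<in>UNIV. ?G j i) / 2"
        by (simp only: eq add_divide_distrib sum.distrib sum_divide_distrib)
      moreover have "(\<Sum>i\<in>UNIV. \<Sum>j\<in>UNIV. ?G j i) = (\<Sum>i\<in>UNIV. \<Sum>j\<in>UNIV. ?G i j)"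
        by (rule sum.swap)
      ultimately show ?thesis
        by linarith
    qed
    also have "\<dots> = (\<Sum>i\<in>UNIV. \<Sum>j\<in>UNIV. LINT y:\<Omega>|lebesgue. E y $ i $ j * radial_tensor \<psi> x \<tau> i j y)"
      using E test_function_radial_tensor[OF \<psi>(1,3) K \<tau>0 subset_trans[OF subQ[OF \<tau>] Q]]
      by (simp add: has_sym_grad_def)
    finally show ?thesis
      using sym_grad_pairing_le[OF \<psi> K \<tau>0 subset_trans[OF subQ[OF \<tau>] Q] _ m ae] E
      by (simp add: has_sym_grad_def)
  qed
  have st_in: "s \<in> {s..t}" "t \<in> {s..t}" using st by auto
  show ?int
    using Bochner_Integration.integrable_diff[OF int\<psi>[OF st_in(1)] int\<psi>[OF st_in(2)]]
    by (simp only: inner_diff_right right_diff_distrib)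
  have "(LINT z|lborel. \<psi> z * inner z (u (x + s *\<^sub>R z) - u (x + t *\<^sub>R z))) = g s - g t"
    unfolding g_eq[OF st_in(1)] g_eq[OF st_in(2)]
    using Bochner_Integration.integral_diff[OF int\<psi>[OF st_in(1)] int\<psi>[OF st_in(2)]]
    by (simp only: inner_diff_right right_diff_distrib)
  also have "ennreal (g s - g t) \<le> (\<integral>\<^sup>+\<tau>\<in>{s..t}. ennreal \<bar>g' \<tau>\<bar> \<partial>lborel)"
  proof -
    have int: "set_integrable lborel {s..t} g'"
      using borel_integrable_compact[OF compact_Icc g'_cont] by (simp add: set_integrable_def)
    have "g t - g s = (LINT \<tau>:{s..t}|lborel. g' \<tau>)"
      using set_borel_integral_eq_integral(2)[OF int] g'_int by (simp add: integral_unique)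
    then have "ennreal \<bar>g t - g s\<bar> \<le> (\<integral>\<^sup>+\<tau>. ennreal (norm (indicat_real {s..t} \<tau> *\<^sub>R g' \<tau>)) \<partial>lborel)"
      using integral_norm_bound_ennreal[OF int[unfolded set_integrable_def]]
      by (simp add: set_lebesgue_integral_def)
    also have "\<dots> = (\<integral>\<^sup>+\<tau>\<in>{s..t}. ennreal \<bar>g' \<tau>\<bar> \<partial>lborel)"
      by (intro nn_integral_cong) (simp add: indicator_def)
    finally show ?thesis
      by (rule order_trans[rotated]) (simp add: ennreal_leI)
  qed
  also have "\<dots> \<le> (\<integral>\<^sup>+\<tau>\<in>{s..t}. (\<integral>\<^sup>+z. ennreal (\<psi> z) * (ennreal ((norm z)\<^sup>2) * m (x + \<tau> *\<^sub>R z)) \<partial>lborel) \<partial>lborel)"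
    by (intro nn_integral_mono) (auto simp: indicator_def intro: g'_le)
  also have "\<dots> = (\<integral>\<^sup>+\<tau>. (\<integral>\<^sup>+z. ennreal (\<psi> z) * (ennreal ((norm z)\<^sup>2) * (m (x + \<tau> *\<^sub>R z) * indicator {s..t} \<tau>)) \<partial>lborel) \<partial>lborel)"
    by (subst nn_integral_multc[symmetric]) (auto simp: mult.assoc)
  also have "\<dots> = (\<integral>\<^sup>+z. (\<integral>\<^sup>+\<tau>. ennreal (\<psi> z) * (ennreal ((norm z)\<^sup>2) * (m (x + \<tau> *\<^sub>R z) * indicator {s..t} \<tau>)) \<partial>lborel) \<partial>lborel)"
    by (rule lborel_pair.Fubini') measurable
  also have "\<dots> = (\<integral>\<^sup>+z. ennreal (\<psi> z) * (ennreal ((norm z)\<^sup>2) * (\<integral>\<^sup>+\<tau>\<in>{s..t}. m (x + \<tau> *\<^sub>R z) \<partial>lborel)) \<partial>lborel)"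
    by (simp add: nn_integral_cmult)
  finally show ?le .
qed

section \<open>From weak to almost everywhere inequalities\<close>

lemma smooth_alg_box_bump:
  fixes a b :: "real^'n::finite"
  shows "\<exists>f. smooth_alg f \<and> (\<forall>y. 0 \<le> f y \<and> f y \<le> 1) \<and> (\<forall>y. f y > 0 \<longleftrightarrow> y \<in> box a b)"
proof (intro exI conjI allI)
  let ?f = "\<lambda>y::real^'n. \<Prod>j\<in>UNIV. flat_exp 0 (y $ j - a $ j) * flat_exp 0 (b $ j - y $ j)"
  show "smooth_alg ?f"
    by (rule smooth_alg_prod) (rule smooth_alg.mult[OF smooth_alg.flat_exp[OF smooth_alg_diff[OF smooth_alg.coord smooth_alg.const]] smooth_alg.flat_exp[OF smooth_alg_diff[OF smooth_alg.const smooth_alg.coord]]])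
  fix y
  show "0 \<le> ?f y" by (intro prod_nonneg mult_nonneg_nonneg flat_exp_bounds)
  show "?f y \<le> 1" by (intro prod_le_1 conjI mult_nonneg_nonneg mult_le_one flat_exp_bounds)
  show "?f y > 0 \<longleftrightarrow> y \<in> box a b"
  proof
    assume "?f y > 0"
    then have "?f y \<noteq> 0" by (rule less_imp_neq[symmetric])
    then have "flat_exp 0 (y $ j - a $ j) * flat_exp 0 (b $ j - y $ j) \<noteq> 0" for j
      by (simp only: prod_zero_iff[OF finite_class.finite_UNIV]) blast
    then have "0 < flat_exp 0 (y $ j - a $ j)" "0 < flat_exp 0 (b $ j - y $ j)" for j
      using flat_exp_bounds(1) by (auto simp: less_le)
    then show "y \<in> box a b"
      by (simp add: mem_box_cart flat_exp_bounds)
  next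
    assume "y \<in> box a b"
    then show "?f y > 0"
      by (intro prod_pos ballI mult_pos_pos) (auto simp: mem_box_cart flat_exp_bounds)
  qed
qed

text \<open>Write the set as a countable union of boxes with bumps \<open>f i\<close> and take one
  minus the product of \<open>(1 - f i y) ^ k\<close> over \<open>i < k\<close>. Every bump
  eventually enters the product, and the growing exponent drives the product to 0 wherever one bump
  is positive; off the set all factors are 1.\<close>

lemma smooth_alg_approx_open:
  fixes U :: "(real^'n::finite) set"
  assumes "open U"
  obtains \<psi> :: "nat \<Rightarrow> real^'n \<Rightarrow> real" where "\<And>k. smooth_alg (\<psi> k)" "\<And>k y. 0 \<le> \<psi> k y" "\<And>k y. \<psi> k y \<le> 1"
    "\<And>k y. y \<notin> U \<Longrightarrow> \<psi> k y = 0" "\<And>y. y \<in> U \<Longrightarrow> (\<lambda>k. \<psi> k y) \<longlonglongrightarrow> 1"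
proof (cases "U = {}")
  case True
  then show ?thesis by (intro that[of "\<lambda>_ _. 0"]) (auto intro: smooth_alg.const)
next
  case False
  obtain D where D: "countable D" "\<And>X. X \<in> D \<Longrightarrow> \<exists>a b. X = box a b" "\<Union>D = U"
    using open_countable_Union_open_box[OF assms] by metis
  with False have ne: "D \<noteq> {}" by auto
  have "\<forall>i. \<exists>f. smooth_alg f \<and> (\<forall>y. 0 \<le> f y \<and> f y \<le> 1) \<and> (\<forall>y. f y > 0 \<longleftrightarrow> y \<in> from_nat_into D i)"
  proof
    fix i
    obtain a b where "from_nat_into D i = box a b" using D(2)[OF from_nat_into[OF ne, of i]] by blast
    then show "\<exists>f. smooth_alg f \<and> (\<forall>y. 0 \<le> f y \<and> f y \<le> 1) \<and> (\<forall>y. f y > 0 \<longleftrightarrow> y \<in> from_nat_into D i)"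
      using smooth_alg_box_bump[of a b] by (simp only:)
  qed
  then obtain f where f: "\<And>i. smooth_alg (f i)" "\<And>i y. 0 \<le> f i y" "\<And>i y. f i y \<le> 1"
     "\<And>i y. f i y > 0 \<longleftrightarrow> y \<in> from_nat_into D i"
    by metis
  define P where "P k y = (\<Prod>i<k. (1 - f i y) ^ k)" for k :: nat and y
  have P0: "0 \<le> P k y" and P1: "P k y \<le> 1" for k y
    unfolding P_def using f by (auto intro!: prod_nonneg prod_le_1 power_le_one)
  show ?thesis
  proof (rule that[of "\<lambda>k y. 1 - P k y"])
    show "smooth_alg (\<lambda>y. 1 - P k y)" for k
      unfolding P_def by (rule smooth_alg_diff[OF smooth_alg.const smooth_alg_prod[OF smooth_alg_power[OF smooth_alg_diff[OF smooth_alg.const f(1)]]]])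
    show "0 \<le> 1 - P k y" "1 - P k y \<le> 1" for k y using P0 P1 by auto
  next
    fix k y assume "y \<notin> U"
    have "f i y = 0" for i
    proof -
      have "y \<notin> from_nat_into D i" using \<open>y \<notin> U\<close> D(3) from_nat_into[OF ne] by blast
      with f(2,4)[of i y] show ?thesis by simp
    qed
    then show "1 - P k y = 0" by (simp add: P_def)
  next
    fix y assume "y \<in> U"
    then obtain X where "X \<in> D" "y \<in> X" using D(3) by blast
    then obtain i where "y \<in> from_nat_into D i" using from_nat_into_surj[OF D(1)] by metis
    then have fi: "0 < f i y" using f(4) by simp
    have "P k y \<le> (1 - f i y) ^ k" if "i < k" for k
    proof -
      have "P k y = (1 - f i y) ^ k * (\<Prod>j\<in>{..<k} - {i}. (1 - f j y) ^ k)"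
        unfolding P_def using that by (intro prod.remove) auto
      also have "\<dots> \<le> (1 - f i y) ^ k * 1"
        using f by (intro mult_left_mono prod_le_1 conjI zero_le_power power_le_one) auto
      finally show ?thesis by simp
    qed
    then have ev: "eventually (\<lambda>k. P k y \<le> (1 - f i y) ^ k) sequentially"
      by (intro eventually_sequentiallyI[of "Suc i"]) auto
    have lim: "(\<lambda>k. (1 - f i y) ^ k) \<longlonglongrightarrow> 0"
      using fi f(3)[of i y] by (intro LIMSEQ_power_zero) auto
    have "(\<lambda>k. P k y) \<longlonglongrightarrow> 0"
      by (rule tendsto_sandwich[OF _ ev tendsto_const lim]) (simp add: P0)
    from tendsto_diff[OF tendsto_const this, of 1] show "(\<lambda>k. 1 - P k y) \<longlonglongrightarrow> 1" by simp
  qed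
qed

section \<open>Comparison of densities through test functions\<close>

lemma ennreal_add_le: "0 \<le> b \<Longrightarrow> ennreal (a + b) \<le> ennreal a + ennreal b"
  by (cases "0 \<le> a") (auto simp: ennreal_neg intro: ennreal_leI)

text \<open>Test functions increasing in effect to the indicator of an open set yield the inequality
  of integrals over open sets; outer regularity extends it to Borel sets, in particular to the set
  where the pointwise inequality fails.\<close>

lemma weak_le_imp_AE_le_box:
  fixes F :: "real^'n::finite \<Rightarrow> real" and G :: "real^'n \<Rightarrow> ennreal"
  assumes F: "continuous_on (cbox a b) F" and G [measurable]: "G \<in> borel_measurable borel"
    and fin: "(\<integral>\<^sup>+z\<in>cbox a b. G z \<partial>lborel) < \<infinity>"
    and weak: "\<And>\<psi>. smooth_alg \<psi> \<Longrightarrow> (\<And>z. 0 \<le> \<psi> z) \<Longrightarrow> (\<And>z. z \<notin> cbox a b \<Longrightarrow> \<psi> z = 0) \<Longrightarrow>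
        integrable lborel (\<lambda>z. \<psi> z * F z) \<and>
        ennreal (LINT z|lborel. \<psi> z * F z) \<le> (\<integral>\<^sup>+z. ennreal (\<psi> z) * G z \<partial>lborel)"
  shows "AE z in lborel. z \<in> box a b \<longrightarrow> ennreal (F z) \<le> G z"
proof -
  let ?B = "box a b"
  obtain M where M: "0 \<le> M" "\<And>z. z \<in> cbox a b \<Longrightarrow> \<bar>F z\<bar> \<le> M"
  proof -
    have "bounded (F ` cbox a b)" by (intro compact_imp_bounded compact_continuous_image F compact_cbox)
    then obtain M where "0 < M" "\<forall>y\<in>F ` cbox a b. norm y \<le> M" unfolding bounded_pos by blast
    then show ?thesis by (intro that[of M]) auto
  qed
  have Bc: "z \<in> cbox a b" if "z \<in> ?B" for z using that box_subset_cbox by blast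
  have F0: "0 \<le> F z + M" if "z \<in> ?B" for z using M(2)[OF Bc[OF that]] by linarith
  have [measurable]: "(\<lambda>z. indicator ?B z *\<^sub>R F z) \<in> borel_measurable borel"
    by (intro borel_measurable_continuous_on_indicator continuous_on_subset[OF F box_subset_cbox]) simp
  \<comment> \<open>Adding the bound \<open>M\<close> of the possibly negative \<open>F\<close> to
    both sides turns them into densities of measures. It is cancelled at the end.\<close>
  define f where "f z = ennreal (indicator ?B z *\<^sub>R F z + M) * indicator ?B z" for z
  define g where "g z = (G z + ennreal M) * indicator ?B z" for z
  have f_eq: "f z = ennreal (F z + M)" if "z \<in> ?B" for z using that by (simp add: f_def)
  have [measurable]: "f \<in> borel_measurable borel" "g \<in> borel_measurable borel"
    unfolding f_def[abs_def] g_def[abs_def] by measurable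
  have open_le: "(\<integral>\<^sup>+z\<in>U. f z \<partial>lborel) \<le> (\<integral>\<^sup>+z\<in>U. g z \<partial>lborel)" if U: "open U" "U \<subseteq> ?B" for U
  proof -
    obtain \<psi> :: "nat \<Rightarrow> real^'n \<Rightarrow> real" where \<psi>: "\<And>k. smooth_alg (\<psi> k)" "\<And>k y. 0 \<le> \<psi> k y" "\<And>k y. \<psi> k y \<le> 1"
      "\<And>k y. y \<notin> U \<Longrightarrow> \<psi> k y = 0" "\<And>y. y \<in> U \<Longrightarrow> (\<lambda>k. \<psi> k y) \<longlonglongrightarrow> 1"
      using smooth_alg_approx_open[OF U(1)] by metis
    have [measurable]: "\<psi> k \<in> borel_measurable borel" for k
      by (intro borel_measurable_continuous_onI smooth_alg_continuous \<psi>)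
    have [measurable]: "U \<in> sets borel" using U(1) by simp
    have le: "(\<integral>\<^sup>+z. ennreal (\<psi> k z) * f z \<partial>lborel) \<le> (\<integral>\<^sup>+z\<in>U. g z \<partial>lborel)" for k
    proof -
      have off: "\<psi> k z = 0" if "z \<notin> cbox a b" for z
        using \<psi>(4) U(2) Bc that by (meson subsetD)
      note w = weak[OF \<psi>(1,2) off]
      have "integrable lborel (\<lambda>z. indicator (cbox a b) z *\<^sub>R \<psi> k z)"
        by (rule borel_integrable_compact[OF compact_cbox smooth_alg_continuous[OF \<psi>(1)]])
      also have "(\<lambda>z. indicator (cbox a b) z *\<^sub>R \<psi> k z) = \<psi> k"
        using off by (auto simp: fun_eq_iff indicator_def)
      finally have i1: "integrable lborel (\<lambda>z. M * \<psi> k z)" by simp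
      have eq: "ennreal (\<psi> k z) * f z = ennreal (\<psi> k z * F z + M * \<psi> k z)" for z
      proof (cases "z \<in> U")
        case True
        with U(2) f_eq F0 \<psi>(2) show ?thesis
          by (auto simp: ennreal_mult'[symmetric] algebra_simps)
      qed (simp add: \<psi>(4))
      have nonneg: "0 \<le> \<psi> k z * F z + M * \<psi> k z" for z
      proof (cases "z \<in> U")
        case True
        then have "0 \<le> \<psi> k z * (F z + M)" using U(2) \<psi>(2) F0 by (intro mult_nonneg_nonneg) auto
        then show ?thesis by (simp add: algebra_simps)
      qed (simp add: \<psi>(4))
      have "(\<integral>\<^sup>+z. ennreal (\<psi> k z) * f z \<partial>lborel) = ennreal (LINT z|lborel. \<psi> k z * F z + M * \<psi> k z)"
        unfolding eq
        by (rule nn_integral_eq_integral) (use w i1 nonneg in auto)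
      also have "\<dots> = ennreal ((LINT z|lborel. \<psi> k z * F z) + (LINT z|lborel. M * \<psi> k z))"
        using w i1 by simp
      also have "\<dots> \<le> ennreal (LINT z|lborel. \<psi> k z * F z) + ennreal (LINT z|lborel. M * \<psi> k z)"
        using M(1) \<psi>(2) by (intro ennreal_add_le integral_nonneg_AE) auto
      also have "\<dots> \<le> (\<integral>\<^sup>+z. ennreal (\<psi> k z) * G z \<partial>lborel) + (\<integral>\<^sup>+z. ennreal (M * \<psi> k z) \<partial>lborel)"
        using w i1 M(1) \<psi>(2) by (intro add_mono) (auto simp: nn_integral_eq_integral)
      also have "\<dots> = (\<integral>\<^sup>+z. ennreal (\<psi> k z) * G z + ennreal (M * \<psi> k z) \<partial>lborel)"
        by (rule nn_integral_add[symmetric]) auto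
      also have "\<dots> \<le> (\<integral>\<^sup>+z\<in>U. g z \<partial>lborel)"
      proof (rule nn_integral_mono)
        fix z
        show "ennreal (\<psi> k z) * G z + ennreal (M * \<psi> k z) \<le> g z * indicator U z"
        proof (cases "z \<in> U")
          case True
          have "ennreal (\<psi> k z) * G z \<le> 1 * G z"
            using \<psi>(3)[of k z] by (intro mult_right_mono) (auto simp: ennreal_le_1)
          moreover have "ennreal (M * \<psi> k z) \<le> ennreal M"
            using M(1) \<psi>(3)[of k z] by (intro ennreal_leI mult_left_le) auto
          ultimately show ?thesis using True U(2) by (auto simp: g_def add_mono)
        qed (simp add: \<psi>(4))
      qed
      finally show ?thesis .
    qed
    \<comment> \<open>A limit is taken only on the side of \<open>f\<close>, where Fatou suffices;
      the side of \<open>g\<close> was already bounded uniformly in \<open>k\<close> because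
      \<open>\<psi> k\<close> is at most the indicator of \<open>U\<close>.\<close>
    have "(\<integral>\<^sup>+z\<in>U. f z \<partial>lborel) = (\<integral>\<^sup>+z. liminf (\<lambda>k. ennreal (\<psi> k z) * f z) \<partial>lborel)"
    proof (rule nn_integral_cong)
      fix z
      have "(\<lambda>k. ennreal (\<psi> k z) * f z) \<longlonglongrightarrow> f z * indicator U z"
      proof (cases "z \<in> U")
        case True
        have "(\<lambda>k. ennreal (\<psi> k z)) \<longlonglongrightarrow> ennreal 1"
          using \<psi>(5)[OF True] by (rule tendsto_ennrealI)
        then have "(\<lambda>k. f z * ennreal (\<psi> k z)) \<longlonglongrightarrow> f z * ennreal 1"
          by (rule ennreal_tendsto_cmult[rotated]) (use True U(2) f_eq in auto)
        with True show ?thesis by (simp add: mult.commute)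
      qed (simp add: \<psi>(4))
      from lim_imp_Liminf[OF _ this] show "f z * indicator U z = liminf (\<lambda>k. ennreal (\<psi> k z) * f z)"
        by simp
    qed
    also have "\<dots> \<le> liminf (\<lambda>k. \<integral>\<^sup>+z. ennreal (\<psi> k z) * f z \<partial>lborel)"
      by (rule nn_integral_liminf) simp
    also have "\<dots> \<le> liminf (\<lambda>k. \<integral>\<^sup>+z\<in>U. g z \<partial>lborel)"
      by (intro Liminf_mono always_eventually allI le)
    finally show ?thesis by (simp add: Liminf_const)
  qed
  let ?f = "density lborel f" and ?g = "density lborel g"
  have g_fin: "(\<integral>\<^sup>+z. g z \<partial>lborel) < \<infinity>"
  proof -
    have "(\<integral>\<^sup>+z. g z \<partial>lborel) \<le> (\<integral>\<^sup>+z. G z * indicator (cbox a b) z + ennreal M * indicator ?B z \<partial>lborel)"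
      using Bc by (intro nn_integral_mono) (auto simp: g_def indicator_def)
    also have "\<dots> = (\<integral>\<^sup>+z\<in>cbox a b. G z \<partial>lborel) + ennreal M * emeasure lborel ?B"
      by (subst nn_integral_add) (auto simp: nn_integral_cmult)
    also have "\<dots> < \<infinity>"
      using fin by (auto simp: ennreal_mult_less_top emeasure_lborel_box_eq)
    finally show ?thesis .
  qed
  have "finite_measure ?g"
    using g_fin by (intro finite_measureI) (simp add: emeasure_density)
  \<comment> \<open>Only the measure with density \<open>g\<close> has to be outer regular:
    \<open>?f A\<close> is below \<open>?f U\<close>, hence below \<open>?g U\<close>, for every
    open \<open>U\<close> containing \<open>A\<close>. This is the purpose of the finiteness of the
    integral of \<open>g\<close>.\<close>
  then have le: "emeasure ?f A \<le> emeasure ?g A" if "A \<in> sets borel" for A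
  proof -
    have "emeasure ?f A \<le> emeasure ?g U" if "U \<in> {U. A \<subseteq> U \<and> open U}" for U
    proof -
      have U: "open U" "U \<in> sets borel" "U \<inter> ?B \<in> sets borel" using that by auto
      have "emeasure ?f A \<le> emeasure ?f U" using that U by (intro emeasure_mono) auto
      also have "\<dots> = (\<integral>\<^sup>+z\<in>U \<inter> ?B. f z \<partial>lborel)"
        using U by (auto simp: emeasure_density f_def indicator_def intro!: nn_integral_cong)
      also have "\<dots> \<le> (\<integral>\<^sup>+z\<in>U \<inter> ?B. g z \<partial>lborel)"
        using U by (intro open_le) auto
      also have "\<dots> = emeasure ?g U"
        using U by (auto simp: emeasure_density g_def indicator_def intro!: nn_integral_cong)
      finally show ?thesis .
    qed
    then show ?thesis
      using outer_regular[of ?g A] \<open>finite_measure ?g\<close> that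
      by (auto intro!: INF_greatest simp: finite_measure.emeasure_finite)
  qed
  define A where "A = {z \<in> ?B. g z < f z}"
  have [measurable]: "A \<in> sets borel"
    unfolding A_def by measurable
  have "AE z in lborel. f z * indicator A z \<le> g z * indicator A z"
  proof (rule ccontr)
    assume *: "\<not> ?thesis"
    have "(\<integral>\<^sup>+z. g z * indicator A z \<partial>lborel) < (\<integral>\<^sup>+z. f z * indicator A z \<partial>lborel)"
    proof (rule nn_integral_less[OF _ _ _ _ *])
      have "(\<integral>\<^sup>+z. g z * indicator A z \<partial>lborel) \<le> (\<integral>\<^sup>+z. g z \<partial>lborel)"
        by (intro nn_integral_mono) (auto simp: indicator_def)
      with g_fin show "(\<integral>\<^sup>+z. g z * indicator A z \<partial>lborel) \<noteq> \<infinity>" by auto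
      show "AE z in lborel. g z * indicator A z \<le> f z * indicator A z"
        by (intro AE_I2) (auto simp: A_def indicator_def)
    qed auto
    with le[of A] show False by (simp add: emeasure_density)
  qed
  then show ?thesis
  proof eventually_elim
    fix z assume z: "f z * indicator A z \<le> g z * indicator A z"
    show "z \<in> ?B \<longrightarrow> ennreal (F z) \<le> G z"
    proof
      assume zB: "z \<in> ?B"
      with z have "f z \<le> g z" by (cases "z \<in> A") (auto simp: A_def)
      then have le: "ennreal (F z + M) \<le> G z + ennreal M" using zB f_eq by (simp add: g_def)
      show "ennreal (F z) \<le> G z"
      proof (cases "0 \<le> F z")
        case True
        then have "ennreal M + ennreal (F z) \<le> ennreal M + G z" using le M(1) by (simp add: add.commute)
        then show ?thesis by (simp add: ennreal_add_left_cancel_le)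
      qed (simp add: ennreal_neg)
    qed
  qed
qed

text \<open>Countably many closed boxes exhaust \<open>W\<close>. The previous lemma covers only
  their interiors, but their faces are null sets.\<close>

lemma weak_le_imp_AE_le:
  fixes F :: "real^'n::finite \<Rightarrow> real" and G :: "real^'n \<Rightarrow> ennreal"
  assumes W: "open W" and F: "continuous_on W F" and G [measurable]: "G \<in> borel_measurable borel"
    and fin: "\<And>K. compact K \<Longrightarrow> K \<subseteq> W \<Longrightarrow> (\<integral>\<^sup>+z\<in>K. G z \<partial>lborel) < \<infinity>"
    and weak: "\<And>\<psi> K. smooth_alg \<psi> \<Longrightarrow> (\<And>z. 0 \<le> \<psi> z) \<Longrightarrow> (\<And>z. z \<notin> K \<Longrightarrow> \<psi> z = 0) \<Longrightarrow> compact K \<Longrightarrow> K \<subseteq> W \<Longrightarrow>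
        integrable lborel (\<lambda>z. \<psi> z * F z) \<and>
        ennreal (LINT z|lborel. \<psi> z * F z) \<le> (\<integral>\<^sup>+z. ennreal (\<psi> z) * G z \<partial>lborel)"
  shows "AE z in lborel. z \<in> W \<longrightarrow> ennreal (F z) \<le> G z"
proof -
  obtain D where D: "countable D" "D \<subseteq> Pow W" "\<And>X. X \<in> D \<Longrightarrow> \<exists>a b. X = cbox a b" "\<Union>D = W"
    using open_countable_Union_open_cbox[OF W] by metis
  have "AE z in lborel. z \<in> X \<longrightarrow> ennreal (F z) \<le> G z" if X: "X \<in> D" for X
  proof -
    obtain a b where ab: "X = cbox a b" using D(3)[OF X] by blast
    then have sub: "cbox a b \<subseteq> W" using D(2) X by auto
    have "AE z in lborel. z \<in> box a b \<longrightarrow> ennreal (F z) \<le> G z"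
      by (rule weak_le_imp_AE_le_box[OF continuous_on_subset[OF F sub] G fin[OF compact_cbox sub]])
        (rule weak[OF _ _ _ compact_cbox sub])
    moreover have "cbox a b - box a b \<in> null_sets lborel"
      using negligible_frontier_interval[of a b]
      by (simp add: negligible_iff_null_sets null_sets_completion_iff)
    then have "AE z in lborel. z \<notin> cbox a b - box a b" by (rule AE_not_in)
    ultimately show ?thesis by eventually_elim (auto simp: ab)
  qed
  then have "AE z in lborel. \<forall>X\<in>D. z \<in> X \<longrightarrow> ennreal (F z) \<le> G z"
    by (subst AE_ball_countable[OF D(1)]) blast
  then show ?thesis by eventually_elim (use D(4) in blast)
qed

section \<open>Almost every ray\<close>

text \<open>The complement is the projection of a closed set along the compact parameter interval,
  hence closed.\<close>

lemma open_segment_directions: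
  fixes x :: "'a::euclidean_space"
  assumes "open \<Omega>"
  shows "open {z. \<forall>\<tau>\<in>{s..t}. x + \<tau> *\<^sub>R z \<in> \<Omega>}"
proof -
  let ?T = "(\<lambda>p::real \<times> 'a. x + fst p *\<^sub>R snd p) -` (- \<Omega>)"
  have "closed ?T"
    using assms by (intro continuous_closed_vimage) (auto intro!: continuous_intros)
  then have "closed {z. \<exists>\<tau>. \<tau> \<in> {s..t} \<and> (\<tau>, z) \<in> ?T}"
    by (rule closed_compact_projection[OF compact_Icc])
  also have "{z. \<exists>\<tau>. \<tau> \<in> {s..t} \<and> (\<tau>, z) \<in> ?T} = - {z. \<forall>\<tau>\<in>{s..t}. x + \<tau> *\<^sub>R z \<in> \<Omega>}"
    by auto
  finally show ?thesis by (simp add: closed_def)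
qed

text \<open>Supplies the finiteness hypothesis of \<open>weak_le_imp_AE_le\<close>. For fixed \<tau>
  the substitution \<open>y = x + \<tau> z\<close> costs \<open>n\<close> factors
  \<open>1/\<tau>\<close>, each at most \<open>1/s\<close>, and the image stays in one compact
  subset of \<Omega>.\<close>

lemma nn_integral_rays_finite:
  fixes x :: "'a::euclidean_space" and m :: "'a \<Rightarrow> ennreal"
  assumes m [measurable]: "m \<in> borel_measurable borel" and K: "compact K" and st: "0 < s" "s \<le> t"
    and fin: "\<And>Q. compact Q \<Longrightarrow> Q \<subseteq> \<Omega> \<Longrightarrow> (\<integral>\<^sup>+y\<in>Q. m y \<partial>lborel) < \<infinity>"
    and seg: "\<And>\<tau> z. \<tau> \<in> {s..t} \<Longrightarrow> z \<in> K \<Longrightarrow> x + \<tau> *\<^sub>R z \<in> \<Omega>"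
  shows "(\<integral>\<^sup>+z\<in>K. ennreal ((norm z)\<^sup>2) * (\<integral>\<^sup>+\<tau>\<in>{s..t}. m (x + \<tau> *\<^sub>R z) \<partial>lborel) \<partial>lborel) < \<infinity>"
proof -
  define Q where "Q = (\<lambda>(\<tau>, z). x + \<tau> *\<^sub>R z) ` ({s..t} \<times> K)"
  have "compact Q"
    unfolding Q_def split_def
    by (intro compact_continuous_image compact_Times K) (auto intro!: continuous_intros)
  have Q: "Q \<subseteq> \<Omega>" using seg by (auto simp: Q_def)
  have [measurable]: "Q \<in> sets borel" "K \<in> sets borel"
    using K \<open>compact Q\<close> by (auto intro: borel_compact)
  define A where "A = (\<integral>\<^sup>+y\<in>Q. m y \<partial>lborel)"
  have A: "A < \<infinity>" unfolding A_def by (rule fin[OF \<open>compact Q\<close> Q])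
  obtain R where R: "0 < R" "\<And>z. z \<in> K \<Longrightarrow> norm z \<le> R"
    using compact_imp_bounded[OF K] unfolding bounded_pos by blast
  let ?c = "ennreal (inverse (s ^ DIM('a)))"
  have inner_le: "(\<integral>\<^sup>+z\<in>K. m (x + \<tau> *\<^sub>R z) \<partial>lborel) \<le> ?c * A" if \<tau>: "\<tau> \<in> {s..t}" for \<tau>
  proof -
    have \<tau>0: "0 < \<tau>" using \<tau> st by auto
    have "(\<integral>\<^sup>+z\<in>K. m (x + \<tau> *\<^sub>R z) \<partial>lborel) \<le> (\<integral>\<^sup>+z. m (x + \<tau> *\<^sub>R z) * indicator Q (x + \<tau> *\<^sub>R z) \<partial>lborel)"
      using \<tau> by (intro nn_integral_mono) (auto simp: Q_def indicator_def)
    also have "\<dots> = ?c * (ennreal (s ^ DIM('a)) * \<dots>)"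
      using st by (simp add: mult.assoc[symmetric] ennreal_mult'[symmetric])
    also have "\<dots> \<le> ?c * (ennreal (\<tau> ^ DIM('a)) * (\<integral>\<^sup>+z. m (x + \<tau> *\<^sub>R z) * indicator Q (x + \<tau> *\<^sub>R z) \<partial>lborel))"
      using \<tau> st by (intro mult_left_mono mult_right_mono ennreal_leI power_mono) auto
    also have "\<dots> = ?c * A"
      unfolding A_def by (subst nn_integral_lborel_affine[OF _ \<tau>0, of _ x]) auto
    finally show ?thesis .
  qed
  have "(\<integral>\<^sup>+z\<in>K. ennreal ((norm z)\<^sup>2) * (\<integral>\<^sup>+\<tau>\<in>{s..t}. m (x + \<tau> *\<^sub>R z) \<partial>lborel) \<partial>lborel) \<le>
     (\<integral>\<^sup>+z. ennreal (R\<^sup>2) * (\<integral>\<^sup>+\<tau>. m (x + \<tau> *\<^sub>R z) * indicator {s..t} \<tau> * indicator K z \<partial>lborel) \<partial>lborel)"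
  proof (rule nn_integral_mono)
    fix z
    show "ennreal ((norm z)\<^sup>2) * (\<integral>\<^sup>+\<tau>\<in>{s..t}. m (x + \<tau> *\<^sub>R z) \<partial>lborel) * indicator K z \<le>
      ennreal (R\<^sup>2) * (\<integral>\<^sup>+\<tau>. m (x + \<tau> *\<^sub>R z) * indicator {s..t} \<tau> * indicator K z \<partial>lborel)"
      using R by (cases "z \<in> K") (auto intro!: mult_right_mono ennreal_leI power_mono)
  qed
  also have "\<dots> = ennreal (R\<^sup>2) * (\<integral>\<^sup>+z. (\<integral>\<^sup>+\<tau>. m (x + \<tau> *\<^sub>R z) * indicator {s..t} \<tau> * indicator K z \<partial>lborel) \<partial>lborel)"
    by (rule nn_integral_cmult) measurable
  also have "(\<integral>\<^sup>+z. (\<integral>\<^sup>+\<tau>. m (x + \<tau> *\<^sub>R z) * indicator {s..t} \<tau> * indicator K z \<partial>lborel) \<partial>lborel)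
      = (\<integral>\<^sup>+\<tau>. (\<integral>\<^sup>+z. m (x + \<tau> *\<^sub>R z) * indicator {s..t} \<tau> * indicator K z \<partial>lborel) \<partial>lborel)"
    by (rule lborel_pair.Fubini') measurable
  also have "ennreal (R\<^sup>2) * \<dots> \<le> ennreal (R\<^sup>2) * (\<integral>\<^sup>+\<tau>. ?c * A * indicator {s..t} \<tau> \<partial>lborel)"
    by (intro mult_left_mono nn_integral_mono) (auto simp: indicator_def[of "{s..t}"] intro: inner_le)
  also have "\<dots> < \<infinity>"
    using A st by (auto simp: nn_integral_cmult ennreal_mult_less_top)
  finally show ?thesis .
qed

text \<open>Removes the test functions from \<open>weak_ray_bound\<close> on the open set of those
  \<open>z\<close> whose segment stays in \<Omega>. The exceptional null set still depends on
  \<open>s\<close> and \<open>t\<close>.\<close>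

lemma AE_ray_bound:
  fixes E :: "real^'n::finite \<Rightarrow> real^'n^'n" and u :: "real^'n \<Rightarrow> real^'n"
  assumes \<Omega>: "open \<Omega>" and st: "0 < s" "s \<le> t"
    and u: "continuous_on \<Omega> u" and E: "has_sym_grad \<Omega> u E"
    and m [measurable]: "m \<in> borel_measurable borel"
    and ae: "AE y in lebesgue. ennreal (norm (E y)) * indicator \<Omega> y = m y"
  shows "AE z in lborel. (\<forall>\<tau>\<in>{s..t}. x + \<tau> *\<^sub>R z \<in> \<Omega>) \<longrightarrow>
     ennreal (inner z (u (x + s *\<^sub>R z) - u (x + t *\<^sub>R z))) \<le>
     ennreal ((norm z)\<^sup>2) * (\<integral>\<^sup>+\<tau>\<in>{s..t}. m (x + \<tau> *\<^sub>R z) \<partial>lborel)"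
proof -
  let ?W = "{z. \<forall>\<tau>\<in>{s..t}. x + \<tau> *\<^sub>R z \<in> \<Omega>}"
  have fin: "(\<integral>\<^sup>+y\<in>Q. m y \<partial>lborel) < \<infinity>" if Q: "compact Q" "Q \<subseteq> \<Omega>" for Q
  proof -
    have "E absolutely_integrable_on Q"
      using E Q by (auto simp: has_sym_grad_def locally_integrable_on_def)
    then have int: "integrable lebesgue (\<lambda>y. indicat_real Q y *\<^sub>R E y)"
      by (simp add: set_integrable_def)
    have "(\<integral>\<^sup>+y\<in>Q. m y \<partial>lborel) = (\<integral>\<^sup>+y\<in>Q. m y \<partial>lebesgue)"
      by (rule nn_integral_completion[symmetric])
    also have "\<dots> = (\<integral>\<^sup>+y. ennreal (norm (indicat_real Q y *\<^sub>R E y)) \<partial>lebesgue)"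
      by (rule nn_integral_cong_AE, use ae in eventually_elim) (use Q(2) in \<open>auto simp: indicator_def subset_iff\<close>)
    also have "\<dots> < \<infinity>"
      using int by (simp add: integrable_iff_bounded)
    finally show ?thesis .
  qed
  have "AE z in lborel. z \<in> ?W \<longrightarrow> ennreal (inner z (u (x + s *\<^sub>R z) - u (x + t *\<^sub>R z))) \<le>
     ennreal ((norm z)\<^sup>2) * (\<integral>\<^sup>+\<tau>\<in>{s..t}. m (x + \<tau> *\<^sub>R z) \<partial>lborel)"
  proof (rule weak_le_imp_AE_le[OF open_segment_directions[OF \<Omega>]])
    show "continuous_on ?W (\<lambda>z. inner z (u (x + s *\<^sub>R z) - u (x + t *\<^sub>R z)))"
      by (intro continuous_on_inner continuous_on_id continuous_on_diff continuous_on_compose2[OF u]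
          continuous_on_add continuous_on_const continuous_on_scaleR) (use st in auto)
    show "(\<integral>\<^sup>+z\<in>K. ennreal ((norm z)\<^sup>2) * (\<integral>\<^sup>+\<tau>\<in>{s..t}. m (x + \<tau> *\<^sub>R z) \<partial>lborel) \<partial>lborel) < \<infinity>"
      if "compact K" "K \<subseteq> ?W" for K
      using that by (intro nn_integral_rays_finite[OF m _ st fin]) auto
    show "integrable lborel (\<lambda>z. \<psi> z * inner z (u (x + s *\<^sub>R z) - u (x + t *\<^sub>R z))) \<and>
      ennreal (LINT z|lborel. \<psi> z * inner z (u (x + s *\<^sub>R z) - u (x + t *\<^sub>R z))) \<le>
      (\<integral>\<^sup>+z. ennreal (\<psi> z) * (ennreal ((norm z)\<^sup>2) * (\<integral>\<^sup>+\<tau>\<in>{s..t}. m (x + \<tau> *\<^sub>R z) \<partial>lborel)) \<partial>lborel)"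
      if "smooth_alg \<psi>" "\<And>z. 0 \<le> \<psi> z" "\<And>z. z \<notin> K \<Longrightarrow> \<psi> z = 0" "compact K" "K \<subseteq> ?W" for \<psi> K
    proof -
      have "x + \<tau> *\<^sub>R z \<in> \<Omega>" if "\<tau> \<in> {s..t}" "z \<in> K" for \<tau> z
        using \<open>K \<subseteq> ?W\<close> that by blast
      from weak_ray_bound[OF that(1-4) st this u E m ae] show ?thesis by blast
    qed
  qed measurable
  then show ?thesis by simp
qed

definition good_ray :: "'a::euclidean_space set \<Rightarrow> ('a \<Rightarrow> 'a) \<Rightarrow> ('a \<Rightarrow> ennreal) \<Rightarrow> 'a \<Rightarrow> real \<Rightarrow> real \<Rightarrow> 'a \<Rightarrow> bool" where
  "good_ray \<Omega> u m x s t z \<longleftrightarrow> ((\<forall>\<tau>\<in>{s..t}. x + \<tau> *\<^sub>R z \<in> \<Omega>) \<longrightarrow>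
     ennreal (inner z (u (x + s *\<^sub>R z) - u (x + t *\<^sub>R z))) \<le>
     ennreal ((norm z)\<^sup>2) * (\<integral>\<^sup>+\<tau>\<in>{s..t}. m (x + \<tau> *\<^sub>R z) \<partial>lborel))"

definition good_directions :: "'a::euclidean_space set \<Rightarrow> ('a \<Rightarrow> 'a) \<Rightarrow> ('a \<Rightarrow> ennreal) \<Rightarrow> 'a \<Rightarrow> 'a set" where
  "good_directions \<Omega> u m x = {z. \<forall>s t. 0 < s \<longrightarrow> s < t \<longrightarrow> good_ray \<Omega> u m x s t z}"

text \<open>Reduction to countably many pairs \<open>(s, t)\<close>, for measurability and almost everywhere statements;
  invariance under scaling (below) needs all real pairs.\<close>

lemma good_directions_rational:
  fixes x :: "'a::euclidean_space"
  assumes u: "continuous_on \<Omega> u"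
  shows "good_directions \<Omega> u m x = (\<Inter>(s, t)\<in>{(s, t) \<in> \<rat> \<times> \<rat>. 0 < s \<and> s < t}. {z. good_ray \<Omega> u m x s t z})"
    (is "?L = ?R")
proof
  show "?L \<subseteq> ?R" by (auto simp: good_directions_def)
  show "?R \<subseteq> ?L"
    unfolding good_directions_def
  proof (intro subsetI CollectI allI impI)
    fix z and s t :: real assume z: "z \<in> ?R" and st: "0 < s" "s < t"
    show "good_ray \<Omega> u m x s t z"
      unfolding good_ray_def
    proof
      assume seg: "\<forall>\<tau>\<in>{s..t}. x + \<tau> *\<^sub>R z \<in> \<Omega>"
      define \<phi> where "\<phi> \<tau> = inner z (u (x + \<tau> *\<^sub>R z))" for \<tau>
      let ?J = "ennreal ((norm z)\<^sup>2) * (\<integral>\<^sup>+\<tau>\<in>{s..t}. m (x + \<tau> *\<^sub>R z) \<partial>lborel)"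
      have cont: "continuous_on {s..t} \<phi>"
        unfolding \<phi>_def using seg
        by (intro continuous_on_inner continuous_on_const continuous_on_compose2[OF u]
            continuous_on_add continuous_on_id continuous_on_scaleR) auto
      \<comment> \<open>The rational endpoints are chosen inside \<open>{s..t}\<close>, so that
        \<Omega> still contains the segment and the right-hand side can only shrink. The factor one
        half keeps \<open>a k < b k\<close>.\<close>
      define d where "d k = (t - s) / 2 * inverse (real (Suc k))" for k
      have d: "0 < d k" "d k \<le> (t - s) / 2" for k
        using st mult_left_le[of "inverse (real (Suc k))" "(t - s) / 2"] by (auto simp: d_def inverse_le_1_iff)
      have "d \<longlonglongrightarrow> 0"
        unfolding d_def by (rule tendsto_mult_right_zero[OF LIMSEQ_inverse_real_of_nat])
      have "\<exists>q\<in>\<rat>. s < q \<and> q < s + d k" "\<exists>q\<in>\<rat>. t - d k < q \<and> q < t" for k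
        using Rats_dense_in_real[of s "s + d k"] Rats_dense_in_real[of "t - d k" t] d(1)[of k] by auto
      then obtain a b where a: "\<And>k. a k \<in> \<rat>" "\<And>k. s < a k" "\<And>k. a k < s + d k"
        and b: "\<And>k. b k \<in> \<rat>" "\<And>k. t - d k < b k" "\<And>k. b k < t" by metis
      have ab: "a k < b k" for k using a(3)[of k] b(2)[of k] d(2)[of k] by argo
      have "a \<longlonglongrightarrow> s"
        by (rule tendsto_sandwich[OF _ _ tendsto_const, where h="\<lambda>k. s + d k"])
          (use a \<open>d \<longlonglongrightarrow> 0\<close> in \<open>auto intro!: always_eventually less_imp_le tendsto_eq_intros\<close>)
      moreover have "b \<longlonglongrightarrow> t"
        by (rule tendsto_sandwich[OF _ _ _ tendsto_const, where f="\<lambda>k. t - d k"])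
          (use b \<open>d \<longlonglongrightarrow> 0\<close> in \<open>auto intro!: always_eventually less_imp_le tendsto_eq_intros\<close>)
      moreover have abst: "a k \<in> {s..t}" "b k \<in> {s..t}" for k
        using a(2)[of k] b(3)[of k] ab[of k] by auto
      ultimately have "(\<lambda>k. \<phi> (a k)) \<longlonglongrightarrow> \<phi> s" "(\<lambda>k. \<phi> (b k)) \<longlonglongrightarrow> \<phi> t"
        using st by (auto intro!: continuous_on_tendsto_compose[OF cont] always_eventually)
      then have "(\<lambda>k. ennreal (\<phi> (a k) - \<phi> (b k))) \<longlonglongrightarrow> ennreal (\<phi> s - \<phi> t)"
        by (intro tendsto_ennrealI tendsto_diff)
      moreover have "ennreal (\<phi> (a k) - \<phi> (b k)) \<le> ?J" for k
      proof -
        have "good_ray \<Omega> u m x (a k) (b k) z" using z a(1,2)[of k] b(1)[of k] ab[of k] st by auto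
        moreover have sub: "{a k..b k} \<subseteq> {s..t}" using abst[of k] by auto
        ultimately have "ennreal (\<phi> (a k) - \<phi> (b k)) \<le>
           ennreal ((norm z)\<^sup>2) * (\<integral>\<^sup>+\<tau>\<in>{a k..b k}. m (x + \<tau> *\<^sub>R z) \<partial>lborel)"
          using seg unfolding good_ray_def by (auto simp: \<phi>_def inner_diff_right)
        also have "\<dots> \<le> ?J"
          using sub by (intro mult_left_mono nn_integral_mono) (auto simp: indicator_def)
        finally show ?thesis .
      qed
      ultimately have "ennreal (\<phi> s - \<phi> t) \<le> ?J"
        by (intro LIMSEQ_le_const2) auto
      then show "ennreal (inner z (u (x + s *\<^sub>R z) - u (x + t *\<^sub>R z))) \<le> ?J"
        by (simp add: \<phi>_def inner_diff_right)
    qed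
  qed
qed

text \<open>The good unit vectors are later integrated over with respect to the Hausdorff measure on
  Borel sets, so full Lebesgue measure alone would not be enough.\<close>

lemma good_directions_borel:
  fixes x :: "'a::euclidean_space"
  assumes \<Omega>: "open \<Omega>" and u: "continuous_on \<Omega> u" and m [measurable]: "m \<in> borel_measurable borel"
  shows "good_directions \<Omega> u m x \<in> sets borel"
  unfolding good_directions_rational[OF u]
proof (rule sets.countable_INT'')
  show "countable {(s, t) \<in> \<rat> \<times> \<rat>. 0 < s \<and> s < (t::real)}"
    by (rule countable_subset[of _ "\<rat> \<times> \<rat>"]) (auto intro: countable_SIGMA countable_rat)
  show "(case p of (s, t) \<Rightarrow> {z. good_ray \<Omega> u m x s t z}) \<in> sets borel"
    if p: "p \<in> {(s, t) \<in> \<rat> \<times> \<rat>. 0 < s \<and> s < t}" for p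
  proof -
    obtain s t where st: "p = (s, t)" "0 < s" "s < t" using p by auto
    let ?W = "{z. \<forall>\<tau>\<in>{s..t}. x + \<tau> *\<^sub>R z \<in> \<Omega>}"
    \<comment> \<open>Since \<open>u\<close> is controlled only on \<Omega>, it is cut off by
      \<open>?W\<close> to obtain a Borel function; outside \<open>?W\<close> the condition is
      vacuous.\<close>
    let ?F = "\<lambda>z. indicator ?W z *\<^sub>R inner z (u (x + s *\<^sub>R z) - u (x + t *\<^sub>R z))"
    have [measurable]: "?W \<in> sets borel"
      using open_segment_directions[OF \<Omega>] by simp
    have "continuous_on ?W (\<lambda>z. inner z (u (x + s *\<^sub>R z) - u (x + t *\<^sub>R z)))"
      by (intro continuous_on_inner continuous_on_id continuous_on_diff continuous_on_compose2[OF u]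
          continuous_on_add continuous_on_const continuous_on_scaleR) (use st in auto)
    then have [measurable]: "?F \<in> borel_measurable borel"
      by (rule borel_measurable_continuous_on_indicator[rotated]) measurable
    have "{z. good_ray \<Omega> u m x s t z} = - ?W \<union>
       {z. ennreal (?F z) \<le> ennreal ((norm z)\<^sup>2) * (\<integral>\<^sup>+\<tau>\<in>{s..t}. m (x + \<tau> *\<^sub>R z) \<partial>lborel)}"
      by (auto simp: good_ray_def indicator_def)
    also have "\<dots> \<in> sets borel"
      by measurable
    finally show ?thesis by (simp add: st)
  qed
qed simp

lemma AE_good_directions:
  fixes E :: "real^'n::finite \<Rightarrow> real^'n^'n" and u :: "real^'n \<Rightarrow> real^'n"
  assumes "open \<Omega>" "continuous_on \<Omega> u" "has_sym_grad \<Omega> u E" "m \<in> borel_measurable borel"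
    and "AE y in lebesgue. ennreal (norm (E y)) * indicator \<Omega> y = m y"
  shows "AE z in lborel. z \<in> good_directions \<Omega> u m x"
proof -
  let ?I = "{(s, t) \<in> \<rat> \<times> \<rat>. 0 < s \<and> s < (t::real)}"
  have "countable ?I"
    by (rule countable_subset[of _ "\<rat> \<times> \<rat>"]) (auto intro: countable_SIGMA countable_rat)
  moreover have "AE z in lborel. good_ray \<Omega> u m x (fst p) (snd p) z" if "p \<in> ?I" for p
    using AE_ray_bound[OF assms(1) _ _ assms(2-5), of "fst p" "snd p" x] that
    unfolding good_ray_def by auto
  ultimately have "AE z in lborel. \<forall>p\<in>?I. good_ray \<Omega> u m x (fst p) (snd p) z"
    by (subst AE_ball_countable) auto
  then show ?thesis
    unfolding good_directions_rational[OF assms(2)] by eventually_elim auto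
qed

text \<open>The ray through \<open>c z\<close> with parameters \<open>(s, t)\<close> is the ray
  through \<open>z\<close> with parameters \<open>(c s, c t)\<close>. This is what allows passing
  from almost every point of a solid ball to its unit direction.\<close>

lemma good_directions_scaleR:
  fixes x :: "'a::euclidean_space"
  assumes [measurable]: "m \<in> borel_measurable borel" and z: "z \<in> good_directions \<Omega> u m x" and c: "0 < c"
  shows "c *\<^sub>R z \<in> good_directions \<Omega> u m x"
  unfolding good_directions_def
proof (intro CollectI allI impI)
  fix s t :: real assume st: "0 < s" "s < t"
  show "good_ray \<Omega> u m x s t (c *\<^sub>R z)"
    unfolding good_ray_def
  proof
    assume seg: "\<forall>\<tau>\<in>{s..t}. x + \<tau> *\<^sub>R c *\<^sub>R z \<in> \<Omega>"
    have "\<forall>\<sigma>\<in>{c * s..c * t}. x + \<sigma> *\<^sub>R z \<in> \<Omega>"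
    proof
      fix \<sigma> assume "\<sigma> \<in> {c * s..c * t}"
      then have "\<sigma> / c \<in> {s..t}" using c by (auto simp: field_simps)
      with seg have "x + (\<sigma> / c) *\<^sub>R c *\<^sub>R z \<in> \<Omega>" by blast
      with c show "x + \<sigma> *\<^sub>R z \<in> \<Omega>" by simp
    qed
    moreover have "good_ray \<Omega> u m x (c * s) (c * t) z"
      using z st c by (simp add: good_directions_def)
    ultimately have le: "ennreal (inner z (u (x + (c * s) *\<^sub>R z) - u (x + (c * t) *\<^sub>R z))) \<le>
       ennreal ((norm z)\<^sup>2) * (\<integral>\<^sup>+\<sigma>\<in>{c * s..c * t}. m (x + \<sigma> *\<^sub>R z) \<partial>lborel)"
      unfolding good_ray_def by blast
    have "(\<integral>\<^sup>+\<sigma>\<in>{c * s..c * t}. m (x + \<sigma> *\<^sub>R z) \<partial>lborel) =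
        ennreal c * (\<integral>\<^sup>+\<tau>. m (x + (0 + c *\<^sub>R \<tau>) *\<^sub>R z) * indicator {c * s..c * t} (0 + c *\<^sub>R \<tau>) \<partial>lborel)"
      by (subst nn_integral_lborel_affine[OF _ c, of _ 0]) auto
    also have "(\<lambda>\<tau>. m (x + (0 + c *\<^sub>R \<tau>) *\<^sub>R z) * indicator {c * s..c * t} (0 + c *\<^sub>R \<tau>)) =
        (\<lambda>\<tau>. m (x + \<tau> *\<^sub>R c *\<^sub>R z) * indicator {s..t} \<tau>)"
      using c by (auto simp: fun_eq_iff indicator_def mult.commute)
    finally have eq: "(\<integral>\<^sup>+\<sigma>\<in>{c * s..c * t}. m (x + \<sigma> *\<^sub>R z) \<partial>lborel) =
        ennreal c * (\<integral>\<^sup>+\<tau>\<in>{s..t}. m (x + \<tau> *\<^sub>R c *\<^sub>R z) \<partial>lborel)" .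
    have "ennreal (inner (c *\<^sub>R z) (u (x + s *\<^sub>R c *\<^sub>R z) - u (x + t *\<^sub>R c *\<^sub>R z))) =
       ennreal c * ennreal (inner z (u (x + (c * s) *\<^sub>R z) - u (x + (c * t) *\<^sub>R z)))"
      using c by (simp add: ennreal_mult'[symmetric] mult.commute)
    also have "\<dots> \<le> ennreal c * (ennreal ((norm z)\<^sup>2) * (ennreal c * (\<integral>\<^sup>+\<tau>\<in>{s..t}. m (x + \<tau> *\<^sub>R c *\<^sub>R z) \<partial>lborel)))"
      using le unfolding eq by (intro mult_left_mono) auto
    also have "\<dots> = (ennreal c * ennreal ((norm z)\<^sup>2) * ennreal c) * (\<integral>\<^sup>+\<tau>\<in>{s..t}. m (x + \<tau> *\<^sub>R c *\<^sub>R z) \<partial>lborel)"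
      by (simp only: mult.assoc)
    also have "ennreal c * ennreal ((norm z)\<^sup>2) * ennreal c = ennreal ((norm (c *\<^sub>R z))\<^sup>2)"
      using c by (simp add: ennreal_mult'[symmetric] power2_eq_square ac_simps)
    finally show "ennreal (inner (c *\<^sub>R z) (u (x + s *\<^sub>R c *\<^sub>R z) - u (x + t *\<^sub>R c *\<^sub>R z))) \<le>
       ennreal ((norm (c *\<^sub>R z))\<^sup>2) * (\<integral>\<^sup>+\<tau>\<in>{s..t}. m (x + \<tau> *\<^sub>R c *\<^sub>R z) \<partial>lborel)" .
  qed
qed

section \<open>Boundary values and ray integrals\<close>

definition ray_integral :: "('a::euclidean_space \<Rightarrow> ennreal) \<Rightarrow> 'a \<Rightarrow> 'a \<Rightarrow> ennreal" where
  "ray_integral m x \<theta> = (\<integral>\<^sup>+\<tau>\<in>{0<..}. m (x + \<tau> *\<^sub>R \<theta>) \<partial>lborel)"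

lemma borel_measurable_ray_integral [measurable]:
  fixes m :: "'a::euclidean_space \<Rightarrow> ennreal"
  assumes [measurable]: "m \<in> borel_measurable borel"
  shows "ray_integral m x \<in> borel_measurable borel"
  unfolding ray_integral_def[abs_def] by measurable

text \<open>Resolves the definite description in \<open>zeta\<close> with \<open>r\<close> the least
  parameter on the frontier. Before \<open>r\<close>, a connected segment from \<open>x\<close> that
  misses the frontier cannot leave \<Omega>; beyond \<open>r\<close>, no frontier point is visible
  because the point at \<open>r\<close> obstructs it and is not in the open set \<Omega>.\<close>

lemma first_frontier_point:
  fixes x \<theta> :: "'a::real_normed_vector"
  assumes \<Omega>: "open \<Omega>" and x: "x \<in> \<Omega>" and hit: "\<exists>t>0. x + t *\<^sub>R \<theta> \<in> frontier \<Omega>"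
  obtains r where "0 < r" "x + r *\<^sub>R \<theta> \<in> frontier \<Omega>" "\<And>t. 0 \<le> t \<Longrightarrow> t < r \<Longrightarrow> x + t *\<^sub>R \<theta> \<in> \<Omega>"
    "zeta \<Omega> x \<theta> = x + r *\<^sub>R \<theta>"
proof -
  define T where "T = {0..} \<inter> (\<lambda>t. x + t *\<^sub>R \<theta>) -` frontier \<Omega>"
  have disj: "y \<notin> \<Omega>" if "y \<in> frontier \<Omega>" for y
    using that \<Omega> by (simp add: frontier_def interior_open)
  have "closed T"
    unfolding T_def by (intro closed_Int closed_real_atLeast continuous_closed_vimage) (auto intro!: continuous_intros)
  moreover have "T \<noteq> {}" "bdd_below T" using hit by (auto simp: T_def intro: less_imp_le)
  ultimately have T: "Inf T \<in> T" by (rule closed_contains_Inf[rotated 2])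
  define r where "r = Inf T"
  have fr: "x + r *\<^sub>R \<theta> \<in> frontier \<Omega>" and r0: "0 \<le> r" using T by (auto simp: T_def r_def)
  have "r \<noteq> 0" using disj[OF fr] x by auto
  with r0 have r: "0 < r" by simp
  have below: "x + t *\<^sub>R \<theta> \<notin> frontier \<Omega>" if "0 \<le> t" "t < r" for t
  proof
    assume "x + t *\<^sub>R \<theta> \<in> frontier \<Omega>"
    then have "t \<in> T" using that by (simp add: T_def)
    then have "r \<le> t" unfolding r_def using \<open>bdd_below T\<close> by (rule cInf_lower)
    with that show False by simp
  qed
  have inside: "x + t *\<^sub>R \<theta> \<in> \<Omega>" if t: "0 \<le> t" "t < r" for t
  proof (rule ccontr)
    assume no: "x + t *\<^sub>R \<theta> \<notin> \<Omega>"
    have "connected ((\<lambda>t. x + t *\<^sub>R \<theta>) ` {0..t})"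
      by (intro connected_continuous_image) (auto intro!: continuous_intros)
    moreover have "x \<in> (\<lambda>t. x + t *\<^sub>R \<theta>) ` {0..t}" using t by (auto intro!: image_eqI[of _ _ 0])
    moreover have "x + t *\<^sub>R \<theta> \<in> (\<lambda>t. x + t *\<^sub>R \<theta>) ` {0..t}" using t by auto
    ultimately have "(\<lambda>t. x + t *\<^sub>R \<theta>) ` {0..t} \<inter> frontier \<Omega> \<noteq> {}"
      using x no by (intro connected_Int_frontier) blast+
    then show False using below t by auto
  qed
  have combine: "(1 - t) *\<^sub>R x + t *\<^sub>R (x + s *\<^sub>R \<theta>) = x + (t * s) *\<^sub>R \<theta>" for s t :: real
    by (simp add: algebra_simps)
  have "(THE t. 0 < t \<and> x + t *\<^sub>R \<theta> \<in> visible_frontier \<Omega> x) = r"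
  proof (rule the_equality, intro conjI r)
    have "x + (t * r) *\<^sub>R \<theta> \<in> \<Omega>" if "t \<in> {0<..<1}" for t
      using inside[of "t * r"] that r by simp
    then show "x + r *\<^sub>R \<theta> \<in> visible_frontier \<Omega> x"
      using fr by (simp add: visible_frontier_def combine)
  next
    fix t assume t: "0 < t \<and> x + t *\<^sub>R \<theta> \<in> visible_frontier \<Omega> x"
    then have "x + t *\<^sub>R \<theta> \<in> frontier \<Omega>" by (simp add: visible_frontier_def)
    then have "r \<le> t" using below[of t] t by force
    moreover have "\<not> r < t"
    proof
      assume "r < t"
      then have "r / t \<in> {0<..<1}" using r by simp
      then have "x + (r / t * t) *\<^sub>R \<theta> \<in> \<Omega>"
        using t unfolding visible_frontier_def mem_Collect_eq combine by blast
      then show False using disj[OF fr] t by simp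
    qed
    ultimately show "t = r" by simp
  qed
  then have "zeta \<Omega> x \<theta> = x + r *\<^sub>R \<theta>" by (simp add: zeta_def)
  with r fr inside that show ?thesis by blast
qed

lemma ray_avoiding_frontier:
  fixes x \<theta> :: "'a::real_normed_vector"
  assumes \<Omega>: "open \<Omega>" and x: "x \<in> \<Omega>" and miss: "\<not> (\<exists>t>0. x + t *\<^sub>R \<theta> \<in> frontier \<Omega>)" and t: "0 \<le> t"
  shows "x + t *\<^sub>R \<theta> \<in> \<Omega>"
proof (rule ccontr)
  assume no: "x + t *\<^sub>R \<theta> \<notin> \<Omega>"
  have "connected ((\<lambda>t. x + t *\<^sub>R \<theta>) ` {0..t})"
    by (intro connected_continuous_image) (auto intro!: continuous_intros)
  moreover have "x \<in> (\<lambda>t. x + t *\<^sub>R \<theta>) ` {0..t}" using t by (auto intro!: image_eqI[of _ _ 0])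
  moreover have "x + t *\<^sub>R \<theta> \<in> (\<lambda>t. x + t *\<^sub>R \<theta>) ` {0..t}" using t by auto
  ultimately have "(\<lambda>t. x + t *\<^sub>R \<theta>) ` {0..t} \<inter> frontier \<Omega> \<noteq> {}"
    using x no by (intro connected_Int_frontier) blast+
  then obtain s where s: "0 \<le> s" "x + s *\<^sub>R \<theta> \<in> frontier \<Omega>" by auto
  then have "s \<noteq> 0" using x \<Omega> by (auto simp: frontier_def interior_open)
  with s miss show False by (metis order_le_less)
qed

text \<open>Let \<open>t\<close> tend to the first frontier point, using continuity on the closure,
  or choose \<open>t\<close> beyond the bounded support of \<open>u\<close> if the ray misses the
  frontier, which accounts for the value 0 there. Then let \<open>s\<close> tend to 0. An infinite
  ray integral makes the claim trivial.\<close>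

lemma good_direction_bound:
  fixes u :: "'a::euclidean_space \<Rightarrow> 'a"
  assumes \<Omega>: "open \<Omega>" and x: "x \<in> \<Omega>" and u: "u \<in> Cb (closure \<Omega>)"
    and \<theta>: "\<theta> \<in> good_directions \<Omega> u m x" "norm \<theta> = 1"
  shows "ennreal (inner \<theta> (u x)) \<le> ennreal (norm (at_zeta u \<Omega> x \<theta>)) + ray_integral m x \<theta>"
proof (cases "ray_integral m x \<theta>")
  case (real j)
  let ?p = "\<lambda>t. x + t *\<^sub>R \<theta>"
  have cu: "continuous_on (closure \<Omega>) u" and bu: "bounded {y \<in> closure \<Omega>. u y \<noteq> 0}"
    using u by (auto simp: Cb_def)
  have sub: "y \<in> \<Omega> \<Longrightarrow> y \<in> closure \<Omega>" for y using closure_subset by blast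
  have step: "inner \<theta> (u (?p s)) \<le> norm (u (?p t)) + j"
    if st: "0 < s" "s < t" and seg: "\<And>\<tau>. \<tau> \<in> {s..t} \<Longrightarrow> ?p \<tau> \<in> \<Omega>" for s t
  proof -
    have "ennreal (inner \<theta> (u (?p s) - u (?p t))) \<le> (\<integral>\<^sup>+\<tau>\<in>{s..t}. m (?p \<tau>) \<partial>lborel)"
      using \<theta> st seg by (auto simp: good_directions_def good_ray_def)
    also have "\<dots> \<le> ennreal j"
      unfolding real(2)[symmetric] ray_integral_def using st
      by (intro nn_integral_mono) (auto simp: indicator_def)
    finally have "inner \<theta> (u (?p s)) - inner \<theta> (u (?p t)) \<le> j"
      using real(1) by (simp add: inner_diff_right)
    moreover have "inner \<theta> (u (?p t)) \<le> norm (u (?p t))"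
      using norm_cauchy_schwarz[of \<theta> "u (?p t)"] \<theta>(2) by simp
    ultimately show ?thesis by linarith
  qed
  \<comment> \<open>Common outcome of the two cases: \<open>r\<close> is either the first frontier
    parameter or a parameter beyond the support of \<open>u\<close>.\<close>
  obtain r where r: "0 < r" and near: "\<And>s. 0 < s \<Longrightarrow> s < r \<Longrightarrow> inner \<theta> (u (?p s)) \<le> norm (at_zeta u \<Omega> x \<theta>) + j"
    and in\<Omega>: "\<And>s. 0 \<le> s \<Longrightarrow> s < r \<Longrightarrow> ?p s \<in> \<Omega>"
  proof (cases "\<exists>t>0. ?p t \<in> frontier \<Omega>")
    case True
    then obtain r where r: "0 < r" "?p r \<in> frontier \<Omega>" "\<And>t. 0 \<le> t \<Longrightarrow> t < r \<Longrightarrow> ?p t \<in> \<Omega>"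
      "zeta \<Omega> x \<theta> = ?p r"
      using first_frontier_point[OF \<Omega> x] by metis
    have "inner \<theta> (u (?p s)) \<le> norm (at_zeta u \<Omega> x \<theta>) + j" if s: "0 < s" "s < r" for s
    proof -
      have "?p ` {s..r} \<subseteq> closure \<Omega>"
      proof
        fix y assume "y \<in> ?p ` {s..r}"
        then obtain t where t: "s \<le> t" "t \<le> r" "y = ?p t" by auto
        show "y \<in> closure \<Omega>"
          using r(2) r(3)[of t] t s sub by (cases "t = r") (auto simp: frontier_def)
      qed
      then have "continuous_on {s..r} (\<lambda>t. u (?p t))"
        by (intro continuous_on_compose2[OF cu]) (auto intro!: continuous_intros)
      then have "continuous_on {s..r} (\<lambda>t. norm (u (?p t)) + j)"
        by (intro continuous_on_add continuous_on_const continuous_on_norm)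
      then have "((\<lambda>t. norm (u (?p t)) + j) \<longlongrightarrow> norm (u (?p r)) + j) (at r within {s..r})"
        using s by (simp add: continuous_on_def)
      then have "((\<lambda>t. norm (u (?p t)) + j) \<longlongrightarrow> norm (u (?p r)) + j) (at_left r)"
        using s by (simp add: at_within_Icc_at_left)
      moreover have "eventually (\<lambda>t. inner \<theta> (u (?p s)) \<le> norm (u (?p t)) + j) (at_left r)"
        unfolding eventually_at_left_field using s r(3) by (intro exI[of _ s]) (auto intro!: step)
      ultimately have "inner \<theta> (u (?p s)) \<le> norm (u (?p r)) + j"
        by (rule tendsto_lowerbound) simp
      then show ?thesis using True r(4) by (simp add: at_zeta_def)
    qed
    with r that show ?thesis by blast
  next
    case False
    note in\<Omega> = ray_avoiding_frontier[OF \<Omega> x False]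
    obtain R where R: "\<And>y. y \<in> closure \<Omega> \<Longrightarrow> u y \<noteq> 0 \<Longrightarrow> norm y \<le> R" "0 < R"
      using bu unfolding bounded_pos by auto
    \<comment> \<open>With a unit direction, the point at parameter \<open>t\<close> has norm at
      least \<open>t - norm x = R + 1\<close>, so \<open>u\<close> vanishes there.\<close>
    define t where "t = R + norm x + 1"
    have "0 < t" using R(2) by (simp add: t_def add_pos_nonneg)
    have "norm (?p t) > R"
      using norm_triangle_ineq2[of "t *\<^sub>R \<theta>" "- x"] \<theta>(2) \<open>0 < t\<close> by (simp add: t_def add.commute)
    moreover have "?p t \<in> closure \<Omega>" using in\<Omega>[of t] \<open>0 < t\<close> sub by simp
    ultimately have "u (?p t) = 0" using R(1) by force
    then have "inner \<theta> (u (?p s)) \<le> norm (at_zeta u \<Omega> x \<theta>) + j" if "0 < s" "s < t" for s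
      using step[OF that] in\<Omega> that by (auto intro: order_trans)
    with \<open>0 < t\<close> in\<Omega> that show ?thesis by blast
  qed
  have "continuous_on {0..r/2} (\<lambda>s. inner \<theta> (u (?p s)))"
    using in\<Omega> r sub
    by (intro continuous_on_inner continuous_on_const continuous_on_compose2[OF cu]
        continuous_on_add continuous_on_id continuous_on_scaleR) auto
  then have "((\<lambda>s. inner \<theta> (u (?p s))) \<longlongrightarrow> inner \<theta> (u (?p 0))) (at 0 within {0..r/2})"
    by (rule bspec[OF iffD1[OF continuous_on_def]]) (use r in auto)
  then have "((\<lambda>s. inner \<theta> (u (?p s))) \<longlongrightarrow> inner \<theta> (u x)) (at_right 0)"
    using r by (simp add: at_within_Icc_at_right)
  moreover have "eventually (\<lambda>s. inner \<theta> (u (?p s)) \<le> norm (at_zeta u \<Omega> x \<theta>) + j) (at_right 0)"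
    unfolding eventually_at_right_field using r near by (intro exI[of _ r]) auto
  ultimately have "inner \<theta> (u x) \<le> norm (at_zeta u \<Omega> x \<theta>) + j"
    by (rule tendsto_upperbound) simp
  then show ?thesis
    unfolding real(2) using real(1) by (simp add: ennreal_plus[symmetric] ennreal_leI del: ennreal_plus)
qed simp

section \<open>From averaged ray integrals to the Riesz potential\<close>

lemma ray_integral_scaleR:
  fixes z :: "'a::euclidean_space"
  assumes [measurable]: "m \<in> borel_measurable borel" and c: "0 < c"
  shows "ray_integral m x z = ennreal c * ray_integral m x (c *\<^sub>R z)"
proof -
  have "ray_integral m x z =
      ennreal c * (\<integral>\<^sup>+\<tau>. m (x + (0 + c *\<^sub>R \<tau>) *\<^sub>R z) * indicator {0<..} (0 + c *\<^sub>R \<tau>) \<partial>lborel)"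
    unfolding ray_integral_def by (subst nn_integral_lborel_affine[OF _ c, of _ 0]) auto
  also have "(\<lambda>\<tau>. m (x + (0 + c *\<^sub>R \<tau>) *\<^sub>R z) * indicator {0<..} (0 + c *\<^sub>R \<tau>)) =
      (\<lambda>\<tau>. m (x + \<tau> *\<^sub>R c *\<^sub>R z) * indicator {0<..} \<tau>)"
    using c by (auto simp: fun_eq_iff indicator_def mult.commute zero_less_mult_iff)
  finally show ?thesis by (simp add: ray_integral_def)
qed

lemma nn_integral_inverse_power:
  assumes "0 < r" "0 < k"
  shows "(\<integral>\<^sup>+\<tau>. ennreal (inverse \<tau> ^ (k + 1)) * indicator {r..} \<tau> \<partial>lborel) = ennreal (inverse r ^ k / real k)"
proof -
  let ?F = "\<lambda>\<tau>::real. - (inverse \<tau> ^ k / real k)"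
  have "(\<integral>\<^sup>+\<tau>. ennreal (inverse \<tau> ^ (k + 1)) * indicator {r..} \<tau> \<partial>lborel) = ennreal (0 - ?F r)"
  proof (rule nn_integral_FTC_atLeast)
    show "DERIV ?F \<tau> :> inverse \<tau> ^ (k + 1)" if "r \<le> \<tau>" for \<tau>
    proof -
      have "\<tau> \<noteq> 0" using that assms by auto
      obtain l where k: "k = Suc l" using assms(2) gr0_implies_Suc by blast
      show ?thesis
        by (rule DERIV_cong[OF DERIV_minus[OF DERIV_cdivide[OF DERIV_power[OF DERIV_inverse[OF \<open>\<tau> \<noteq> 0\<close>, of UNIV]]]]])
          (simp add: k power2_eq_square del: of_nat_Suc)
    qed
    have "(inverse \<longlongrightarrow> (0::real)) at_top" by (rule tendsto_inverse_0_at_top) (rule filterlim_ident)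
    from tendsto_minus[OF tendsto_divide[OF tendsto_power[OF this, of k] tendsto_const[of "real k"]]] assms(2)
    show "(?F \<longlongrightarrow> 0) at_top" by (simp add: power_0_left)
  qed (use assms in auto)
  then show ?thesis by simp
qed

text \<open>Scaling gives \<open>ray_integral m x (sgn z) = norm z * ray_integral m x z\<close> for
  \<open>z \<noteq> 0\<close>. After Fubini and \<open>y = x + \<tau> z\<close>, with
  \<open>r = norm (y - x)\<close>, the condition \<open>norm z < 1\<close> becomes
  \<open>r < \<tau>\<close>, and the \<tau>-integral of \<open>r * inverse \<tau> ^ (n + 1)\<close>
  from \<open>r\<close> on is \<open>1 / (n * r ^ (n - 1))\<close>. The factor \<open>1/n\<close> is
  dropped.\<close>

lemma nn_integral_ray_integral_ball:
  fixes x :: "'a::euclidean_space"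
  assumes m [measurable]: "m \<in> borel_measurable borel"
  shows "(\<integral>\<^sup>+z\<in>ball 0 1. ray_integral m x (sgn z) \<partial>lborel) \<le>
     (\<integral>\<^sup>+y. m y * ennreal (1 / norm (x - y) ^ (DIM('a) - 1)) \<partial>lborel)"
proof -
  let ?N = "DIM('a)"
  have [measurable]: "ball (0::'a) 1 \<in> sets borel" by simp
  have "AE z in lborel. z \<noteq> (0::'a)" by (rule AE_lborel_singleton)
  then have "(\<integral>\<^sup>+z\<in>ball 0 1. ray_integral m x (sgn z) \<partial>lborel) =
     (\<integral>\<^sup>+z. ennreal (norm z) * ray_integral m x z * indicator (ball 0 1) z \<partial>lborel)"
  proof (intro nn_integral_cong_AE, eventually_elim)
    fix z :: 'a assume "z \<noteq> 0"
    then have "ray_integral m x (sgn z) = ennreal (norm z) * ray_integral m x (norm z *\<^sub>R sgn z)"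
      by (intro ray_integral_scaleR m) simp
    also have "norm z *\<^sub>R sgn z = z" using \<open>z \<noteq> 0\<close> by (simp add: sgn_div_norm)
    finally show "ray_integral m x (sgn z) * indicator (ball 0 1) z =
      ennreal (norm z) * ray_integral m x z * indicator (ball 0 1) z" by simp
  qed
  also have "\<dots> = (\<integral>\<^sup>+z. (\<integral>\<^sup>+\<tau>. ennreal (norm z) * (m (x + \<tau> *\<^sub>R z) * indicator {0<..} \<tau>) * indicator (ball 0 1) z \<partial>lborel) \<partial>lborel)"
    unfolding ray_integral_def by (simp add: nn_integral_cmult nn_integral_multc)
  also have "\<dots> = (\<integral>\<^sup>+\<tau>. (\<integral>\<^sup>+z. ennreal (norm z) * (m (x + \<tau> *\<^sub>R z) * indicator {0<..} \<tau>) * indicator (ball 0 1) z \<partial>lborel) \<partial>lborel)"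
    by (rule lborel_pair.Fubini') measurable
  also have "\<dots> = (\<integral>\<^sup>+\<tau>. (\<integral>\<^sup>+y. ennreal (inverse \<tau> ^ (?N + 1)) * (ennreal (norm (y - x)) * m y * (if norm (y - x) < \<tau> then 1 else 0)) \<partial>lborel) \<partial>lborel)"
  proof (rule nn_integral_cong)
    fix \<tau> :: real
    show "(\<integral>\<^sup>+z. ennreal (norm z) * (m (x + \<tau> *\<^sub>R z) * indicator {0<..} \<tau>) * indicator (ball 0 1) z \<partial>lborel) =
      (\<integral>\<^sup>+y. ennreal (inverse \<tau> ^ (?N + 1)) * (ennreal (norm (y - x)) * m y * (if norm (y - x) < \<tau> then 1 else 0)) \<partial>lborel)"
    proof (cases "0 < \<tau>")
      case True
      have "(\<integral>\<^sup>+y. ennreal (inverse \<tau> ^ (?N + 1)) * (ennreal (norm (y - x)) * m y * (if norm (y - x) < \<tau> then 1 else 0)) \<partial>lborel) =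
        ennreal (\<tau> ^ ?N) * (\<integral>\<^sup>+z. ennreal (inverse \<tau> ^ (?N + 1)) *
           (ennreal (norm (x + \<tau> *\<^sub>R z - x)) * m (x + \<tau> *\<^sub>R z) * (if norm (x + \<tau> *\<^sub>R z - x) < \<tau> then 1 else 0)) \<partial>lborel)"
        by (rule nn_integral_lborel_affine[OF _ True]) measurable
      also have "\<dots> = (\<integral>\<^sup>+z. ennreal (\<tau> ^ ?N) * (ennreal (inverse \<tau> ^ (?N + 1)) *
           (ennreal (norm (x + \<tau> *\<^sub>R z - x)) * m (x + \<tau> *\<^sub>R z) * (if norm (x + \<tau> *\<^sub>R z - x) < \<tau> then 1 else 0))) \<partial>lborel)"
        by (rule nn_integral_cmult[symmetric]) measurable
      also have "\<dots> = (\<integral>\<^sup>+z. ennreal (norm z) * (m (x + \<tau> *\<^sub>R z) * indicator {0<..} \<tau>) * indicator (ball 0 1) z \<partial>lborel)"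
      proof (rule nn_integral_cong)
        fix z :: 'a
        have "\<tau> ^ ?N * (inverse \<tau> ^ (?N + 1) * (\<tau> * norm z)) = norm z"
          using True by (simp add: power_inverse field_simps)
        then have "ennreal (\<tau> ^ ?N) * (ennreal (inverse \<tau> ^ (?N + 1)) * ennreal (norm (x + \<tau> *\<^sub>R z - x))) = ennreal (norm z)"
          using True by (simp add: ennreal_mult'[symmetric] del: power_Suc)
        moreover have "(if norm (x + \<tau> *\<^sub>R z - x) < \<tau> then 1 else 0) = (indicator (ball 0 1) z :: ennreal)"
          using True by (auto simp: indicator_def)
        moreover have "A * (B * (C * D * I)) = A * (B * C) * (D * 1) * I" for A B C D I :: ennreal
          by (simp only: ac_simps mult_1_right)
        moreover have "indicator {0<..} \<tau> = (1 :: ennreal)" using True by simp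
        ultimately show "ennreal (\<tau> ^ ?N) * (ennreal (inverse \<tau> ^ (?N + 1)) *
           (ennreal (norm (x + \<tau> *\<^sub>R z - x)) * m (x + \<tau> *\<^sub>R z) * (if norm (x + \<tau> *\<^sub>R z - x) < \<tau> then 1 else 0))) =
           ennreal (norm z) * (m (x + \<tau> *\<^sub>R z) * indicator {0<..} \<tau>) * indicator (ball 0 1) z"
          by (simp only:)
      qed
      finally show ?thesis ..
    next
      case False
      then have "(if norm (y - x) < \<tau> then 1 else 0) = (0::ennreal)" for y
        using norm_ge_zero[of "y - x"] by (auto simp: not_less simp del: norm_ge_zero dest: order_le_less_trans)
      with False show ?thesis by simp
    qed
  qed
  also have "\<dots> = (\<integral>\<^sup>+y. (\<integral>\<^sup>+\<tau>. ennreal (inverse \<tau> ^ (?N + 1)) * (ennreal (norm (y - x)) * m y * (if norm (y - x) < \<tau> then 1 else 0)) \<partial>lborel) \<partial>lborel)"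
    by (rule lborel_pair.Fubini') measurable
  also have "\<dots> \<le> (\<integral>\<^sup>+y. m y * ennreal (1 / norm (x - y) ^ (?N - 1)) \<partial>lborel)"
  proof (rule nn_integral_mono_AE)
    have "AE y in lborel. y \<noteq> x" by (rule AE_lborel_singleton)
    then show "AE y in lborel. (\<integral>\<^sup>+\<tau>. ennreal (inverse \<tau> ^ (?N + 1)) * (ennreal (norm (y - x)) * m y * (if norm (y - x) < \<tau> then 1 else 0)) \<partial>lborel)
       \<le> m y * ennreal (1 / norm (x - y) ^ (?N - 1))"
    proof eventually_elim
      fix y assume "y \<noteq> x"
      define r where "r = norm (x - y)"
      have r: "0 < r" "norm (y - x) = r" using \<open>y \<noteq> x\<close> by (auto simp: r_def norm_minus_commute)
      have "(\<integral>\<^sup>+\<tau>. ennreal (inverse \<tau> ^ (?N + 1)) * (ennreal r * m y * (if r < \<tau> then 1 else 0)) \<partial>lborel) \<le>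
          (\<integral>\<^sup>+\<tau>. (ennreal r * m y) * (ennreal (inverse \<tau> ^ (?N + 1)) * indicator {r..} \<tau>) \<partial>lborel)"
        by (intro nn_integral_mono) (auto simp: indicator_def mult.commute)
      also have "\<dots> = (ennreal r * m y) * ennreal (inverse r ^ ?N / real ?N)"
        using r(1) by (subst nn_integral_cmult) (simp_all only: nn_integral_inverse_power DIM_positive, measurable)
      also have "\<dots> = m y * ennreal (r * (inverse r ^ ?N / real ?N))"
        unfolding ennreal_mult'[OF less_imp_le[OF r(1)]] by (simp only: ac_simps)
      also have "\<dots> \<le> m y * ennreal (1 / r ^ (?N - 1))"
      proof (intro mult_left_mono ennreal_leI)
        obtain l where l: "?N = Suc l" using DIM_positive gr0_implies_Suc by blast
        have "r * (inverse r ^ ?N / real ?N) = (1 / r ^ (?N - 1)) / real ?N"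
        proof -
          have "r * (inverse r ^ ?N / real ?N) = (r * inverse r) * inverse r ^ l / real ?N" by (simp add: l)
          then show ?thesis using r(1) by (simp add: l inverse_eq_divide power_divide)
        qed
        also have "\<dots> \<le> 1 / r ^ (?N - 1)"
          using r(1) divide_left_mono[of 1 "real ?N" "1 / r ^ (?N - 1)"] DIM_positive[where 'a='a] by simp
        finally show "r * (inverse r ^ ?N / real ?N) \<le> 1 / r ^ (?N - 1)" .
      qed simp
      finally show "(\<integral>\<^sup>+\<tau>. ennreal (inverse \<tau> ^ (?N + 1)) * (ennreal (norm (y - x)) * m y * (if norm (y - x) < \<tau> then 1 else 0)) \<partial>lborel)
         \<le> m y * ennreal (1 / norm (x - y) ^ (?N - 1))"
        unfolding r(2) unfolding r_def .
    qed
  qed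
  finally show ?thesis .
qed

section \<open>Cone measure and Hausdorff measure\<close>

text \<open>Points at spacing \<open>1/k\<close>, at most \<open>d\<close>, carry
  \<open>k + 1\<close> balls of radius \<open>2 d\<close> that cover the neighbourhood. Since
  \<open>k < 1/d + 1\<close> and \<open>d\<close> \<le> 2, \<open>(k + 1) * d\<close> is at most 5,
  which absorbs one power of \<open>d\<close>.\<close>

lemma emeasure_segment_neighbourhood_le:
  fixes e :: "'a::euclidean_space"
  assumes e: "norm e \<le> 1" and d: "0 < d" "d \<le> 2"
  shows "emeasure lborel {z. \<exists>r\<in>{0..1}. dist z (r *\<^sub>R e) \<le> d}
    \<le> ennreal (5 * 2 ^ DIM('a) * unit_ball_vol DIM('a) * d ^ (DIM('a) - 1))"
proof -
  define k where "k = nat \<lceil>1 / d\<rceil>"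
  have k: "1 / d \<le> real k" "real k < 1 / d + 1" "0 < real k"
    using d unfolding k_def by (simp_all add: ceiling_correct) linarith+
  let ?B = "\<lambda>i::nat. cball ((real i / real k) *\<^sub>R e) (2 * d)"
  have "{z. \<exists>r\<in>{0..1}. dist z (r *\<^sub>R e) \<le> d} \<subseteq> (\<Union>i\<in>{..k}. ?B i)"
  proof safe
    fix z r assume r: "r \<in> {0..1::real}" and z: "dist z (r *\<^sub>R e) \<le> d"
    define i where "i = nat \<lfloor>r * real k\<rfloor>"
    have i: "real i \<le> r * real k" "r * real k < real i + 1"
      using r unfolding i_def by (simp_all add: floor_correct)
    have "r * real k \<le> 1 * real k" using r by (intro mult_right_mono) auto
    with i have "i \<le> k" by simp
    have "\<bar>r - real i / real k\<bar> \<le> 1 / real k"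
    proof -
      have "r - real i / real k = (r * real k - real i) / real k" using k(3) by (simp add: field_simps)
      moreover have "\<bar>r * real k - real i\<bar> \<le> 1" using i by simp
      ultimately show ?thesis using k(3) by (simp add: divide_right_mono)
    qed
    also have "\<dots> \<le> d" using k d by (simp add: field_simps)
    finally have "dist (r *\<^sub>R e) ((real i / real k) *\<^sub>R e) \<le> d"
      using e mult_mono[of "\<bar>r - real i / real k\<bar>" d "norm e" 1] d
      by (simp add: dist_norm scaleR_diff_left[symmetric])
    then have "dist z ((real i / real k) *\<^sub>R e) \<le> 2 * d"
      using z dist_triangle[of z "(real i / real k) *\<^sub>R e" "r *\<^sub>R e"] by simp
    with \<open>i \<le> k\<close> show "z \<in> (\<Union>i\<in>{..k}. ?B i)"
      by (auto simp: dist_commute)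
  qed
  then have "emeasure lborel {z. \<exists>r\<in>{0..1}. dist z (r *\<^sub>R e) \<le> d} \<le> emeasure lborel (\<Union>i\<in>{..k}. ?B i)"
    by (rule emeasure_mono) (auto intro!: sets.finite_UN)
  also have "\<dots> \<le> (\<Sum>i\<in>{..k}. emeasure lborel (?B i))"
    by (rule emeasure_subadditive_finite) auto
  also have "\<dots> = ennreal (real (k + 1) * (unit_ball_vol DIM('a) * (2 * d) ^ DIM('a)))"
    using d by (simp add: emeasure_cball ennreal_of_nat_eq_real_of_nat ennreal_mult' del: of_nat_Suc)
  also have "\<dots> \<le> ennreal (5 * 2 ^ DIM('a) * unit_ball_vol DIM('a) * d ^ (DIM('a) - 1))"
  proof (rule ennreal_leI)
    obtain l where l: "DIM('a) = Suc l" using DIM_positive gr0_implies_Suc by blast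
    have "real (k + 1) * d \<le> 5" using mult_right_mono[of "real k" "1 / d + 1" d] k d by (simp add: algebra_simps)
    then have "real (k + 1) * d * (2 ^ DIM('a) * unit_ball_vol DIM('a) * d ^ l) \<le> 5 * (2 ^ DIM('a) * unit_ball_vol DIM('a) * d ^ l)"
      using d by (intro mult_right_mono) auto
    then show "real (k + 1) * (unit_ball_vol DIM('a) * (2 * d) ^ DIM('a)) \<le> 5 * 2 ^ DIM('a) * unit_ball_vol DIM('a) * d ^ (DIM('a) - 1)"
      by (simp add: l power_mult_distrib ac_simps)
  qed
  finally show ?thesis .
qed

text \<open>Covering sets may have diameter 0, so \<open>d = 0\<close> must be included; it is
  reached as a limit of larger \<open>d'\<close>. The range up to 2 in the previous lemma leaves
  room above \<open>d = 1\<close>.\<close>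

lemma emeasure_segment_neighbourhood_le':
  fixes e :: "'a::euclidean_space"
  assumes e: "norm e \<le> 1" and d: "0 \<le> d" "d \<le> 1"
  shows "emeasure lborel {z. \<exists>r\<in>{0..1}. dist z (r *\<^sub>R e) \<le> d}
    \<le> ennreal (5 * 2 ^ DIM('a) * unit_ball_vol DIM('a) * d ^ (DIM('a) - 1))"
proof -
  let ?S = "\<lambda>d. {z. \<exists>r\<in>{0..1}. dist z (r *\<^sub>R e) \<le> d}"
  let ?f = "\<lambda>d. ennreal (5 * 2 ^ DIM('a) * unit_ball_vol DIM('a) * d ^ (DIM('a) - 1))"
  have S: "closed (?S d')" for d'
  proof -
    have "closed {z. \<exists>r. r \<in> {0..1} \<and> (r, z) \<in> {p. dist (snd p) (fst p *\<^sub>R e) \<le> d'}}"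
      by (rule closed_compact_projection[OF compact_Icc]) (intro closed_Collect_le continuous_intros)
    then show ?thesis by (simp add: Bex_def)
  qed
  have "(?f \<longlongrightarrow> ?f d) (at_right d)"
    by (intro tendsto_ennrealI tendsto_intros)
  moreover have "eventually (\<lambda>d'. emeasure lborel (?S d) \<le> ?f d') (at_right d)"
    unfolding eventually_at_right_field
  proof (intro exI[of _ 2] conjI allI impI)
    fix d' assume d': "d < d'" "d' < 2"
    have "emeasure lborel (?S d) \<le> emeasure lborel (?S d')"
    proof (rule emeasure_mono)
      show "?S d \<subseteq> ?S d'"
      proof safe
        fix z r assume "r \<in> {0..1::real}" "dist z (r *\<^sub>R e) \<le> d"
        then show "\<exists>r\<in>{0..1}. dist z (r *\<^sub>R e) \<le> d'" using d'(1) by (intro bexI[of _ r]) auto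
      qed
    qed (use S[of d'] in simp)
    also have "\<dots> \<le> ?f d'" using d d' by (intro emeasure_segment_neighbourhood_le e) auto
    finally show "emeasure lborel (?S d) \<le> ?f d'" .
  qed (use d in simp)
  ultimately show ?thesis by (rule tendsto_lowerbound) simp
qed

text \<open>The cone over a subset of the sphere of diameter \<open>d\<close> lies in the \<open>d\<close>-neighbourhood of a
  segment, whose volume is of order \<open>d ^ (DIM('a) - 1)\<close>.\<close>
lemma cone_measure_le_hausdorff:
  fixes A :: "'a::euclidean_space set"
  assumes dim: "2 \<le> DIM('a)" and A: "A \<in> sets borel" "A \<subseteq> sphere 0 1"
  shows "emeasure lborel {z \<in> ball 0 1. sgn z \<in> A} \<le>
    ennreal (10 ^ DIM('a) * unit_ball_vol DIM('a) / unit_ball_vol (real (DIM('a) - 1))) *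
    hausdorff_outer (DIM('a) - 1) A"
proof -
  let ?N = "DIM('a)"
  let ?V = "unit_ball_vol (real (?N - 1))"
  let ?C = "10 ^ ?N * unit_ball_vol ?N / ?V"
  have V: "0 < ?V" by simp
  have C: "0 < ?C" by simp
  have "ennreal (inverse c) * ennreal c = 1 \<and> ennreal c * ennreal (inverse c) = 1" if "0 < c" for c
    using that by (simp add: ennreal_mult'[symmetric])
  from this[OF C] have inv: "ennreal (inverse ?C) * ennreal ?C = 1" "ennreal ?C * ennreal (inverse ?C) = 1"
    by blast+
  \<comment> \<open>Covers at the single scale 1 suffice, because the premeasure at any scale is a
    lower bound for \<open>hausdorff_outer\<close>.\<close>
  have cover: "emeasure lborel {z \<in> ball 0 1. sgn z \<in> A} \<le> ennreal ?C * (\<Sum>i. hausdorff_weight (?N - 1) (U i))"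
    if U: "U \<in> hausdorff_covers 1 A" for U
  proof -
    \<comment> \<open>The sets \<open>U i\<close> are arbitrary, so each is replaced by a closed
      neighbourhood of one radius that meets it. Those missing the sphere cover nothing of
      \<open>A\<close> and are discarded.\<close>
    define W where "W i = (if U i \<inter> sphere 0 1 = {} then {} else
      {z. \<exists>r\<in>{0..1}. dist z (r *\<^sub>R (SOME e. e \<in> U i \<inter> sphere 0 1)) \<le> diameter (U i)})" for i
    have bU: "bounded (U i)" "diameter (U i) \<le> 1" for i
      using U unfolding hausdorff_covers_def mem_Collect_eq by blast+
    have some: "(SOME e. e \<in> U i \<inter> sphere 0 1) \<in> U i \<inter> sphere 0 1" if "U i \<inter> sphere 0 1 \<noteq> {}" for i
      by (rule someI_ex[of "\<lambda>e. e \<in> U i \<inter> sphere 0 1"]) (use that in blast)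
    have W_closed: "closed (W i)" for i
    proof -
      have "closed {z. \<exists>r. r \<in> {0..1} \<and> (r, z) \<in> {p. dist (snd p) (fst p *\<^sub>R (SOME e. e \<in> U i \<inter> sphere 0 1)) \<le> diameter (U i)}}"
        by (rule closed_compact_projection[OF compact_Icc]) (intro closed_Collect_le continuous_intros)
      then show ?thesis by (simp add: Bex_def W_def)
    qed
    have W_le: "emeasure lborel (W i) \<le> ennreal ?C * hausdorff_weight (?N - 1) (U i)" for i
    proof (cases "U i \<inter> sphere 0 1 = {}")
      case False
      let ?d = "diameter (U i)"
      have "emeasure lborel (W i) \<le> ennreal (5 * 2 ^ ?N * unit_ball_vol ?N * ?d ^ (?N - 1))"
      proof -
        have "norm (SOME e. e \<in> U i \<inter> sphere 0 1) \<le> 1" using some[OF False] by simp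
        from emeasure_segment_neighbourhood_le'[OF this diameter_ge_0[OF bU(1)] bU(2), of i]
        show ?thesis unfolding W_def if_not_P[OF False] .
      qed
      also have "\<dots> \<le> ennreal (?C * (?V * (?d / 2) ^ (?N - 1)))"
      proof (rule ennreal_leI)
        \<comment> \<open>The factor \<open>2 ^ (?N - 1)\<close> compensates for the halved diameter
          in \<open>hausdorff_weight\<close>; with \<open>?N = Suc l\<close> the product is
          \<open>10 * 4 ^ l\<close>.\<close>
        have "(5 * 2 ^ ?N * 2 ^ (?N - 1) :: real) \<le> 10 ^ ?N"
        proof -
          obtain l where l: "?N = Suc l" "1 \<le> l" using dim by (cases ?N) auto
          have "(4::real) ^ l \<le> 10 ^ l" by (intro power_mono) auto
          moreover have "(2::real) ^ l * 2 ^ l = 4 ^ l" by (simp add: power_mult_distrib[symmetric])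
          ultimately show ?thesis by (simp add: l)
        qed
        then have "5 * 2 ^ ?N * 2 ^ (?N - 1) * (unit_ball_vol ?N * (?d / 2) ^ (?N - 1)) \<le>
            10 ^ ?N * (unit_ball_vol ?N * (?d / 2) ^ (?N - 1))"
          using diameter_ge_0[OF bU(1), of i] by (intro mult_right_mono) auto
        moreover have "5 * 2 ^ ?N * unit_ball_vol ?N * ?d ^ (?N - 1) =
            5 * 2 ^ ?N * 2 ^ (?N - 1) * (unit_ball_vol ?N * (?d / 2) ^ (?N - 1))"
          by (simp add: power_divide)
        moreover have "a * b / c * (c * w) = a * (b * w)" if "0 < c" for a b c w :: real
          using that by simp
        note this[OF V, of "10 ^ ?N" "unit_ball_vol ?N" "(?d / 2) ^ (?N - 1)"]
        ultimately show "5 * 2 ^ ?N * unit_ball_vol ?N * ?d ^ (?N - 1) \<le> ?C * (?V * (?d / 2) ^ (?N - 1))"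
          by (simp only:)
      qed
      also have "\<dots> = ennreal ?C * hausdorff_weight (?N - 1) (U i)"
      proof -
        have "U i \<noteq> {}" using False by blast
        then have "hausdorff_weight (?N - 1) (U i) = ennreal (?V * (?d / 2) ^ (?N - 1))"
          by (simp only: hausdorff_weight_def if_False)
        then show ?thesis by (simp only: ennreal_mult'[OF less_imp_le[OF C]])
      qed
      finally show ?thesis .
    qed (simp add: W_def)
    have "{z \<in> ball 0 1. sgn z \<in> A} \<subseteq> (\<Union>i. W i)"
    proof safe
      fix z :: 'a assume z: "z \<in> ball 0 1" "sgn z \<in> A"
      then obtain i where i: "sgn z \<in> U i" using U unfolding hausdorff_covers_def by blast
      have ne: "U i \<inter> sphere 0 1 \<noteq> {}" using i z(2) A(2) by blast
      let ?e = "SOME e. e \<in> U i \<inter> sphere 0 1"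
      have e: "?e \<in> U i" using some[OF ne] by blast
      have "dist (sgn z) ?e \<le> diameter (U i)"
        by (rule diameter_bounded_bound[OF bU(1) i e])
      moreover have "dist z (norm z *\<^sub>R ?e) = norm z * dist (sgn z) ?e"
      proof -
        have "z = norm z *\<^sub>R sgn z" by (cases "z = 0") (simp_all add: sgn_div_norm)
        then have "z - norm z *\<^sub>R ?e = norm z *\<^sub>R (sgn z - ?e)"
          by (simp only: scaleR_diff_right)
        then show ?thesis by (simp add: dist_norm)
      qed
      moreover have "norm z * dist (sgn z) ?e \<le> 1 * dist (sgn z) ?e"
        using z by (intro mult_right_mono) auto
      ultimately have "dist z (norm z *\<^sub>R ?e) \<le> diameter (U i)" by simp
      then have "z \<in> W i" using ne z(1) by (auto simp: W_def intro!: bexI[of _ "norm z"])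
      then show "z \<in> (\<Union>i. W i)" by blast
    qed
    then have "emeasure lborel {z \<in> ball 0 1. sgn z \<in> A} \<le> emeasure lborel (\<Union>i. W i)"
      using W_closed by (intro emeasure_mono) auto
    also have "\<dots> \<le> (\<Sum>i. emeasure lborel (W i))"
      using W_closed by (intro emeasure_subadditive_countably) auto
    also have "\<dots> \<le> (\<Sum>i. ennreal ?C * hausdorff_weight (?N - 1) (U i))"
      by (intro suminf_le W_le) auto
    finally show ?thesis by simp
  qed
  \<comment> \<open>The constant is moved to the left so that the estimate becomes a lower bound for
    the bare sums, as the infimum over covers requires.\<close>
  have "ennreal (inverse ?C) * emeasure lborel {z \<in> ball 0 1. sgn z \<in> A} \<le> hausdorff_premeasure (?N - 1) 1 A"
    unfolding hausdorff_premeasure_def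
  proof (rule INF_greatest)
    fix U assume "U \<in> hausdorff_covers 1 A"
    from mult_left_mono[OF cover[OF this], of "ennreal (inverse ?C)"]
    show "ennreal (inverse ?C) * emeasure lborel {z \<in> ball 0 1. sgn z \<in> A} \<le> (\<Sum>i. hausdorff_weight (?N - 1) (U i))"
      by (simp only: mult.assoc[symmetric] inv(1) mult_1_left zero_le)
  qed
  also have "\<dots> \<le> hausdorff_outer (?N - 1) A" by (rule hausdorff_outer_ge) simp
  finally have "ennreal ?C * (ennreal (inverse ?C) * emeasure lborel {z \<in> ball 0 1. sgn z \<in> A}) \<le>
     ennreal ?C * hausdorff_outer (?N - 1) A"
    by (rule mult_left_mono) simp
  then show ?thesis
    by (simp only: mult.assoc[symmetric] inv(2) mult_1_left)
qed

text \<open>The estimate for sets is an order relation between two Borel measures, the image under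
  \<open>sgn\<close> of Lebesgue measure on the ball and a multiple of Hausdorff measure on the
  sphere, and so passes to integrals.\<close>

lemma nn_integral_cone_le_hausdorff:
  fixes f :: "'a::euclidean_space \<Rightarrow> ennreal"
  assumes dim: "2 \<le> DIM('a)" and f [measurable]: "f \<in> borel_measurable borel"
  shows "(\<integral>\<^sup>+z\<in>ball 0 1. f (sgn z) \<partial>lborel) \<le>
    ennreal (10 ^ DIM('a) * unit_ball_vol DIM('a) / unit_ball_vol (real (DIM('a) - 1))) *
    (\<integral>\<^sup>+\<theta>\<in>sphere 0 1. f \<theta> \<partial>hausdorff_measure (DIM('a) - 1))"
proof -
  let ?C = "ennreal (10 ^ DIM('a) * unit_ball_vol DIM('a) / unit_ball_vol (real (DIM('a) - 1)))"
  let ?H = "hausdorff_measure (DIM('a) - 1) :: 'a measure"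
  have [measurable]: "ball (0::'a) 1 \<in> sets borel" "sphere (0::'a) 1 \<in> sets borel" by simp_all
  let ?M = "distr (density lborel (indicator (ball (0::'a) 1))) borel sgn"
  let ?N = "scale_measure ?C (density ?H (indicator (sphere 0 1)))"
  have "emeasure ?M A \<le> emeasure ?N A" if A [measurable]: "A \<in> sets borel" for A
  proof -
    have [measurable]: "sgn -` A \<in> sets (borel :: 'a measure)"
      using measurable_sets[OF borel_measurable_sgn A] by simp
    \<comment> \<open>The origin is removed because \<open>sgn 0 = 0\<close> does not lie on the
      sphere.\<close>
    have "AE z in lborel. z \<noteq> (0::'a)" by (rule AE_lborel_singleton)
    then have "AE z in lborel. indicator (ball 0 1) z * indicator (sgn -` A) z
        = (indicator {z \<in> ball 0 1. sgn z \<in> A \<inter> sphere 0 1} z :: ennreal)"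
      by eventually_elim (auto simp: indicator_def norm_sgn)
    then have "emeasure ?M A = (\<integral>\<^sup>+z. indicator {z \<in> ball 0 1. sgn z \<in> A \<inter> sphere 0 1} z \<partial>lborel)"
      by (simp add: emeasure_distr emeasure_density nn_integral_cong_AE)
    also have "\<dots> = emeasure lborel {z \<in> ball 0 1. sgn z \<in> A \<inter> sphere 0 1}"
      by (rule nn_integral_indicator) measurable
    also have "\<dots> \<le> ?C * hausdorff_outer (DIM('a) - 1) (A \<inter> sphere 0 1)"
      by (rule cone_measure_le_hausdorff[OF dim]) auto
    also have "hausdorff_outer (DIM('a) - 1) (A \<inter> sphere 0 1) = emeasure ?H (A \<inter> sphere 0 1)"
      by (rule emeasure_hausdorff_measure[symmetric]) simp
    also have "\<dots> = emeasure (density ?H (indicator (sphere 0 1))) A"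
      by (subst emeasure_density) (auto simp: indicator_inter_arith[symmetric] Int_commute)
    finally show ?thesis by simp
  qed
  then have "?M \<le> ?N" by (subst le_measure) auto
  then have "(\<integral>\<^sup>+\<theta>. f \<theta> \<partial>?M) \<le> (\<integral>\<^sup>+\<theta>. f \<theta> \<partial>?N)"
    by (intro nn_integral_mono_measure) auto
  moreover have "(\<integral>\<^sup>+\<theta>. f \<theta> \<partial>?M) = (\<integral>\<^sup>+z\<in>ball 0 1. f (sgn z) \<partial>lborel)"
    by (subst nn_integral_distr) (auto simp: nn_integral_density mult.commute)
  moreover have "(\<integral>\<^sup>+\<theta>. f \<theta> \<partial>?N) = ?C * (\<integral>\<^sup>+\<theta>\<in>sphere 0 1. f \<theta> \<partial>?H)"
    by (subst nn_integral_scale_measure) (auto simp: nn_integral_density mult.commute)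
  ultimately show ?thesis by simp
qed

section \<open>Averaging over directions close to \<open>u x\<close>\<close>

lemma ex_borel_norm:
  fixes E :: "real^'n::finite \<Rightarrow> 'b::euclidean_space"
  assumes \<Omega>: "open \<Omega>" and E: "E locally_integrable_on \<Omega>"
  obtains m :: "real^'n \<Rightarrow> ennreal" where "m \<in> borel_measurable borel"
    "AE y in lebesgue. ennreal (norm (E y)) * indicator \<Omega> y = m y"
proof -
  obtain D where D: "countable D" "D \<subseteq> Pow \<Omega>" "\<And>X. X \<in> D \<Longrightarrow> \<exists>a b. X = cbox a b" "\<Union>D = \<Omega>"
    using open_countable_Union_open_cbox[OF \<Omega>] by metis
  \<comment> \<open>Local integrability gives measurability only on compact pieces; a countable
    supremum over boxes glues them, and the completion then provides a Borel version.\<close>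
  have "(\<lambda>y. SUP X\<in>D. ennreal (norm (indicat_real X y *\<^sub>R E y))) \<in> borel_measurable lebesgue"
  proof (rule borel_measurable_SUP[OF D(1)])
    fix X assume X: "X \<in> D"
    then have "compact X" "X \<subseteq> \<Omega>" using D(2) D(3)[OF X] by auto
    then have "integrable lebesgue (\<lambda>y. indicat_real X y *\<^sub>R E y)"
      using E by (simp add: locally_integrable_on_def set_integrable_def)
    then have "(\<lambda>y. indicat_real X y *\<^sub>R E y) \<in> borel_measurable lebesgue"
      by (rule borel_measurable_integrable)
    then show "(\<lambda>y. ennreal (norm (indicat_real X y *\<^sub>R E y))) \<in> borel_measurable lebesgue"
      by measurable
  qed
  also have "(\<lambda>y. SUP X\<in>D. ennreal (norm (indicat_real X y *\<^sub>R E y))) = (\<lambda>y. ennreal (norm (E y)) * indicator \<Omega> y)"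
  proof
    fix y
    show "(SUP X\<in>D. ennreal (norm (indicat_real X y *\<^sub>R E y))) = ennreal (norm (E y)) * indicator \<Omega> y"
    proof (rule antisym)
      show "(SUP X\<in>D. ennreal (norm (indicat_real X y *\<^sub>R E y))) \<le> ennreal (norm (E y)) * indicator \<Omega> y"
        using D(4) by (intro SUP_least) (auto simp: indicator_def)
      show "ennreal (norm (E y)) * indicator \<Omega> y \<le> (SUP X\<in>D. ennreal (norm (indicat_real X y *\<^sub>R E y)))"
      proof (cases "y \<in> \<Omega>")
        case True
        then obtain X where X: "X \<in> D" "y \<in> X" using D(4) by blast
        then show ?thesis using True by (intro SUP_upper2[OF X(1)]) simp
      qed simp
    qed
  qed
  finally obtain m where "m \<in> borel_measurable lborel"
      "AE y in lborel. ennreal (norm (E y)) * indicator \<Omega> y = m y"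
    using completion_ex_borel_measurable by blast
  with that show ?thesis by (simp add: AE_completion)
qed

text \<open>The left-hand side is the integral of the lower bound \<open>norm (u x) / 4\<close> over
  a ball of radius 1/4, whose centre exists because \<open>u x\<close> is nonzero. On the right the
  boundary part carries the constant of the cone comparison, the ray part the constant 1.\<close>

lemma pointwise_bound:
  fixes u :: "real^'n::finite \<Rightarrow> real^'n"
  assumes n: "2 \<le> CARD('n)" and \<Omega>: "open \<Omega>" and x: "x \<in> \<Omega>" and u: "u \<in> Cb (closure \<Omega>)"
    and E: "has_sym_grad \<Omega> u E" and ux: "u x \<noteq> 0"
  shows "ennreal (norm (u x) / 4 * (unit_ball_vol CARD('n) * (1/4) ^ CARD('n))) \<le>
    ennreal (10 ^ CARD('n) * unit_ball_vol CARD('n) / unit_ball_vol (real (CARD('n) - 1))) *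
      (\<integral>\<^sup>+\<theta>\<in>sphere 0 1. ennreal (norm (at_zeta u \<Omega> x \<theta>)) \<partial>hausdorff_measure (CARD('n) - 1)) +
    (\<integral>\<^sup>+y\<in>\<Omega>. ennreal (norm (E y) / norm (x - y) ^ (CARD('n) - 1)) \<partial>lebesgue)"
proof -
  let ?K = "ennreal (10 ^ CARD('n) * unit_ball_vol CARD('n) / unit_ball_vol (real (CARD('n) - 1)))"
  let ?H = "hausdorff_measure (CARD('n) - 1) :: (real^'n) measure"
  obtain m :: "real^'n \<Rightarrow> ennreal" where m [measurable]: "m \<in> borel_measurable borel"
    and ae: "AE y in lebesgue. ennreal (norm (E y)) * indicator \<Omega> y = m y"
    using ex_borel_norm[OF \<Omega> conjunct1[OF E[unfolded has_sym_grad_def]]] by blast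
  have cu: "continuous_on \<Omega> u"
    using u continuous_on_subset[OF _ closure_subset] by (auto simp: Cb_def)
  define S where "S = good_directions \<Omega> u m x \<inter> sphere 0 1"
  have [measurable]: "S \<in> sets borel"
    unfolding S_def using good_directions_borel[OF \<Omega> cu m] by simp
  \<comment> \<open>\<open>at_zeta\<close> need not be measurable, hence the Borel minorant \<open>P\<close>; the subtraction is truncated,
     and is \<open>0\<close> if the ray integral is infinite.\<close>
  define P where "P \<theta> = (ennreal (inner \<theta> (u x)) - ray_integral m x \<theta>) * indicator S \<theta>" for \<theta>
  have [measurable]: "P \<in> borel_measurable borel" unfolding P_def[abs_def] by measurable
  have P_le: "P \<theta> \<le> ennreal (norm (at_zeta u \<Omega> x \<theta>))" for \<theta>
  proof (cases "\<theta> \<in> S")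
    case True
    then show ?thesis
      using good_direction_bound[OF \<Omega> x u, of \<theta> m]
      by (auto simp: P_def S_def ennreal_minus_le_iff add.commute)
  qed (simp add: P_def)
  define e where "e = u x /\<^sub>R norm (u x)"
  have e: "norm e = 1" "u x = norm (u x) *\<^sub>R e" using ux by (simp_all add: e_def)
  \<comment> \<open>Points of \<open>B\<close> have norm below 3/4 and component along
    \<open>e\<close> at least 1/2 - 1/4, so \<open>B\<close> lies in the unit ball and stays away
    from the hyperplane orthogonal to \<open>u x\<close>.\<close>
  define B where "B = ball (e /\<^sub>R 2) (1/4)"
  have [measurable]: "B \<in> sets borel" "ball (0::real^'n) 1 \<in> sets borel" by (simp_all add: B_def)
  have B: "norm z < 1" "norm (u x) / 4 \<le> inner z (u x)" if "z \<in> B" for z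
  proof -
    define w where "w = z - e /\<^sub>R 2"
    have w: "norm w < 1/4" using that by (simp add: w_def B_def dist_norm norm_minus_commute)
    have z: "z = e /\<^sub>R 2 + w" by (simp add: w_def)
    show "norm z < 1" using norm_triangle_ineq[of "e /\<^sub>R 2" w] w e(1) by (simp add: z)
    have "\<bar>inner w e\<bar> \<le> 1/4" using Cauchy_Schwarz_ineq2[of w e] w e(1) by simp
    moreover have "inner z e = 1/2 + inner w e"
      using e(1) by (simp add: z inner_add_left power2_norm_eq_inner[symmetric])
    ultimately have "1/4 \<le> inner z e" by linarith
    then have "norm (u x) * (1/4) \<le> norm (u x) * inner z e" by (intro mult_left_mono) auto
    then show "norm (u x) / 4 \<le> inner z (u x)" by (subst (2) e(2)) simp
  qed
  have "ennreal (norm (u x) / 4 * (unit_ball_vol CARD('n) * (1/4) ^ CARD('n))) = ennreal (norm (u x) / 4) * emeasure lborel B"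
    unfolding B_def by (subst emeasure_ball) (simp_all add: ennreal_mult'[symmetric])
  also have "\<dots> = (\<integral>\<^sup>+z\<in>B. ennreal (norm (u x) / 4) \<partial>lborel)"
    by (simp add: nn_integral_cmult)
  also have "\<dots> \<le> (\<integral>\<^sup>+z. P (sgn z) * indicator (ball 0 1) z + ray_integral m x (sgn z) * indicator (ball 0 1) z \<partial>lborel)"
  proof (rule nn_integral_mono_AE)
    have "AE z in lborel. z \<in> good_directions \<Omega> u m x"
      by (rule AE_good_directions[OF \<Omega> cu E m ae])
    then show "AE z in lborel. ennreal (norm (u x) / 4) * indicator B z \<le>
       P (sgn z) * indicator (ball 0 1) z + ray_integral m x (sgn z) * indicator (ball 0 1) z"
    proof eventually_elim
      fix z assume z: "z \<in> good_directions \<Omega> u m x"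
      show "ennreal (norm (u x) / 4) * indicator B z \<le>
        P (sgn z) * indicator (ball 0 1) z + ray_integral m x (sgn z) * indicator (ball 0 1) z"
      proof (cases "z \<in> B")
        case True
        have pos: "0 < inner z (u x)" by (rule order_less_le_trans[OF _ B(2)[OF True]]) (use ux in simp)
        then have "z \<noteq> 0" by auto
        have "sgn z \<in> S"
          using good_directions_scaleR[OF m z, of "inverse (norm z)"] \<open>z \<noteq> 0\<close>
          by (simp add: S_def norm_sgn) (simp add: sgn_div_norm)
        have "norm (u x) / 4 \<le> inner z (u x)" by (rule B(2)[OF True])
        also have "\<dots> \<le> inner z (u x) / norm z"
          using pos B(1)[OF True] \<open>z \<noteq> 0\<close> by (simp add: field_simps mult_left_le)
        also have "\<dots> = inner (sgn z) (u x)" by (simp add: sgn_div_norm divide_inverse mult.commute)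
        finally have "ennreal (norm (u x) / 4) \<le> ennreal (inner (sgn z) (u x))" by (rule ennreal_leI)
        \<comment> \<open>Adding back the ray integral recovers the inner product, unless the
          subtraction was truncated; then the ray integral alone exceeds it.\<close>
        also have "\<dots> \<le> P (sgn z) + ray_integral m x (sgn z)"
          using \<open>sgn z \<in> S\<close> diff_add_cancel_ennreal[of "ray_integral m x (sgn z)" "ennreal (inner (sgn z) (u x))"]
          by (cases "ray_integral m x (sgn z) \<le> ennreal (inner (sgn z) (u x))")
            (auto simp: P_def not_le intro: order_trans[OF less_imp_le] add_increasing)
        finally show ?thesis using True B(1)[OF True] by simp
      qed simp
    qed
  qed
  also have "\<dots> = (\<integral>\<^sup>+z\<in>ball 0 1. P (sgn z) \<partial>lborel) + (\<integral>\<^sup>+z\<in>ball 0 1. ray_integral m x (sgn z) \<partial>lborel)"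
    by (rule nn_integral_add) measurable
  also have "(\<integral>\<^sup>+z\<in>ball 0 1. P (sgn z) \<partial>lborel) \<le> ?K * (\<integral>\<^sup>+\<theta>\<in>sphere 0 1. P \<theta> \<partial>?H)"
    using nn_integral_cone_le_hausdorff[of P] n by simp
  \<comment> \<open>Monotonicity asks nothing of the larger function: its integral is a supremum
    over the simple functions below it.\<close>
  also have "(\<integral>\<^sup>+\<theta>\<in>sphere 0 1. P \<theta> \<partial>?H) \<le> (\<integral>\<^sup>+\<theta>\<in>sphere 0 1. ennreal (norm (at_zeta u \<Omega> x \<theta>)) \<partial>?H)"
    by (intro nn_integral_mono mult_right_mono P_le) simp
  also have "(\<integral>\<^sup>+z\<in>ball 0 1. ray_integral m x (sgn z) \<partial>lborel) \<le>
      (\<integral>\<^sup>+y. m y * ennreal (1 / norm (x - y) ^ (CARD('n) - 1)) \<partial>lborel)"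
    using nn_integral_ray_integral_ball[OF m, of x] by simp
  also have "\<dots> = (\<integral>\<^sup>+y. m y * ennreal (1 / norm (x - y) ^ (CARD('n) - 1)) \<partial>lebesgue)"
    by (rule nn_integral_completion[symmetric])
  also have "\<dots> = (\<integral>\<^sup>+y\<in>\<Omega>. ennreal (norm (E y) / norm (x - y) ^ (CARD('n) - 1)) \<partial>lebesgue)"
  proof (rule nn_integral_cong_AE, use ae in eventually_elim)
    fix y assume m_eq: "ennreal (norm (E y)) * indicator \<Omega> y = m y"
    then show "m y * ennreal (1 / norm (x - y) ^ (CARD('n) - 1)) =
      ennreal (norm (E y) / norm (x - y) ^ (CARD('n) - 1)) * indicator \<Omega> y"
      unfolding m_eq[symmetric] by (cases "y \<in> \<Omega>") (simp_all add: ennreal_mult'[symmetric])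
  qed
  finally show ?thesis by (simp add: add_mono mult_left_mono)
qed

theorem theorem2p1:
  assumes "CARD('n::finite) \<ge> 2"
  shows "\<exists>C::real. C > 0 \<and>
    (\<forall>\<Omega> :: (real^'n) set. open \<Omega> \<longrightarrow>
      (\<forall>u \<in> E11 \<Omega> \<inter> Cb (closure \<Omega>). \<forall>E. has_sym_grad \<Omega> u E \<longrightarrow>
        (\<forall>x\<in>\<Omega>.
          ennreal (norm (u x))
            \<le> ennreal C * (\<integral>\<^sup>+\<theta>\<in>sphere 0 1. ennreal (norm (at_zeta u \<Omega> x \<theta>)) \<partial>hausdorff_measure (CARD('n) - 1))
              + ennreal C * (\<integral>\<^sup>+y\<in>\<Omega>. ennreal (norm (E y) / norm (x - y) ^ (CARD('n) - 1)) \<partial>lebesgue))))"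
proof -
  define K where "K = 10 ^ CARD('n) * unit_ball_vol CARD('n) / unit_ball_vol (real (CARD('n) - 1))"
  define b where "b = unit_ball_vol CARD('n) * (1/4) ^ CARD('n) / 4"
  \<comment> \<open>\<open>K + 1\<close> dominates both constants of \<open>pointwise_bound\<close>,
    \<open>K\<close> and 1; \<open>b\<close> is the coefficient of \<open>norm (u x)\<close>
    there.\<close>
  define C where "C = (K + 1) / b"
  have "0 \<le> K" "0 < b" by (simp_all add: K_def b_def)
  then have "0 < C" by (simp add: C_def)
  moreover have "ennreal (norm (u x)) \<le>
      ennreal C * (\<integral>\<^sup>+\<theta>\<in>sphere 0 1. ennreal (norm (at_zeta u \<Omega> x \<theta>)) \<partial>hausdorff_measure (CARD('n) - 1))
      + ennreal C * (\<integral>\<^sup>+y\<in>\<Omega>. ennreal (norm (E y) / norm (x - y) ^ (CARD('n) - 1)) \<partial>lebesgue)"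
    (is "_ \<le> ennreal C * ?A + ennreal C * ?I")
    if "open \<Omega>" "u \<in> Cb (closure \<Omega>)" "has_sym_grad \<Omega> u E" "x \<in> \<Omega>"
    for \<Omega> :: "(real^'n) set" and u E x
  proof (cases "u x = 0")
    case False
    have "ennreal (norm (u x)) = ennreal (1 / b) * ennreal (norm (u x) * b)"
      using \<open>0 < b\<close> by (simp add: ennreal_mult'[symmetric])
    also have "norm (u x) * b = norm (u x) / 4 * (unit_ball_vol CARD('n) * (1/4) ^ CARD('n))"
      by (simp add: b_def)
    also have "ennreal (1 / b) * ennreal \<dots> \<le> ennreal (1 / b) * (ennreal K * ?A + ?I)"
      unfolding K_def by (intro mult_left_mono pointwise_bound assms that False) auto
    also have "\<dots> \<le> ennreal (1 / b) * (ennreal (K + 1) * ?A + ennreal (K + 1) * ?I)"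
    proof (intro mult_left_mono add_mono)
      show "ennreal K * ?A \<le> ennreal (K + 1) * ?A" by (intro mult_right_mono ennreal_leI) auto
      have "1 * ?I \<le> ennreal (K + 1) * ?I"
        using \<open>0 \<le> K\<close> by (intro mult_right_mono) auto
      then show "?I \<le> ennreal (K + 1) * ?I" by simp
    qed auto
    also have "\<dots> = (ennreal (1 / b) * ennreal (K + 1)) * ?A + (ennreal (1 / b) * ennreal (K + 1)) * ?I"
      by (simp only: distrib_left mult.assoc)
    also have "ennreal (1 / b) * ennreal (K + 1) = ennreal C"
      using \<open>0 < b\<close> by (simp add: C_def ennreal_mult'[symmetric])
    finally show ?thesis .
  qed simp
  ultimately show ?thesis by blast
qed

end
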